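(* Let $t\ge 2$ be an integer. Every $K_{2,t}$-free planar graph $G$ with maximum degree $\Delta>428$ satisfies $q_B(G)\le \Delta+t-1$.
   Context: All graphs are finite, simple and undirected. An edge-coloring is proper if incident edges receive distinct colors. A B-coloring of a graph $G$ is a proper edge-coloring in which the four edges of every $4$-cycle (not necessarily induced) receive pairwise distinct colors. The B-coloring number $q_B(G)$ is the minimum number of colors in a B-coloring of $G$. For an integer $t\ge2$, a graph is $K_{2,t}$-free if any two distinct vertices have at most $t-1$ common neighbors. *)

theory Defs
  imports "HOL-Analysis.Analysis"
begin

definition simple_graph :: "'a set \<Rightarrow> 'a set set \<Rightarrow> bool" where
  "simple_graph V E \<longleftrightarrow> finite V \<and> (\<forall>e\<in>E. e \<subseteq> V \<and> card e = 2)"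

definition neighborhood :: "'a set set \<Rightarrow> 'a \<Rightarrow> 'a set" where
  "neighborhood E u = {v. {u, v} \<in> E}"

definition degree :: "'a set set \<Rightarrow> 'a \<Rightarrow> nat" where
  "degree E u = card (neighborhood E u)"

(* Inserting 0 only matters for the graph without vertices, where Max {} is unspecified. *)
definition max_degree :: "'a set \<Rightarrow> 'a set set \<Rightarrow> nat" where
  "max_degree V E = Max (insert 0 (degree E ` V))"

definition K2t_free :: "nat \<Rightarrow> 'a set \<Rightarrow> 'a set set \<Rightarrow> bool" where
  "K2t_free t V E \<longleftrightarrow>
     (\<forall>u\<in>V. \<forall>v\<in>V. u \<noteq> v \<longrightarrow> card (neighborhood E u \<inter> neighborhood E v) \<le> t - 1)"

(* A crossing-free drawing: p places the vertices and \<gamma> draws each edge as an arc, that is, as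
   an injective path on [0,1].  The plane is the type complex because the Jordan curve theorem
   of the library is stated there. *)
definition plane_drawing ::
  "'a set \<Rightarrow> 'a set set \<Rightarrow> ('a \<Rightarrow> complex) \<Rightarrow> ('a set \<Rightarrow> real \<Rightarrow> complex) \<Rightarrow> bool" where
  "plane_drawing V E p \<gamma> \<longleftrightarrow>
     inj_on p V \<and>
     (\<forall>e\<in>E. arc (\<gamma> e) \<and> {pathstart (\<gamma> e), pathfinish (\<gamma> e)} = p ` e \<and>
             path_image (\<gamma> e) \<inter> p ` V = p ` e) \<and>
     (\<forall>e\<in>E. \<forall>f\<in>E. e \<noteq> f \<longrightarrow>
             path_image (\<gamma> e) \<inter> path_image (\<gamma> f) = p ` (e \<inter> f))"

definition planar :: "'a set \<Rightarrow> 'a set set \<Rightarrow> bool" where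
  "planar V E \<longleftrightarrow> (\<exists>p \<gamma>. plane_drawing V E p \<gamma>)"

definition proper_edge_coloring :: "'a set set \<Rightarrow> ('a set \<Rightarrow> nat) \<Rightarrow> bool" where
  "proper_edge_coloring E c \<longleftrightarrow>
     (\<forall>e\<in>E. \<forall>f\<in>E. e \<noteq> f \<and> e \<inter> f \<noteq> {} \<longrightarrow> c e \<noteq> c f)"

definition four_cycle :: "'a set set \<Rightarrow> 'a \<Rightarrow> 'a \<Rightarrow> 'a \<Rightarrow> 'a \<Rightarrow> bool" where
  "four_cycle E w x y z \<longleftrightarrow>
     distinct [w, x, y, z] \<and> {w, x} \<in> E \<and> {x, y} \<in> E \<and> {y, z} \<in> E \<and> {z, w} \<in> E"

definition B_coloring :: "'a set set \<Rightarrow> ('a set \<Rightarrow> nat) \<Rightarrow> bool" where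
  "B_coloring E c \<longleftrightarrow>
     proper_edge_coloring E c \<and>
     (\<forall>w x y z. four_cycle E w x y z \<longrightarrow>
        distinct [c {w, x}, c {x, y}, c {y, z}, c {z, w}])"

definition B_coloring_number :: "'a set set \<Rightarrow> nat" where
  "B_coloring_number E = (LEAST k. \<exists>c. B_coloring E c \<and> c ` E \<subseteq> {..<k})"

(* The minimum above ranges over a nonempty set of natural numbers. *)
lemma B_coloring_exists:
  assumes "simple_graph V E"
  shows "\<exists>k c. B_coloring E c \<and> c ` E \<subseteq> {..<k}"
proof -
  have "E \<subseteq> Pow V" "finite V"
    using assms by (auto simp: simple_graph_def)
  then have "finite E"
    by (meson finite_Pow_iff finite_subset)
  then obtain c :: "'a set \<Rightarrow> nat" and n where c: "c ` E = {i. i < n}" "inj_on c E"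
    by (elim finite_imp_inj_to_nat_seg[THEN exE] exE conjE)
  have "proper_edge_coloring E c"
    using c(2) by (simp add: proper_edge_coloring_def inj_on_eq_iff)
  moreover have "distinct [c {w, x}, c {x, y}, c {y, z}, c {z, w}]" if cyc: "four_cycle E w x y z"
    for w x y z
  proof -
    let ?es = "[{w, x}, {x, y}, {y, z}, {z, w}]"
    have "distinct ?es" "set ?es \<subseteq> E"
      using cyc by (auto simp: four_cycle_def doubleton_eq_iff)
    then have "distinct (map c ?es)"
      using inj_on_subset[OF c(2)] by (simp only: distinct_map)
    then show ?thesis
      by simp
  qed
  ultimately have "B_coloring E c"
    by (simp add: B_coloring_def)
  then show ?thesis
    using c(1) by (intro exI[of _ n] exI[of _ c]) auto
qed

end

theory Submission
  imports Defs
begin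

text \<open>Call two edges \<^emph>\<open>conflicting\<close> if they share a vertex or are opposite edges of a 4-cycle; a B-coloring is a
coloring in which conflicting edges differ. Call a vertex big if its degree is at least 88 and small
otherwise, and an edge light if both its ends are small. Two facts drive the proof.

First, a light edge has at most 428 conflicts in all: its opposite edges run between the
neighborhoods of its two ends, and a planar graph has only linearly many edges there
(\<open>light_edge_conflicts\<close>). With \<open>\<Delta> + t - 1\<close> colors, where \<open>\<Delta> > 428\<close> and \<open>t \<ge> 2\<close>, light edges
can therefore be colored greedily after all others, and only the edges with a big end matter.

Second, some small vertex \<open>v\<close> has the property that each edge \<open>vx\<close> to a big vertex \<open>x\<close> conflicts with at
most \<open>\<Delta> + t - 2\<close> non-light edges (\<open>reducible_vertex\<close>). Two opposite edges of a 4-cycle contain all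
its vertices, so deleting \<open>v\<close> removes no conflict between edges that avoid \<open>v\<close>. So one colors
\<open>G - v\<close> by induction, forgets the colors of the light edges, colors the edges from \<open>v\<close> to big vertices,
and finally colors all light edges (\<open>conflict_free_colouring\<close>).

The vertex \<open>v\<close> is found as follows. The edge \<open>vx\<close> meets at most \<open>\<Delta> - 1\<close> other edges at \<open>x\<close>. If \<open>x\<close> and \<open>y\<close>
are the only big neighbors of \<open>v\<close>, then \<open>vy\<close> and the opposite edges at \<open>y\<close> that come from common
neighbors of \<open>x\<close> and \<open>y\<close> add at most \<open>t - 1\<close>, since \<open>G\<close> is \<open>K\<^sub>2\<^sub>,\<^sub>t\<close>-free; if \<open>x\<close> is the only big neighbor, then
the opposite non-light edges add at most \<open>t - 1\<close> unless two of them are disjoint. Hence a small vertex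
fails only if it has at least three big neighbors, or if a third big vertex (or a small vertex that in turn
fails with one big neighbor) is close to it. Contracting such neighborhoods yields vertices with at least
three neighbors in a small set of hubs, and a planar bipartite graph contains fewer than twice as many
of those as hubs. Counting in three rounds, the failing vertices are so few that the average degree of the
big vertices would drop below 88 (\<open>big_degrees\<close>).

Planarity enters only through the absence of a \<open>K\<^sub>3\<^sub>,\<^sub>3\<close> minor (\<open>planar_imp_K33_free\<close>), a property that passes to
contractions without any redrawing. The single counting tool is that a bipartite graph with \<open>n \<ge> 3\<close>
vertices and no \<open>K\<^sub>3\<^sub>,\<^sub>3\<close> minor has at most \<open>2n - 4\<close> edges (\<open>bipartite_K33_free_bound\<close>), which is proved by
contraction and by splitting along 4-cycles, without Euler's formula.\<close>

section \<open>Connected vertex sets and \<open>K\<^sub>3\<^sub>,\<^sub>3\<close> minors\<close>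

text \<open>Connectivity of the subgraph induced by a nonempty vertex set, the branch sets of minors.\<close>

definition linked :: "('v \<Rightarrow> 'v \<Rightarrow> bool) \<Rightarrow> 'v set \<Rightarrow> bool" where
  "linked adj X \<longleftrightarrow> X \<noteq> {} \<and> (\<forall>x\<in>X. \<forall>y\<in>X. (\<lambda>u v. u \<in> X \<and> v \<in> X \<and> adj u v)\<^sup>*\<^sup>* x y)"

definition touch :: "('v \<Rightarrow> 'v \<Rightarrow> bool) \<Rightarrow> 'v set \<Rightarrow> 'v set \<Rightarrow> bool" where
  "touch adj X Y \<longleftrightarrow> (\<exists>x\<in>X. \<exists>y\<in>Y. adj x y)"

text \<open>The branch sets \<open>P 0\<close>, \<open>P 1\<close>, \<open>P 2\<close> and \<open>P 3\<close>, \<open>P 4\<close>, \<open>P 5\<close> form the two sides of a \<open>K\<^sub>3\<^sub>,\<^sub>3\<close> minor.\<close>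

definition K33_model :: "'v set \<Rightarrow> ('v \<Rightarrow> 'v \<Rightarrow> bool) \<Rightarrow> (nat \<Rightarrow> 'v set) \<Rightarrow> bool" where
  "K33_model V adj P \<longleftrightarrow> (\<forall>i<6. linked adj (P i) \<and> P i \<subseteq> V) \<and>
     (\<forall>i<6. \<forall>j<6. i \<noteq> j \<longrightarrow> P i \<inter> P j = {}) \<and> (\<forall>i<3. \<forall>j<3. touch adj (P i) (P (3 + j)))"

definition K33_free :: "'v set \<Rightarrow> ('v \<Rightarrow> 'v \<Rightarrow> bool) \<Rightarrow> bool" where
  "K33_free V adj \<longleftrightarrow> (\<nexists>P. K33_model V adj P)"

lemma K33_freeD:
  assumes "K33_free V adj"
    and "linked adj A1" "linked adj A2" "linked adj A3" "linked adj B1" "linked adj B2" "linked adj B3"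
    and "A1 \<union> A2 \<union> A3 \<union> B1 \<union> B2 \<union> B3 \<subseteq> V"
    and "A1 \<inter> (A2 \<union> A3 \<union> B1 \<union> B2 \<union> B3) = {}" "A2 \<inter> (A3 \<union> B1 \<union> B2 \<union> B3) = {}"
      "A3 \<inter> (B1 \<union> B2 \<union> B3) = {}" "B1 \<inter> (B2 \<union> B3) = {}" "B2 \<inter> B3 = {}"
    and "touch adj A1 B1" "touch adj A1 B2" "touch adj A1 B3"
      "touch adj A2 B1" "touch adj A2 B2" "touch adj A2 B3"
      "touch adj A3 B1" "touch adj A3 B2" "touch adj A3 B3"
  shows False
proof -
  define P where "P i = [A1, A2, A3, B1, B2, B3] ! i" for i
  have P: "P 0 = A1" "P (Suc 0) = A2" "P (Suc (Suc 0)) = A3" "P (Suc (Suc (Suc 0))) = B1"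
    "P (Suc (Suc (Suc (Suc 0)))) = B2" "P (Suc (Suc (Suc (Suc (Suc 0))))) = B3"
    by (simp_all add: P_def)
  have dis: "A1 \<inter> A2 = {}" "A1 \<inter> A3 = {}" "A1 \<inter> B1 = {}" "A1 \<inter> B2 = {}" "A1 \<inter> B3 = {}"
    "A2 \<inter> A3 = {}" "A2 \<inter> B1 = {}" "A2 \<inter> B2 = {}" "A2 \<inter> B3 = {}"
    "A3 \<inter> B1 = {}" "A3 \<inter> B2 = {}" "A3 \<inter> B3 = {}" "B1 \<inter> B2 = {}" "B1 \<inter> B3 = {}" "B2 \<inter> B3 = {}"
    using assms(9-13) by blast+
  have "K33_model V adj P"
    unfolding K33_model_def using assms(2-8,14-) dis
    by (simp add: numeral_eq_Suc All_less_Suc P Int_commute)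
  with assms(1) show False
    by (auto simp: K33_free_def)
qed

text \<open>Replacing the vertices of a connected set by connected sets that touch along its edges keeps it
connected. This is what makes minors of minors minors.\<close>

lemma linked_UN:
  assumes X: "linked adj' X" and F: "\<And>w. w \<in> X \<Longrightarrow> linked adj (F w)"
    and edge: "\<And>v w. v \<in> X \<Longrightarrow> w \<in> X \<Longrightarrow> adj' v w \<Longrightarrow> touch adj (F v) (F w)"
  shows "linked adj (\<Union>(F ` X))"
proof -
  let ?U = "\<Union>(F ` X)"
  let ?r = "\<lambda>Y u v. u \<in> Y \<and> v \<in> Y \<and> adj u v"
  have inF: "(?r ?U)\<^sup>*\<^sup>* a b" if "w \<in> X" "a \<in> F w" "b \<in> F w" for w a b
  proof -
    have "(?r (F w))\<^sup>*\<^sup>* a b"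
      using F[OF that(1)] that(2,3) by (simp add: linked_def)
    then show ?thesis
      by (rule rtranclp_mono[THEN predicate2D, rotated]) (use that(1) in auto)
  qed
  have reach: "\<forall>b\<in>F w. (?r ?U)\<^sup>*\<^sup>* a b"
    if "(\<lambda>u v. u \<in> X \<and> v \<in> X \<and> adj' u v)\<^sup>*\<^sup>* v w" "v \<in> X" "a \<in> F v" for v w a
    using that(1)
  proof induction
    case base
    show ?case using inF that(2,3) by blast
  next
    case (step w w')
    then obtain c d where cd: "c \<in> F w" "d \<in> F w'" "adj c d"
      using edge[of w w'] by (auto simp: touch_def)
    show ?case
    proof
      fix b assume "b \<in> F w'"
      then have db: "(?r ?U)\<^sup>*\<^sup>* d b"
        using inF[of w' d b] cd step(2) by blast
      have "(?r ?U)\<^sup>*\<^sup>* a c"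
        using step cd by blast
      then have "(?r ?U)\<^sup>*\<^sup>* a d"
        by (rule rtranclp.rtrancl_into_rtrancl) (use cd step(2) in blast)
      then show "(?r ?U)\<^sup>*\<^sup>* a b"
        using db by (rule rtranclp_trans)
    qed
  qed
  have "(?r ?U)\<^sup>*\<^sup>* a b" if ab: "a \<in> ?U" "b \<in> ?U" for a b
  proof -
    obtain v w where "v \<in> X" "a \<in> F v" "w \<in> X" "b \<in> F w"
      using ab by blast
    then show ?thesis
      using reach[of v w a] X by (simp add: linked_def)
  qed
  moreover have "?U \<noteq> {}"
  proof -
    obtain w where "w \<in> X" using X by (auto simp: linked_def)
    then show ?thesis using F[of w] by (auto simp: linked_def)
  qed
  ultimately show ?thesis
    by (simp add: linked_def)
qed

text \<open>The fibers \<open>F w\<close> are the branch sets of a minor with vertex set \<open>W\<close>. One lemma covers subgraphs (singleton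
fibers), the contraction of a path (one larger fiber) and quotients whose vertices are sets (\<open>F = id\<close>),
because the vertex type of the minor is arbitrary.\<close>

lemma K33_free_minor:
  assumes V: "K33_free V adj"
    and F: "\<And>w. w \<in> W \<Longrightarrow> linked adj (F w) \<and> F w \<subseteq> V"
    and dis: "\<And>v w. v \<in> W \<Longrightarrow> w \<in> W \<Longrightarrow> v \<noteq> w \<Longrightarrow> F v \<inter> F w = {}"
    and edge: "\<And>v w. v \<in> W \<Longrightarrow> w \<in> W \<Longrightarrow> adj' v w \<Longrightarrow> touch adj (F v) (F w)"
  shows "K33_free W adj'"
  unfolding K33_free_def
proof
  assume "\<exists>P. K33_model W adj' P"
  then obtain P where P: "K33_model W adj' P" ..
  have "K33_model V adj (\<lambda>i. \<Union>(F ` P i))"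
    unfolding K33_model_def
  proof (intro conjI allI impI)
    fix i :: nat assume i: "i < 6"
    then have Pi: "linked adj' (P i)" "P i \<subseteq> W"
      using P by (auto simp: K33_model_def)
    show "linked adj (\<Union>(F ` P i))"
      by (rule linked_UN[OF Pi(1)]) (use F edge Pi(2) in blast)+
    show "\<Union>(F ` P i) \<subseteq> V"
      using F Pi by blast
    fix j :: nat assume j: "j < 6" "i \<noteq> j"
    then have "P j \<subseteq> W" "P i \<inter> P j = {}"
      using P i by (auto simp: K33_model_def)
    then show "\<Union>(F ` P i) \<inter> \<Union>(F ` P j) = {}"
      using dis Pi(2) by blast
  next
    fix i j :: nat assume ij: "i < 3" "j < 3"
    then have "touch adj' (P i) (P (3 + j))" "P i \<subseteq> W" "P (3 + j) \<subseteq> W"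
      using P by (auto simp: K33_model_def)
    then obtain v w where "v \<in> P i" "w \<in> P (3 + j)" "adj' v w"
      unfolding touch_def by blast
    moreover from this have "touch adj (F v) (F w)"
      using edge \<open>P i \<subseteq> W\<close> \<open>P (3 + j) \<subseteq> W\<close> by blast
    ultimately show "touch adj (\<Union>(F ` P i)) (\<Union>(F ` P (3 + j)))"
      by (auto simp: touch_def)
  qed
  with V show False
    by (auto simp: K33_free_def)
qed

lemma linked_singleton: "linked adj {x}"
  by (simp add: linked_def)

lemma K33_free_subgraph:
  assumes "K33_free V adj" "W \<subseteq> V" "\<And>v w. v \<in> W \<Longrightarrow> w \<in> W \<Longrightarrow> adj' v w \<Longrightarrow> adj v w"
  shows "K33_free W adj'"
  by (rule K33_free_minor[OF assms(1), of W "\<lambda>w. {w}"]) 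
     (use assms(2,3) in \<open>auto simp: linked_singleton touch_def\<close>)

lemma linked_from_root:
  assumes sym: "\<And>u v. adj u v \<Longrightarrow> adj v u"
    and r: "r \<in> X" "\<And>x. x \<in> X \<Longrightarrow> (\<lambda>u v. u \<in> X \<and> v \<in> X \<and> adj u v)\<^sup>*\<^sup>* r x"
  shows "linked adj X"
proof -
  have "symp (\<lambda>u v. u \<in> X \<and> v \<in> X \<and> adj u v)"
    using sym by (auto simp: symp_def)
  then have "(\<lambda>u v. u \<in> X \<and> v \<in> X \<and> adj u v)\<^sup>*\<^sup>* x r" if "x \<in> X" for x
    using r(2)[OF that] by (meson symp_rtranclp sympD)
  then show ?thesis
    using r by (auto simp: linked_def intro: rtranclp_trans)
qed

lemma linked_star:
  assumes sym: "\<And>u v. adj u v \<Longrightarrow> adj v u" and "r \<in> X" "\<And>x. x \<in> X \<Longrightarrow> x \<noteq> r \<Longrightarrow> adj r x"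
  shows "linked adj X"
proof (rule linked_from_root[where r = r, OF sym])
  fix x assume "x \<in> X"
  then show "(\<lambda>u v. u \<in> X \<and> v \<in> X \<and> adj u v)\<^sup>*\<^sup>* r x"
    using assms(2,3) by (cases "x = r") auto
qed (use assms in auto)

section \<open>A plane drawing has no \<open>K\<^sub>3\<^sub>,\<^sub>3\<close> minor\<close>

text \<open>Three arcs with common ends form a theta curve, and \<open>c\<close> is linked to the interiors of \<open>l2\<close> and \<open>l3\<close> without
crossing the curve. A point \<open>d\<close> on the other side of the circle \<open>l1 \<union> l2\<close> can then be joined to \<open>c\<close> off
\<open>l1 \<union> l3\<close>: its component reaches \<open>l2\<close>, since otherwise it would be a component of the complement of the
single arc \<open>l1\<close>, which is connected and contains \<open>c\<close>; from there one passes through \<open>l2\<close> and \<open>A2\<close> to \<open>c\<close>.\<close>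

lemma theta_side_connected:
  fixes c d :: complex
  assumes l1: "arc l1" and l2: "arc l2" 
    and ends: "pathstart l1 = a" "pathfinish l1 = a'" "pathstart l2 = a" "pathfinish l2 = a'"
      "pathstart l3 = a" "pathfinish l3 = a'"
    and A2: "connected A2" "c \<in> A2" "path_image l2 - {a, a'} \<subseteq> A2"
      "A2 \<inter> path_image l1 = {}" "A2 \<inter> path_image l3 = {}"
    and A3: "connected A3" "c \<in> A3" "path_image l3 - {a, a'} \<subseteq> A3"
      "A3 \<inter> path_image l1 = {}" "A3 \<inter> path_image l2 = {}"
    and d: "d \<notin> path_image l1 \<union> path_image l2"
      "\<not> connected_component (- (path_image l1 \<union> path_image l2)) c d"
  shows "connected_component (- (path_image l1 \<union> path_image l3)) c d"
proof -
  let ?K = "path_image l1 \<union> path_image l2"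
  define D where "D = connected_component_set (- ?K) d"
  have dD: "d \<in> D" and conD: "connected D" and DK: "D \<subseteq> - ?K"
    using d(1) by (auto simp: D_def dest: connected_component_in)
  have clK: "closed ?K"
    by (simp add: closed_Un closed_arc_image l1 l2)
  then have opD: "open D"
    unfolding D_def by (intro open_connected_component) (metis open_Compl)
  have cD: "c \<notin> D"
    using d(2) by (simp add: D_def connected_component_sym_eq)
  have A3D: "A3 \<inter> D = {}"
  proof (rule ccontr)
    assume "A3 \<inter> D \<noteq> {}"
    then obtain x where x: "x \<in> A3" "x \<in> D" by blast
    have "A3 \<subseteq> connected_component_set (- ?K) x"
      by (rule connected_component_maximal) (use x A3 in auto)
    then have "connected_component (- ?K) x c"
      using A3(2) by auto
    moreover have "connected_component (- ?K) d x"
      using x(2) by (simp add: D_def)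
    ultimately show False
      using d(2) connected_component_trans connected_component_sym by metis
  qed
  have inD: "x \<in> D" if "x \<in> closure D" "x \<notin> ?K" for x
  proof -
    have "connected (insert x D)"
      by (rule connected_intermediate_closure[OF conD]) (use that(1) closure_subset[of D] in auto)
    then have "insert x D \<subseteq> D"
      unfolding D_def
      by (intro connected_component_maximal) (use dD DK that in \<open>auto simp: D_def\<close>)
    then show ?thesis by auto
  qed
  have "\<exists>s. s \<in> closure D \<and> s \<in> path_image l2 \<and> s \<notin> path_image l1"
  proof (rule ccontr)
    assume no: "\<not> ?thesis"
    have con: "connected (- path_image l1)"
      by (rule connected_arc_complement[OF l1]) simp
    have "closure D \<inter> - path_image l1 = D"
    proof
      show "closure D \<inter> - path_image l1 \<subseteq> D"
        using no inD by blast
      show "D \<subseteq> closure D \<inter> - path_image l1"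
        using DK closure_subset[of D] by blast
    qed
    then have "closedin (top_of_set (- path_image l1)) D"
      by (metis closed_closure closedin_closed_Int inf_commute)
    moreover have "openin (top_of_set (- path_image l1)) D"
      using opD DK by (intro open_subset) auto
    ultimately have "D = - path_image l1"
      using con dD unfolding connected_clopen by blast
    then show False
      using cD A2 by auto
  qed
  then obtain s where s: "s \<in> closure D" "s \<in> path_image l2" "s \<notin> path_image l1" by blast
  have aa: "a \<in> path_image l1" "a' \<in> path_image l1"
    using ends by auto
  have sA: "s \<in> A2"
    using s A2(3) aa by blast
  have "connected (insert s D)"
    by (rule connected_intermediate_closure[OF conD]) (use s(1) closure_subset[of D] in auto)
  then have "connected (insert s D \<union> A2)"
    by (rule connected_Un) (use A2 sA in auto)
  moreover have "insert s D \<union> A2 \<subseteq> - (path_image l1 \<union> path_image l3)"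
  proof -
    have "path_image l3 \<subseteq> A3 \<union> path_image l1"
      using A3(3) aa by blast
    then show ?thesis
      using A2 sA A3D DK by blast
  qed
  ultimately show ?thesis
    unfolding connected_component_def using A2(2) dD by blast
qed

text \<open>No point outside a theta curve reaches all three of its arcs. By the Jordan curve theorem \<open>l1 \<union> l2\<close>
separates \<open>c\<close> from some \<open>d\<close>, while neither \<open>l1 \<union> l3\<close> nor \<open>l2 \<union> l3\<close> does. These two circles meet in the
connected set \<open>l3\<close>, so by Janiszewski's theorem their union does not separate \<open>c\<close> from \<open>d\<close> either.\<close>

lemma no_theta_centre:
  fixes c :: complex
  assumes arcs: "arc l1" "arc l2" "arc l3"
    and ends: "pathstart l1 = a" "pathfinish l1 = a'" "pathstart l2 = a" "pathfinish l2 = a'"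
      "pathstart l3 = a" "pathfinish l3 = a'"
    and meet: "path_image l1 \<inter> path_image l2 = {a, a'}" 
    and A1: "connected A1" "c \<in> A1" "path_image l1 - {a, a'} \<subseteq> A1"
      "A1 \<inter> path_image l2 = {}" "A1 \<inter> path_image l3 = {}"
    and A2: "connected A2" "c \<in> A2" "path_image l2 - {a, a'} \<subseteq> A2"
      "A2 \<inter> path_image l1 = {}" "A2 \<inter> path_image l3 = {}"
    and A3: "connected A3" "c \<in> A3" "path_image l3 - {a, a'} \<subseteq> A3"
      "A3 \<inter> path_image l1 = {}" "A3 \<inter> path_image l2 = {}"
  shows False
proof -
  let ?K = "path_image l1 \<union> path_image l2"
  have "simple_path (l1 +++ reversepath l2)"
    by (rule simple_path_join_loop) (use arcs ends meet in \<open>auto simp: arc_reversepath\<close>)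
  then have "\<not> connected (- path_image (l1 +++ reversepath l2))"
    by (rule Jordan_disconnected) (simp add: ends)
  then have "\<not> connected (- ?K)"
    by (simp add: path_image_join ends)
  moreover have cK: "c \<in> - ?K"
    using A1 A2 by auto
  ultimately obtain d where d: "d \<notin> ?K" "\<not> connected_component (- ?K) c d"
  proof -
    obtain x y where xy: "x \<in> - ?K" "y \<in> - ?K" "\<not> connected_component (- ?K) x y"
      using \<open>\<not> connected (- ?K)\<close> unfolding connected_iff_connected_component by blast
    then have "\<not> connected_component (- ?K) c x \<or> \<not> connected_component (- ?K) c y"
      using connected_component_trans connected_component_sym by metis
    then show ?thesis
      using that xy(1,2) by blast
  qed
  have "connected_component (- (path_image l1 \<union> path_image l3)) c d"
    by (rule theta_side_connected[OF arcs(1,2) ends A2 A3 d])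
  moreover have "connected_component (- (path_image l2 \<union> path_image l3)) c d"
    by (rule theta_side_connected[OF arcs(2,1) ends(3,4,1,2,5,6) A1 A3(1-3,5,4)])
       (use d in \<open>simp_all add: Un_commute\<close>)
  moreover have "{a, a'} \<subseteq> path_image l3"
    using ends(5,6) pathstart_in_path_image[of l3] pathfinish_in_path_image[of l3] by simp
  then have "(path_image l1 \<union> path_image l3) \<inter> (path_image l2 \<union> path_image l3) = path_image l3"
    using meet by blast
  then have "connected ((path_image l1 \<union> path_image l3) \<inter> (path_image l2 \<union> path_image l3))"
    using arcs(3) by (simp add: connected_arc_image)
  ultimately have "connected_component
      (- ((path_image l1 \<union> path_image l3) \<union> (path_image l2 \<union> path_image l3))) c d"
    using Janiszewski[of "path_image l1 \<union> path_image l3" "path_image l2 \<union> path_image l3" c d] arcs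
    by (simp only: closed_Un compact_Un compact_arc_image closed_arc_image)
  then have "connected_component (- ?K) c d"
    by (rule connected_component_of_subset) auto
  with d(2) show False ..
qed

lemma connected_arc_minus_ends:
  fixes g :: "real \<Rightarrow> 'a::t2_space"
  assumes "arc g"
  shows "connected (path_image g - {pathstart g, pathfinish g})"
proof -
  have inj: "inj_on g {0..1}" and con: "continuous_on {0..1} g"
    using assms by (auto simp: arc_def path_def)
  have "path_image g - {pathstart g, pathfinish g} = g ` {0..1} - g ` {0, 1}"
    by (simp add: path_image_def pathstart_def pathfinish_def)
  also have "\<dots> = g ` ({0..1} - {0, 1})"
    by (rule inj_on_image_set_diff[OF inj, symmetric]) auto
  also have "{0..1} - {0, 1} = {0<..<(1::real)}"
    by auto
  finally have im: "path_image g - {pathstart g, pathfinish g} = g ` {0<..<1}" .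
  have "continuous_on {0<..<1} g"
    by (rule continuous_on_subset[OF con]) auto
  then show ?thesis
    unfolding im by (rule connected_continuous_image) simp
qed

text \<open>The classical nonplanarity of \<open>K\<^sub>3\<^sub>,\<^sub>3\<close>: the arcs through \<open>b 0\<close>, \<open>b 1\<close>, \<open>b 2\<close> from \<open>a 0\<close> to \<open>a 1\<close> form a theta curve,
and \<open>a 2\<close> would be a center reaching all three.\<close>

lemma no_planar_K33_arcs:
  fixes a b :: "nat \<Rightarrow> complex" and h :: "nat \<Rightarrow> nat \<Rightarrow> real \<Rightarrow> complex"
  assumes h: "\<And>i j. i < 3 \<Longrightarrow> j < 3 \<Longrightarrow> arc (h i j) \<and> pathstart (h i j) = a i \<and> pathfinish (h i j) = b j"
    and row: "\<And>i j k. i < 3 \<Longrightarrow> j < 3 \<Longrightarrow> k < 3 \<Longrightarrow> j \<noteq> k \<Longrightarrow> path_image (h i j) \<inter> path_image (h i k) \<subseteq> {a i}"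
    and col: "\<And>i j k. i < 3 \<Longrightarrow> j < 3 \<Longrightarrow> k < 3 \<Longrightarrow> i \<noteq> k \<Longrightarrow> path_image (h i j) \<inter> path_image (h k j) \<subseteq> {b j}"
    and dis: "\<And>i j k l. i < 3 \<Longrightarrow> j < 3 \<Longrightarrow> k < 3 \<Longrightarrow> l < 3 \<Longrightarrow> i \<noteq> k \<Longrightarrow> j \<noteq> l \<Longrightarrow>
        path_image (h i j) \<inter> path_image (h k l) = {}"
  shows False
proof -
  define l where "l j = h 0 j +++ reversepath (h 1 j)" for j
  define A where "A j = path_image (h 2 j) \<union> (path_image (l j) - {a 0, a 1})" for j
  have a_in: "a i \<in> path_image (h i j)" and b_in: "b j \<in> path_image (h i j)" if "i < 3" "j < 3" for i j
    using h[OF that] pathstart_in_path_image pathfinish_in_path_image by metis+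
  have arcl: "arc (l j)" if "j < 3" for j
    unfolding l_def
    by (rule arc_join) (use that h[of 0 j] h[of 1 j] col[of 0 j 1] in \<open>simp_all add: arc_reversepath\<close>)
  have endl: "pathstart (l j) = a 0" "pathfinish (l j) = a 1"
    and iml: "path_image (l j) = path_image (h 0 j) \<union> path_image (h 1 j)" if "j < 3" for j
    using that h[of 0 j] h[of 1 j] by (simp_all add: l_def path_image_join)
  have a01: "a i \<noteq> a k" if "i < 3" "k < 3" "i \<noteq> k" for i k
    using dis[of i 0 k 1] that a_in[of i 0] a_in[of k 1] by force
  have aA: "a i \<notin> path_image (h k j)" if "i < 3" "k < 3" "i \<noteq> k" "j < 3" for i j k
  proof -
    obtain m :: nat where "m < 3" "m \<noteq> j" 
      using that by (metis less_numeral_extra(3) less_trans one_less_numeral_iff semiring_norm(77) zero_less_numeral zero_neq_one)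
    then show ?thesis
      using dis[of i m k j] that a_in[of i m] by auto
  qed
  have bl: "b j \<in> path_image (l j) - {a 0, a 1}" if "j < 3" for j
  proof -
    have "b j \<noteq> a 0" "b j \<noteq> a 1"
      using that b_in[of 1 j] aA[of 0 1 j] b_in[of 0 j] aA[of 1 0 j] by force+
    then show ?thesis
      using b_in[of 0 j] iml[OF that] that by simp
  qed
  have A: "connected (A j)" "a 2 \<in> A j" "path_image (l j) - {a 0, a 1} \<subseteq> A j" if "j < 3" for j
  proof -
    show "connected (A j)"
      unfolding A_def
    proof (rule connected_Un)
      show "connected (path_image (h 2 j))"
        using h[of 2 j] that by (simp add: connected_arc_image)
      show "connected (path_image (l j) - {a 0, a 1})"
        using connected_arc_minus_ends[OF arcl[OF that]] endl[OF that] by simp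
      show "path_image (h 2 j) \<inter> (path_image (l j) - {a 0, a 1}) \<noteq> {}"
        using bl[OF that] b_in[of 2 j] that by (intro notI) (simp, blast)
    qed
    show "a 2 \<in> A j" "path_image (l j) - {a 0, a 1} \<subseteq> A j"
      unfolding A_def using that a_in[of 2 j] by simp_all
  qed
  have meet: "path_image (l j) \<inter> path_image (l k) = {a 0, a 1}" if "j < 3" "k < 3" "j \<noteq> k" for j k
  proof
    have "path_image (h 0 j) \<inter> path_image (h 0 k) \<subseteq> {a 0}" "path_image (h 1 j) \<inter> path_image (h 1 k) \<subseteq> {a 1}"
      "path_image (h 0 j) \<inter> path_image (h 1 k) = {}" "path_image (h 1 j) \<inter> path_image (h 0 k) = {}"
      using that row[of 0 j k] row[of 1 j k] dis[of 0 j 1 k] dis[of 1 j 0 k] by simp_all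
    then show "path_image (l j) \<inter> path_image (l k) \<subseteq> {a 0, a 1}"
      unfolding iml[OF that(1)] iml[OF that(2)] by blast
    show "{a 0, a 1} \<subseteq> path_image (l j) \<inter> path_image (l k)"
      unfolding iml[OF that(1)] iml[OF that(2)] using a_in that by simp
  qed
  have off: "A j \<inter> path_image (l k) = {}" if "j < 3" "k < 3" "j \<noteq> k" for j k
  proof -
    have "path_image (h 2 j) \<inter> path_image (l k) = {}"
      unfolding iml[OF that(2)] Int_Un_distrib using that dis[of 2 j 0 k] dis[of 2 j 1 k] by simp
    then show ?thesis
      unfolding A_def using meet[OF that] by blast
  qed
  have z: "0 < (3::nat)" "1 < (3::nat)" "2 < (3::nat)"
    and ne: "0 \<noteq> (1::nat)" "0 \<noteq> (2::nat)" "1 \<noteq> (2::nat)" "1 \<noteq> (0::nat)" "2 \<noteq> (0::nat)" "2 \<noteq> (1::nat)"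
    by simp_all
  show False
    by (rule no_theta_centre[OF arcl[OF z(1)] arcl[OF z(2)] arcl[OF z(3)] endl[OF z(1)] endl[OF z(2)]
          endl[OF z(3)] meet[OF z(1,2) ne(1)]
          A[OF z(1)] off[OF z(1,2) ne(1)] off[OF z(1,3) ne(2)]
          A[OF z(2)] off[OF z(2,1) ne(4)] off[OF z(2,3) ne(3)]
          A[OF z(3)] off[OF z(3,1) ne(5)] off[OF z(3,2) ne(6)]])
qed

text \<open>Three points of a path-connected set can be joined by a tripod inside the set: take an arc between two of
them and a path from the third up to its first point on this arc. Legs may be trivial, which
covers coinciding points. With this lemma a branch set of degree three can be replaced by a single
point with three legs.\<close>

lemma path_connected_tripod:
  fixes P :: "'a::{complete_space,real_normed_vector} set"
  assumes P: "path_connected P" and q: "\<And>k. k < 3 \<Longrightarrow> q k \<in> P"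
  obtains c :: 'a and L :: "nat \<Rightarrow> 'a set"
  where "c \<in> P" "\<And>k. k < 3 \<Longrightarrow> L k \<subseteq> P \<and> path_connected (L k) \<and> c \<in> L k \<and> q k \<in> L k"
    "\<And>k l. k < 3 \<Longrightarrow> l < 3 \<Longrightarrow> k \<noteq> l \<Longrightarrow> L k \<inter> L l = {c}"
proof -
  have q': "q 0 \<in> P" "q 1 \<in> P" "q 2 \<in> P"
    using q by auto
  have three: "k < 3 \<longleftrightarrow> k = 0 \<or> k = 1 \<or> k = 2" for k :: nat
    by auto
  have "\<exists>c L0 L1 L2. c \<in> P \<and> 
     (L0 \<subseteq> P \<and> path_connected L0 \<and> c \<in> L0 \<and> q 0 \<in> L0) \<and>
     (L1 \<subseteq> P \<and> path_connected L1 \<and> c \<in> L1 \<and> q 1 \<in> L1) \<and>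
     (L2 \<subseteq> P \<and> path_connected L2 \<and> c \<in> L2 \<and> q 2 \<in> L2) \<and>
     L0 \<inter> L1 = {c} \<and> L0 \<inter> L2 = {c} \<and> L1 \<inter> L2 = {c}" (is "\<exists>c L0 L1 L2. ?T c L0 L1 L2")
  proof (cases "q 0 = q 1")
    case True
    show ?thesis
      by (rule exI[of _ "q 0"], rule exI[of _ "{q 0}"], rule exI[of _ "{q 0}"], rule exI[of _ P])
         (use True q' P in auto)
  next
    case False
    then obtain g where g: "arc g" "path_image g \<subseteq> P" "pathstart g = q 0" "pathfinish g = q 1"
      using P q' by (metis path_connected_arcwise)
    have clg: "closed (path_image g)"
      by (simp add: closed_arc_image g)
    have "\<exists>c L2. c \<in> path_image g \<and> L2 \<subseteq> P \<and> path_connected L2 \<and> c \<in> L2 \<and> q 2 \<in> L2 \<and> L2 \<inter> path_image g = {c}"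
    proof (cases "q 2 \<in> path_image g")
      case True
      then show ?thesis using q' by (intro exI[of _ "q 2"] exI[of _ "{q 2}"]) auto
    next
      case out: False
      obtain r where r: "path r" "path_image r \<subseteq> P" "pathstart r = q 2" "pathfinish r = q 0"
        using P q' unfolding path_connected_def by metis
      have "pathfinish r \<notin> - path_image g"
        using r g pathstart_in_path_image[of g] by simp
      moreover have "pathstart r \<in> closure (- path_image g)"
        using r out closure_subset by fastforce
      ultimately obtain s where s: "path s" "path_image s \<subseteq> path_image r" "pathstart s = q 2"
          "path_image s - {pathfinish s} \<subseteq> - path_image g" "pathfinish s \<in> frontier (- path_image g)"
        using exists_path_subpath_to_frontier[OF r(1), of "- path_image g"] clg r(3)
        by (metis interior_open open_Compl)
      have "pathfinish s \<in> path_image g"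
        using s(5) clg by (metis Diff_iff frontier_complement frontier_def closure_closed)
      moreover have "path_image s \<inter> path_image g = {pathfinish s}"
        using s(4) calculation by auto
      moreover have "path_connected (path_image s)" "pathfinish s \<in> path_image s" "q 2 \<in> path_image s"
        using s(1) path_connected_path_image pathstart_in_path_image pathfinish_in_path_image s(3) by metis+
      ultimately show ?thesis
        using s(2) r(2) by (intro exI[of _ "pathfinish s"] exI[of _ "path_image s"]) auto
    qed
    then obtain c L2 where c: "c \<in> path_image g" and L2: "L2 \<subseteq> P" "path_connected L2" "c \<in> L2" "q 2 \<in> L2"
        "L2 \<inter> path_image g = {c}" by blast
    obtain t where t: "0 \<le> t" "t \<le> 1" "c = g t"
      using c by (auto simp: path_image_def)
    have con: "continuous_on {0..1} g" and inj: "inj_on g {0..1}"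
      using g by (auto simp: arc_def path_def)
    have pc: "path_connected (g ` {u..v})" if "0 \<le> u" "v \<le> 1" for u v
      using that con by (intro path_connected_continuous_image continuous_on_subset[OF con]) auto
    have g01: "q 0 = g 0" "q 1 = g 1"
      using g by (auto simp: pathstart_def pathfinish_def)
    have sub: "g ` {0..t} \<subseteq> path_image g" "g ` {t..1} \<subseteq> path_image g"
      using t by (auto simp: path_image_def)
    have "g ` {0..t} \<inter> g ` {t..1} = g ` ({0..t} \<inter> {t..1})"
      using t by (intro inj_on_image_Int[OF inj, symmetric]) auto
    moreover have "{0..t} \<inter> {t..1} = {t}"
      using t by auto
    ultimately have "g ` {0..t} \<inter> g ` {t..1} = {c}"
      using t by auto
    moreover have "g ` {0..t} \<inter> L2 = {c}" "g ` {t..1} \<inter> L2 = {c}"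
      using sub L2(3,5) t by auto
    moreover have "c \<in> P" "g ` {0..t} \<subseteq> P" "g ` {t..1} \<subseteq> P"
      using sub g(2) c by blast+
    moreover have "path_connected (g ` {0..t})" "path_connected (g ` {t..1})"
      "q 0 \<in> g ` {0..t}" "q 1 \<in> g ` {t..1}" "c \<in> g ` {0..t}" "c \<in> g ` {t..1}"
      using pc t g01 by auto
    ultimately show ?thesis
      using L2 by (intro exI[of _ c] exI[of _ "g ` {0..t}"] exI[of _ "g ` {t..1}"] exI[of _ L2]) simp
  qed
  then obtain c L0 L1 L2 where "?T c L0 L1 L2" by (elim exE)
  then show ?thesis
    by (intro that[of c "\<lambda>k. if k = 0 then L0 else if k = 1 then L1 else L2"]) (auto simp: three)
qed

text \<open>The part of the drawing that belongs to the subgraph induced by \<open>X\<close>.\<close>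

definition drawn ::
  "'a set set \<Rightarrow> ('a \<Rightarrow> complex) \<Rightarrow> ('a set \<Rightarrow> real \<Rightarrow> complex) \<Rightarrow> 'a set \<Rightarrow> complex set" where
  "drawn E p \<gamma> X = p ` X \<union> (\<Union>e\<in>{e \<in> E. e \<subseteq> X}. path_image (\<gamma> e))"

lemma path_connected_drawn:
  assumes G: "simple_graph V E" and D: "plane_drawing V E p \<gamma>"
    and X: "X \<subseteq> V" "linked (\<lambda>u v. {u, v} \<in> E) X"
  shows "path_connected (drawn E p \<gamma> X)"
proof -
  let ?I = "drawn E p \<gamma> X"
  have arcs: "arc (\<gamma> e)" and ends: "p ` e \<subseteq> path_image (\<gamma> e)" if "e \<in> E" for e
    using D that unfolding plane_drawing_def by blast+
  have edge: "path_component ?I y z" if "e \<in> E" "e \<subseteq> X" "y \<in> path_image (\<gamma> e)" "z \<in> path_image (\<gamma> e)" for e y z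
  proof (rule path_component_of_subset)
    show "path_image (\<gamma> e) \<subseteq> ?I"
      using that by (auto simp: drawn_def)
    show "path_component (path_image (\<gamma> e)) y z"
      using arcs[OF that(1)] that(3,4) path_connected_path_image[OF arc_imp_path]
      by (metis path_connected_component)
  qed
  have walk: "path_component ?I (p x) (p y)"
    if "(\<lambda>u v. u \<in> X \<and> v \<in> X \<and> {u, v} \<in> E)\<^sup>*\<^sup>* x y" "x \<in> X" for x y
    using that(1)
  proof induction
    case base
    show ?case
      using that(2) by (auto simp: drawn_def intro!: path_component_refl)
  next
    case (step y z)
    have "path_component ?I (p y) (p z)"
      using edge[of "{y, z}" "p y" "p z"] ends[of "{y, z}"] step(2) by auto
    with step(3) show ?case
      by (rule path_component_trans)
  qed
  have near: "\<exists>x\<in>X. path_component ?I (p x) y" if y: "y \<in> ?I" for y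
  proof (cases "y \<in> p ` X")
    case True
    then show ?thesis
      using y by (auto intro: path_component_refl)
  next
    case False
    then obtain e where e: "e \<in> E" "e \<subseteq> X" "y \<in> path_image (\<gamma> e)"
      using y by (auto simp: drawn_def)
    moreover have "card e = 2"
      using G e(1) by (auto simp: simple_graph_def)
    then obtain x where "x \<in> e"
      by fastforce
    ultimately show ?thesis
      using edge[of e "p x" y] ends[of e] by blast
  qed
  show ?thesis
    unfolding path_connected_component
  proof (intro ballI)
    fix y z assume "y \<in> ?I" "z \<in> ?I"
    then obtain u v where uv: "u \<in> X" "path_component ?I (p u) y" "v \<in> X" "path_component ?I (p v) z"
      using near by meson
    then have "path_component ?I (p u) (p v)"
      using X(2) walk by (simp add: linked_def)
    then show "path_component ?I y z"
      using uv path_component_trans path_component_sym by metis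
  qed
qed

lemma drawn_disjoint:
  assumes G: "simple_graph V E" and D: "plane_drawing V E p \<gamma>"
    and X: "X \<subseteq> V" "Y \<subseteq> V" "X \<inter> Y = {}"
  shows "drawn E p \<gamma> X \<inter> drawn E p \<gamma> Y = {}"
proof -
  have inj: "inj_on p V" and v: "\<And>e. e \<in> E \<Longrightarrow> path_image (\<gamma> e) \<inter> p ` V = p ` e"
    and ef: "\<And>e f. e \<in> E \<Longrightarrow> f \<in> E \<Longrightarrow> e \<noteq> f \<Longrightarrow> path_image (\<gamma> e) \<inter> path_image (\<gamma> f) = p ` (e \<inter> f)"
    using D unfolding plane_drawing_def by blast+
  have ne: "e \<noteq> {}" if "e \<in> E" for e
    using G that by (auto simp: simple_graph_def)
  have im: "p ` A \<inter> p ` B = {}" if "A \<subseteq> X" "B \<subseteq> Y" for A B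
  proof -
    have "p ` (A \<inter> B) = p ` A \<inter> p ` B"
      by (rule inj_on_image_Int[OF inj]) (use that X in auto)
    moreover have "A \<inter> B = {}"
      using that X(3) by blast
    ultimately show ?thesis by simp
  qed
  have 1: "path_image (\<gamma> e) \<inter> p ` Y = {}" if "e \<in> E" "e \<subseteq> X" for e
    using v[OF that(1)] im[OF that(2), of Y] X(2) by blast
  have 2: "path_image (\<gamma> e) \<inter> p ` X = {}" if "e \<in> E" "e \<subseteq> Y" for e
    using v[OF that(1)] im[of X e] X(1) that(2) by blast
  have 3: "path_image (\<gamma> e) \<inter> path_image (\<gamma> f) = {}" if "e \<in> E" "e \<subseteq> X" "f \<in> E" "f \<subseteq> Y" for e f
  proof -
    have "e \<inter> f = {}" using that X(3) by blast
    then show ?thesis using ef[OF that(1,3)] ne[OF that(1)] by auto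
  qed
  have "(\<Union>e\<in>{e \<in> E. e \<subseteq> X}. path_image (\<gamma> e)) \<inter> p ` Y = {}"
    using 1 by blast
  moreover have "p ` X \<inter> (\<Union>e\<in>{e \<in> E. e \<subseteq> Y}. path_image (\<gamma> e)) = {}"
    using 2 by blast
  moreover have "(\<Union>e\<in>{e \<in> E. e \<subseteq> X}. path_image (\<gamma> e)) \<inter> (\<Union>e\<in>{e \<in> E. e \<subseteq> Y}. path_image (\<gamma> e)) = {}"
    using 3 by blast
  ultimately show ?thesis
    using im[of X Y] unfolding drawn_def Int_Un_distrib Int_Un_distrib2 by simp
qed

text \<open>An edge leaving \<open>X\<close> meets the drawing of \<open>X\<close> only in its own end.\<close>

lemma edge_meets_drawn:
  assumes D: "plane_drawing V E p \<gamma>" and e: "e \<in> E" "\<not> e \<subseteq> X" and X: "X \<subseteq> V" "e \<subseteq> V"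
  shows "path_image (\<gamma> e) \<inter> drawn E p \<gamma> X \<subseteq> p ` (e \<inter> X)"
proof -
  have inj: "inj_on p V" and v: "path_image (\<gamma> e) \<inter> p ` V = p ` e"
    and ef: "\<And>f. f \<in> E \<Longrightarrow> e \<noteq> f \<Longrightarrow> path_image (\<gamma> e) \<inter> path_image (\<gamma> f) = p ` (e \<inter> f)"
    using D e unfolding plane_drawing_def by blast+
  have "path_image (\<gamma> e) \<inter> p ` X \<subseteq> p ` e \<inter> p ` X"
    using v X by blast
  also have "\<dots> = p ` (e \<inter> X)"
    using inj X by (simp add: inj_on_image_Int)
  finally have 1: "path_image (\<gamma> e) \<inter> p ` X \<subseteq> p ` (e \<inter> X)" .
  have "path_image (\<gamma> e) \<inter> path_image (\<gamma> f) \<subseteq> p ` (e \<inter> X)" if "f \<in> E" "f \<subseteq> X" for f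
    using ef[OF that(1)] e(2) that(2) by blast
  then have "path_image (\<gamma> e) \<inter> (\<Union>f\<in>{f \<in> E. f \<subseteq> X}. path_image (\<gamma> f)) \<subseteq> p ` (e \<inter> X)"
    by blast
  with 1 show ?thesis
    unfolding drawn_def Int_Un_distrib by simp
qed

text \<open>Each branch set of a \<open>K\<^sub>3\<^sub>,\<^sub>3\<close> model is drawn as a path-connected set with three attachment points, the ends of
the three edges chosen to the opposite side. A tripod in each of the six sets, continued along the nine edges,
yields nine path-connected sets that pairwise meet only in common centers. Arcs inside these sets
contradict the nonplanarity of \<open>K\<^sub>3\<^sub>,\<^sub>3\<close>.\<close>

theorem planar_imp_K33_free:
  assumes G: "simple_graph V E" and "planar V E"
  shows "K33_free V (\<lambda>u v. {u, v} \<in> E)"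
  unfolding K33_free_def
proof
  assume "\<exists>P. K33_model V (\<lambda>u v. {u, v} \<in> E) P"
  then obtain P where P: "K33_model V (\<lambda>u v. {u, v} \<in> E) P" ..
  obtain p \<gamma> where D: "plane_drawing V E p \<gamma>"
    using assms(2) by (auto simp: planar_def)
  let ?D = "\<lambda>m. drawn E p \<gamma> (P m)"
  have PV: "P m \<subseteq> V" and lin: "linked (\<lambda>u v. {u, v} \<in> E) (P m)" if "m < 6" for m
    using P that by (auto simp: K33_model_def)
  have Pdis: "P m \<inter> P n = {}" if "m < 6" "n < 6" "m \<noteq> n" for m n
    using P that by (auto simp: K33_model_def)
  have "\<forall>i j. \<exists>u w. i < 3 \<and> j < 3 \<longrightarrow> u \<in> P i \<and> w \<in> P (3 + j) \<and> {u, w} \<in> E"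
    using P unfolding K33_model_def touch_def by blast
  then obtain u w where uw: "\<And>i j. i < 3 \<Longrightarrow> j < 3 \<Longrightarrow> u i j \<in> P i \<and> w i j \<in> P (3 + j) \<and> {u i j, w i j} \<in> E"
    by metis
  define e where "e i j = {u i j, w i j}" for i j
  define q where "q m k = (if m < 3 then p (u m k) else p (w k (m - 3)))" for m k
  have q_in: "q m k \<in> ?D m" if "m < 6" "k < 3" for m k
  proof (cases "m < 3")
    case True
    then show ?thesis using uw[of m k] that by (auto simp: q_def drawn_def)
  next
    case False
    then show ?thesis using uw[of k "m - 3"] that by (auto simp: q_def drawn_def)
  qed
  have Dpc: "path_connected (?D m)" if "m < 6" for m
    using path_connected_drawn[OF G D PV lin] that by blast
  have Ddis: "?D m \<inter> ?D n = {}" if "m < 6" "n < 6" "m \<noteq> n" for m n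
    by (rule drawn_disjoint[OF G D]) (use PV Pdis that in auto)
  define T where "T m c L \<longleftrightarrow> c \<in> ?D m \<and>
      (\<forall>k<3. L k \<subseteq> ?D m \<and> path_connected (L k) \<and> c \<in> L k \<and> q m k \<in> L k) \<and>
      (\<forall>k<3. \<forall>l<3. k \<noteq> l \<longrightarrow> L k \<inter> L l = {c})" for m c L
  have "\<exists>c L. T m c L" if m: "m < 6" for m
  proof -
    obtain c L where "c \<in> ?D m"
      "\<And>k. k < 3 \<Longrightarrow> L k \<subseteq> ?D m \<and> path_connected (L k) \<and> c \<in> L k \<and> q m k \<in> L k"
      "\<And>k l. k < 3 \<Longrightarrow> l < 3 \<Longrightarrow> k \<noteq> l \<Longrightarrow> L k \<inter> L l = {c}"
      using path_connected_tripod[of "?D m" "q m"] Dpc[OF m] q_in[OF m] by blast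
    then have "T m c L"
      by (simp add: T_def)
    then show ?thesis by blast
  qed
  then obtain c L where T: "\<And>m. m < 6 \<Longrightarrow> T m (c m) (L m)"
    by metis
  have cD: "c m \<in> ?D m" 
    and L: "\<And>k. k < 3 \<Longrightarrow> L m k \<subseteq> ?D m \<and> path_connected (L m k) \<and> c m \<in> L m k \<and> q m k \<in> L m k"
    and Lc: "\<And>k l. k < 3 \<Longrightarrow> l < 3 \<Longrightarrow> k \<noteq> l \<Longrightarrow> L m k \<inter> L m l = {c m}" if "m < 6" for m
    using T[OF that] unfolding T_def by blast+
  have eE: "e i j \<in> E" "e i j \<subseteq> V" "u i j \<in> P i" "w i j \<in> P (3 + j)"
    and earc: "arc (\<gamma> (e i j))" and eends: "p ` e i j \<subseteq> path_image (\<gamma> (e i j))" if "i < 3" "j < 3" for i j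
  proof -
    show e: "e i j \<in> E" "u i j \<in> P i" "w i j \<in> P (3 + j)"
      using uw[OF that] by (simp_all add: e_def)
    show "e i j \<subseteq> V"
      using G e(1) by (simp add: simple_graph_def)
    show "arc (\<gamma> (e i j))" "p ` e i j \<subseteq> path_image (\<gamma> (e i j))"
      using D e(1) unfolding plane_drawing_def by blast+
  qed
  have eP: "e i j \<inter> P m = (if m = i then {u i j} else if m = 3 + j then {w i j} else {})"
    if "i < 3" "j < 3" "m < 6" for i j m
  proof -
    have "P m \<inter> P i = {}" if "m \<noteq> i" using Pdis[of m i] that \<open>m < 6\<close> \<open>i < 3\<close> by simp
    moreover have "P m \<inter> P (3 + j) = {}" if "m \<noteq> 3 + j"
      using Pdis[of m "3 + j"] that \<open>m < 6\<close> \<open>j < 3\<close> by simp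
    moreover have "i \<noteq> 3 + j" using that by simp
    ultimately show ?thesis
      using eE(3,4)[OF that(1,2)] unfolding e_def by (cases "m = i"; cases "m = 3 + j") auto
  qed
  define H where "H i j = L i j \<union> path_image (\<gamma> (e i j)) \<union> L (3 + j) i" for i j
  have H_D: "(m = i \<and> x \<in> L i j) \<or> (m = 3 + j \<and> x \<in> L (3 + j) i)"
    if ij: "i < 3" "j < 3" "m < 6" and x: "x \<in> H i j" "x \<in> ?D m" for i j m x
  proof -
    have "x \<in> L i j \<longrightarrow> m = i" "x \<in> L (3 + j) i \<longrightarrow> m = 3 + j"
      using L[of i j] L[of "3 + j" i] Ddis[of m i] Ddis[of m "3 + j"] ij x by auto
    moreover have "(m = i \<and> x \<in> L i j) \<or> (m = 3 + j \<and> x \<in> L (3 + j) i)" if "x \<in> path_image (\<gamma> (e i j))"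
    proof -
      have "\<not> e i j \<subseteq> P m"
        using eE(3,4)[OF ij(1,2)] Pdis[of m i] Pdis[of m "3 + j"] ij by (auto simp: e_def)
      then have "x \<in> p ` (e i j \<inter> P m)"
        using edge_meets_drawn[OF D eE(1)[OF ij(1,2)] _ PV[OF ij(3)] eE(2)[OF ij(1,2)]] that x(2) by blast
      then have "(m = i \<and> x = q i j) \<or> (m = 3 + j \<and> x = q (3 + j) i)"
        unfolding eP[OF ij] using ij by (auto simp: q_def split: if_splits)
      then show ?thesis
        using L[of i j] L[of "3 + j" i] ij by auto
    qed
    ultimately show ?thesis
      using x(1) by (auto simp: H_def)
  qed
  have meet: "(i = k \<and> x = c i) \<or> (j = l \<and> x = c (3 + j))"
    if ij: "i < 3" "j < 3" "k < 3" "l < 3" "(i, j) \<noteq> (k, l)" and x: "x \<in> H i j" "x \<in> H k l" for i j k l x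
  proof -
    have "\<exists>m<6. x \<in> ?D m"
    proof (cases "x \<in> path_image (\<gamma> (e i j)) \<inter> path_image (\<gamma> (e k l))")
      case False
      then have "x \<in> L i j \<or> x \<in> L (3 + j) i \<or> x \<in> L k l \<or> x \<in> L (3 + l) k"
        using x by (auto simp: H_def)
      moreover have "i < 6" "k < 6" "3 + j < 6" "3 + l < 6"
        using ij by auto
      ultimately show ?thesis
        using L[of i j] L[of "3 + j" i] L[of k l] L[of "3 + l" k] ij by blast
    next
      case True
      have "e i j \<noteq> e k l"
      proof
        assume "e i j = e k l"
        then have "e k l \<inter> P i = {u i j}" "e k l \<inter> P (3 + j) = {w i j}"
          using eP[of i j i] eP[of i j "3 + j"] ij by auto
        then show False
          using eP[of k l i] eP[of k l "3 + j"] ij by (auto split: if_splits)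
      qed
      then have "path_image (\<gamma> (e i j)) \<inter> path_image (\<gamma> (e k l)) = p ` (e i j \<inter> e k l)"
        using D eE(1)[of i j] eE(1)[of k l] ij unfolding plane_drawing_def by blast
      with True have "x \<in> p ` e i j"
        by blast
      then have "x \<in> ?D i \<or> x \<in> ?D (3 + j)"
        using eE(3,4)[of i j] ij by (auto simp: e_def drawn_def)
      then show ?thesis
        using ij by (elim disjE) (rule exI[of _ i], simp, rule exI[of _ "3 + j"], simp)
    qed
    then obtain m where m: "m < 6" "x \<in> ?D m" by blast
    have "(m = i \<and> x \<in> L i j) \<or> (m = 3 + j \<and> x \<in> L (3 + j) i)"
      "(m = k \<and> x \<in> L k l) \<or> (m = 3 + l \<and> x \<in> L (3 + l) k)"
      using H_D[of i j m x] H_D[of k l m x] ij x m by blast+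
    then consider "i = k" "x \<in> L i j" "x \<in> L i l" | "j = l" "x \<in> L (3 + j) i" "x \<in> L (3 + j) k"
      using ij by auto
    then show ?thesis
      using Lc[of i j l] Lc[of "3 + j" i k] ij by cases auto
  qed
  have Hpc: "path_connected (H i j)" "c i \<in> H i j" "c (3 + j) \<in> H i j" if "i < 3" "j < 3" for i j
  proof -
    have LL: "path_connected (L i j)" "q i j \<in> L i j" "c i \<in> L i j"
       "path_connected (L (3 + j) i)" "q (3 + j) i \<in> L (3 + j) i" "c (3 + j) \<in> L (3 + j) i"
      using L[of i j] L[of "3 + j" i] that by auto
    have qq: "q i j \<in> path_image (\<gamma> (e i j))" "q (3 + j) i \<in> path_image (\<gamma> (e i j))"
      using eends[OF that] that by (auto simp: q_def e_def)
    show "c i \<in> H i j" "c (3 + j) \<in> H i j"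
      using LL by (auto simp: H_def)
    have "path_connected (path_image (\<gamma> (e i j)))"
      using earc[OF that] by (simp add: arc_imp_path path_connected_path_image)
    then have "path_connected (L i j \<union> path_image (\<gamma> (e i j)))"
      using LL qq by (intro path_connected_Un) auto
    then show "path_connected (H i j)"
      unfolding H_def using LL qq by (intro path_connected_Un[of "_ \<union> _"]) auto
  qed
  have "\<forall>i j. \<exists>g. i < 3 \<and> j < 3 \<longrightarrow> arc g \<and> path_image g \<subseteq> H i j \<and> pathstart g = c i \<and> pathfinish g = c (3 + j)"
  proof (intro allI)
    fix i j
    show "\<exists>g. i < 3 \<and> j < 3 \<longrightarrow> arc g \<and> path_image g \<subseteq> H i j \<and> pathstart g = c i \<and> pathfinish g = c (3 + j)"
    proof (cases "i < 3 \<and> j < 3")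
      case True
      then have "c i \<noteq> c (3 + j)"
        using cD[of i] cD[of "3 + j"] Ddis[of i "3 + j"] by auto
      then show ?thesis
        using Hpc[of i j] True unfolding path_connected_arcwise by blast
    qed auto
  qed
  then obtain h where h: "\<And>i j. i < 3 \<Longrightarrow> j < 3 \<Longrightarrow>
      arc (h i j) \<and> path_image (h i j) \<subseteq> H i j \<and> pathstart (h i j) = c i \<and> pathfinish (h i j) = c (3 + j)"
    by metis
  show False
  proof (rule no_planar_K33_arcs[of h c "\<lambda>j. c (3 + j)"])
    show "arc (h i j) \<and> pathstart (h i j) = c i \<and> pathfinish (h i j) = c (3 + j)" if "i < 3" "j < 3" for i j
      using h[OF that] by blast
    show "path_image (h i j) \<inter> path_image (h i k) \<subseteq> {c i}" if "i < 3" "j < 3" "k < 3" "j \<noteq> k" for i j k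
      using h[of i j] h[of i k] meet[of i j i k] that by blast
    show "path_image (h i j) \<inter> path_image (h k j) \<subseteq> {c (3 + j)}" if "i < 3" "j < 3" "k < 3" "i \<noteq> k" for i j k
      using h[of i j] h[of k j] meet[of i j k j] that by blast
    show "path_image (h i j) \<inter> path_image (h k l) = {}" if "i < 3" "j < 3" "k < 3" "l < 3" "i \<noteq> k" "j \<noteq> l" for i j k l
      using h[of i j] h[of k l] meet[of i j k l] that by blast
  qed
qed

section \<open>Bipartite graphs without a \<open>K\<^sub>3\<^sub>,\<^sub>3\<close> minor have few edges\<close>

definition relation_adj :: "('v \<times> 'v) set \<Rightarrow> 'v \<Rightarrow> 'v \<Rightarrow> bool" where
  "relation_adj R u v \<longleftrightarrow> (u, v) \<in> R \<or> (v, u) \<in> R"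

text \<open>A bipartite graph is given by its sides and its edges, directed from \<open>X\<close> to \<open>Y\<close>; three vertices are required because
the bound \<open>2n - 4\<close> fails for a single edge.\<close>

definition bipartite_K33_free :: "'v set \<Rightarrow> 'v set \<Rightarrow> ('v \<times> 'v) set \<Rightarrow> bool" where
  "bipartite_K33_free X Y R \<longleftrightarrow> finite X \<and> finite Y \<and> X \<inter> Y = {} \<and> R \<subseteq> X \<times> Y \<and>
     K33_free (X \<union> Y) (relation_adj R) \<and> 3 \<le> card X + card Y"

definition min_counterexample :: "'v set \<Rightarrow> 'v set \<Rightarrow> ('v \<times> 'v) set \<Rightarrow> bool" where
  "min_counterexample X Y R \<longleftrightarrow> bipartite_K33_free X Y R \<and> 2 * (card X + card Y) < card R + 4 \<and>
     (\<forall>(X' :: 'v set) Y' R'. bipartite_K33_free X' Y' R' \<and> card X' + card Y' + card R' < card X + card Y + card R \<longrightarrow>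
        card R' + 4 \<le> 2 * (card X' + card Y'))"

lemma relation_adj_converse [simp]: "relation_adj (R\<inverse>) = relation_adj R"
  by (auto simp: relation_adj_def fun_eq_iff)

lemma bipartite_K33_free_converse: "bipartite_K33_free X Y R \<Longrightarrow> bipartite_K33_free Y X (R\<inverse>)"
  by (auto simp: bipartite_K33_free_def Un_commute)

text \<open>By this symmetry a vertex of degree three may be assumed to lie in \<open>X\<close>.\<close>

lemma min_counterexample_converse:
  assumes "min_counterexample X Y R"
  shows "min_counterexample Y X (R\<inverse>)"
  using assms bipartite_K33_free_converse[of X Y R] unfolding min_counterexample_def by (simp add: add.commute)

lemma bipartite_K33_free_sub:
  assumes "bipartite_K33_free X Y R" "X' \<subseteq> X" "Y' \<subseteq> Y" "R' \<subseteq> R \<inter> X' \<times> Y'" "3 \<le> card X' + card Y'"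
  shows "bipartite_K33_free X' Y' R'"
proof -
  have "K33_free (X' \<union> Y') (relation_adj R')"
    by (rule K33_free_subgraph[of "X \<union> Y" "relation_adj R"]) (use assms in \<open>auto simp: bipartite_K33_free_def relation_adj_def\<close>)
  then show ?thesis
    using assms by (auto simp: bipartite_K33_free_def intro: finite_subset)
qed

lemma min_counterexampleD:
  fixes X Y :: "'v set"
  assumes "min_counterexample X Y R"
  shows "bipartite_K33_free X Y R" "finite X" "finite Y" "X \<inter> Y = {}" "R \<subseteq> X \<times> Y" "finite R"
    "2 * (card X + card Y) < card R + 4"
    "\<And>(X' :: 'v set) Y' R'. bipartite_K33_free X' Y' R' \<Longrightarrow> card X' + card Y' + card R' < card X + card Y + card R \<Longrightarrow>
        card R' + 4 \<le> 2 * (card X' + card Y')"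
proof -
  show b: "bipartite_K33_free X Y R" and "2 * (card X + card Y) < card R + 4"
    and "\<And>(X' :: 'v set) Y' R'. bipartite_K33_free X' Y' R' \<Longrightarrow> card X' + card Y' + card R' < card X + card Y + card R \<Longrightarrow>
        card R' + 4 \<le> 2 * (card X' + card Y')"
    using assms unfolding min_counterexample_def by blast+
  show X: "finite X" "finite Y" "X \<inter> Y = {}" "R \<subseteq> X \<times> Y"
    using b unfolding bipartite_K33_free_def by auto
  then show "finite R"
    by (meson finite_SigmaI finite_subset)
qed

lemma min_counterexample_card:
  assumes m: "min_counterexample X Y R"
  shows "card R + 3 = 2 * (card X + card Y)"
proof (rule ccontr)
  note M = min_counterexampleD[OF m]
  assume "card R + 3 \<noteq> 2 * (card X + card Y)"
  then have big: "2 * (card X + card Y) < card R + 3"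
    using M(7) by simp
  have "3 \<le> card X + card Y"
    using M(1) by (simp add: bipartite_K33_free_def)
  then have "R \<noteq> {}"
    using big by auto
  then obtain e where e: "e \<in> R" by blast
  then have c: "card (R - {e}) + 1 = card R"
    using M(6) by (metis Suc_eq_plus1 card_Suc_Diff1)
  have "bipartite_K33_free X Y (R - {e})"
    by (rule bipartite_K33_free_sub[OF M(1)]) (use M(5) \<open>3 \<le> _\<close> in auto)
  then have "card (R - {e}) + 4 \<le> 2 * (card X + card Y)"
    by (rule M(8)) (use c in simp)
  then show False
    using big c by simp
qed

lemma min_counterexample_order:
  assumes m: "min_counterexample X Y R"
  shows "4 \<le> card X + card Y"
proof (rule ccontr)
  note M = min_counterexampleD[OF m]
  assume "\<not> ?thesis"
  then have n: "card X + card Y = 3"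
    using M(1) by (simp add: bipartite_K33_free_def)
  then have "card X \<in> {0,1,2,3}" "card Y = 3 - card X"
    by auto
  then have "card X * card Y \<le> 2"
    by auto
  moreover have "card R \<le> card X * card Y"
    using M card_mono[OF _ M(5)] by (simp add: card_cartesian_product)
  ultimately show False
    using min_counterexample_card[OF m] n by simp
qed

lemma card_delete_row:
  assumes "finite R"
  shows "card (R - {x} \<times> R `` {x}) + card (R `` {x}) = card R"
proof -
  have sub: "{x} \<times> R `` {x} \<subseteq> R" by auto
  then have "card (R - {x} \<times> R `` {x}) = card R - card ({x} \<times> R `` {x})"
    using assms by (meson card_Diff_subset finite_subset)
  moreover have "card ({x} \<times> R `` {x}) \<le> card R"
    using assms sub by (rule card_mono)
  ultimately show ?thesis
    by (simp add: card_cartesian_product)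
qed

lemma min_counterexample_degree:
  assumes m: "min_counterexample X Y R" and x: "x \<in> X"
  shows "3 \<le> card (R `` {x})"
proof (rule ccontr)
  note M = min_counterexampleD[OF m]
  assume low: "\<not> ?thesis"
  let ?R = "R - {x} \<times> R `` {x}"
  have cX: "card (X - {x}) + 1 = card X"
    using x M(2) by (metis Suc_eq_plus1 card_Suc_Diff1)
  have cR: "card ?R + card (R `` {x}) = card R"
    by (rule card_delete_row[OF M(6)])
  have "bipartite_K33_free (X - {x}) Y ?R"
    by (rule bipartite_K33_free_sub[OF M(1)]) (use M(5) cX min_counterexample_order[OF m] in auto)
  then have "card ?R + 4 \<le> 2 * (card (X - {x}) + card Y)"
    by (rule M(8)) (use cX cR in simp)
  then show False
    using low cX cR M(7) by simp
qed

lemma card_relation_rows: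
  assumes "finite X" "finite Y" "R \<subseteq> X \<times> Y"
  shows "card R = (\<Sum>x\<in>X. card (R `` {x}))"
proof -
  have "R = (SIGMA x:X. R `` {x})"
    using assms(3) by auto
  moreover have "finite (R `` {x})" for x
    by (rule finite_subset[OF _ assms(2)]) (use assms(3) in auto)
  ultimately show ?thesis
    using card_SigmaI[of X "\<lambda>x. R `` {x}"] assms(1) by simp
qed

lemma min_counterexample_degree_3:
  assumes m: "min_counterexample X Y R"
  shows "(\<exists>x\<in>X. card (R `` {x}) = 3) \<or> (\<exists>y\<in>Y. card (R\<inverse> `` {y}) = 3)"
proof (rule ccontr)
  note M = min_counterexampleD[OF m]
  assume no: "\<not> ?thesis"
  have "4 \<le> card (R `` {x})" if "x \<in> X" for x
    using min_counterexample_degree[OF m that] no that by force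
  then have "4 * card X \<le> (\<Sum>x\<in>X. card (R `` {x}))"
    using sum_mono[of X "\<lambda>_. 4" "\<lambda>x. card (R `` {x})"] by simp
  then have 1: "4 * card X \<le> card R"
    using card_relation_rows[OF M(2,3,5)] by simp
  have "4 \<le> card (R\<inverse> `` {y})" if "y \<in> Y" for y
    using min_counterexample_degree[OF min_counterexample_converse[OF m] that] no that by force
  then have "4 * card Y \<le> (\<Sum>y\<in>Y. card (R\<inverse> `` {y}))"
    using sum_mono[of Y "\<lambda>_. 4" "\<lambda>y. card (R\<inverse> `` {y})"] by simp
  also have "\<dots> = card (R\<inverse>)"
  proof -
    have "R\<inverse> \<subseteq> Y \<times> X" using M(5) by auto
    then show ?thesis using card_relation_rows[OF M(3,2)] by metis
  qed
  finally have "4 * card Y \<le> card R"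
    by (simp add: card_inverse)
  with 1 show False
    using min_counterexample_card[OF m] by simp
qed

text \<open>Contracting the path \<open>b - i - b'\<close> through a vertex \<open>i\<close> of degree three removes two vertices. It loses the three edges
at \<open>i\<close> and one edge for every other common neighbor of \<open>b\<close> and \<open>b'\<close>. If there is at most one such neighbor,
at most four edges are lost, and the smaller graph is a counterexample as well.\<close>

lemma min_counterexample_contract:
  fixes X Y :: "'v set"
  assumes m: "min_counterexample X Y R" and i: "i \<in> X" "card (R `` {i}) = 3"
    and b: "(i, b) \<in> R" "(i, b') \<in> R" "b \<noteq> b'"
  shows "3 \<le> card {x \<in> X. (x, b) \<in> R \<and> (x, b') \<in> R}"
proof (rule ccontr)
  note M = min_counterexampleD[OF m]
  let ?C = "{x \<in> X. (x, b) \<in> R \<and> (x, b') \<in> R}"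
  assume few: "\<not> 3 \<le> card ?C"
  define f :: "'v \<times> 'v \<Rightarrow> 'v \<times> 'v" where "f = (\<lambda>(x, y). (x, if y = b' then b else y))"
  define R1 where "R1 = R - {i} \<times> R `` {i}"
  define R' where "R' = f ` R1"
  \<comment> \<open>These are the edges that become parallel to others.\<close>
  define D where "D = (?C - {i}) \<times> {b'}"
  have bY: "b \<in> Y" "b' \<in> Y"
    using b M(5) by auto
  have cR1: "card R1 + 3 = card R"
    using card_delete_row[OF M(6), of i] i by (simp add: R1_def)
  have cD: "card D \<le> 1"
  proof -
    have "i \<in> ?C" using i b by auto
    then have "card (?C - {i}) + 1 = card ?C"
      using M(2) by (metis (no_types, lifting) Suc_eq_plus1 card_Suc_Diff1 finite_Collect_conjI finite_subset mem_Collect_eq subsetI)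
    then show ?thesis
      using few by (simp add: D_def card_cartesian_product)
  qed
  have "inj_on f (R1 - D)"
    using M(5) by (auto simp: inj_on_def f_def R1_def D_def split: if_splits)
  then have "card (R1 - D) = card (f ` (R1 - D))"
    by (simp add: card_image)
  also have "\<dots> \<le> card R'"
    unfolding R'_def by (rule card_mono) (use M(6) in \<open>auto simp: R1_def\<close>)
  finally have "card R1 \<le> card R' + 1"
    using cD diff_card_le_card_Diff[of D R1] M(2)
    by (metis (no_types, lifting) D_def add.commute add_mono finite.emptyI finite.insertI finite_Collect_conjI finite_Diff finite_SigmaI finite_subset le_diff_conv mem_Collect_eq order_trans subsetI)
  then have cR': "card R \<le> card R' + 4"
    using cR1 by simp
  have R'le: "card R' \<le> card R"
    using card_image_le[of R1 f] cR1 M(6) by (simp add: R'_def R1_def)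
  have cX: "card (X - {i}) + 1 = card X" and cY: "card (Y - {b'}) + 1 = card Y"
    using i bY M(2,3) by (metis Suc_eq_plus1 card_Suc_Diff1)+
  have "card (R `` {i}) \<le> card Y"
    by (rule card_mono) (use M(3,5) in auto)
  moreover have "card (R\<inverse> `` {b}) \<le> card X"
    by (rule card_mono) (use M(2,5) in auto)
  ultimately have n6: "3 \<le> card X" "3 \<le> card Y"
    using i min_counterexample_degree[OF min_counterexample_converse[OF m] bY(1)] by simp_all
  \<comment> \<open>The vertex \<open>b\<close> represents the contracted path.\<close>
  let ?F = "\<lambda>w. if w = b then {b, i, b'} else {w}"
  have XY: "b \<notin> X" "b' \<notin> X" "i \<notin> Y"
    using bY i M(4) by auto
  have "K33_free ((X - {i}) \<union> (Y - {b'})) (relation_adj R')"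
  proof (rule K33_free_minor[of "X \<union> Y" "relation_adj R" _ ?F])
    show "K33_free (X \<union> Y) (relation_adj R)"
      using M(1) by (simp add: bipartite_K33_free_def)
    show "linked (relation_adj R) (?F w) \<and> ?F w \<subseteq> X \<union> Y" if "w \<in> (X - {i}) \<union> (Y - {b'})" for w
    proof -
      have "linked (relation_adj R) {b, i, b'}"
        by (rule linked_star[where r = i]) (use b in \<open>auto simp: relation_adj_def\<close>)
      then show ?thesis
        using that i bY by (auto simp: linked_singleton)
    qed
    show "?F v \<inter> ?F w = {}" if "v \<in> (X - {i}) \<union> (Y - {b'})" "w \<in> (X - {i}) \<union> (Y - {b'})" "v \<noteq> w" for v w
      using that XY by auto
    have "touch (relation_adj R) (?F x) (?F y) \<and> touch (relation_adj R) (?F y) (?F x)" if xy: "(x, y) \<in> R'" for x y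
    proof -
      obtain z where z: "(x, z) \<in> R" "x \<noteq> i" "y = (if z = b' then b else z)"
        using xy by (auto simp: R'_def R1_def f_def)
      then have "x \<noteq> b" "x \<in> ?F x" "z \<in> ?F y"
        using M(5) XY by auto
      then show ?thesis
        using z(1) by (auto simp: touch_def relation_adj_def)
    qed
    then show "touch (relation_adj R) (?F v) (?F w)" if "relation_adj R' v w" for v w
      using that unfolding relation_adj_def[of R'] by blast
  qed
  moreover have "R' \<subseteq> (X - {i}) \<times> (Y - {b'})"
  proof
    fix z assume "z \<in> R'"
    then obtain x y where "z = (x, if y = b' then b else y)" "(x, y) \<in> R" "x \<noteq> i"
      by (auto simp: R'_def R1_def f_def)
    then show "z \<in> (X - {i}) \<times> (Y - {b'})"
      using M(5) bY b(3) by auto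
  qed
  ultimately have "bipartite_K33_free (X - {i}) (Y - {b'}) R'"
    using M(2-4) cX cY n6 by (auto simp: bipartite_K33_free_def)
  then have "card R' + 4 \<le> 2 * (card (X - {i}) + card (Y - {b'}))"
    by (rule M(8)) (use cX cY R'le in simp)
  then show False
    using cX cY cR' M(7) by simp
qed

text \<open>Deleting the 4-cycle \<open>i b j b'\<close> leaves a connected graph. Otherwise the graph is the union of two
smaller ones that share exactly the four vertices and four edges of the cycle, and the
bounds \<open>2n\<^sub>1 - 4\<close> and \<open>2n\<^sub>2 - 4\<close> add up to \<open>2n - 4\<close>.\<close>

lemma min_counterexample_4cycle_cut:
  assumes m: "min_counterexample X Y R" and b: "b \<in> Y" "b' \<in> Y" "b \<noteq> b'"
    and i: "i \<in> X" "j \<in> X" "i \<noteq> j" "{i, j} \<times> {b, b'} \<subseteq> R"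
    and U: "U \<subseteq> X \<union> Y - {b, b', i, j}" "u \<in> U" "v \<in> X \<union> Y - {b, b', i, j} - U"
  shows "\<exists>s\<in>U. \<exists>t\<in>X \<union> Y - {b, b', i, j} - U. relation_adj R s t"
proof (rule ccontr)
  assume no: "\<not> ?thesis"
  note M = min_counterexampleD[OF m]
  define V1 where "V1 = U \<union> {b, b', i, j}"
  define V2 where "V2 = X \<union> Y - U"
  define R1 where "R1 = R \<inter> (X \<inter> V1) \<times> (Y \<inter> V1)"
  define R2 where "R2 = R \<inter> (X \<inter> V2) \<times> (Y \<inter> V2)"
  have V: "V1 \<subseteq> X \<union> Y" "V2 \<subseteq> X \<union> Y" "V1 \<union> V2 = X \<union> Y" "V1 \<inter> V2 = {b, b', i, j}"
    using b i U by (auto simp: V1_def V2_def)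
  have fin: "finite (X \<union> Y)" using M by simp
  have ij: "i \<notin> Y" "j \<notin> Y" "b \<notin> X" "b' \<notin> X"
    using i b M(4) by auto
  have split: "card (X \<inter> W) + card (Y \<inter> W) = card W" if "W \<subseteq> X \<union> Y" for W
  proof -
    have "W = (X \<inter> W) \<union> (Y \<inter> W)" "(X \<inter> W) \<inter> (Y \<inter> W) = {}"
      using that M(4) by auto
    then show ?thesis
      using card_Un_disjoint[of "X \<inter> W" "Y \<inter> W"] M(2,3) by simp
  qed
  have n: "card (X \<union> Y) = card X + card Y"
    using M(2-4) by (simp add: card_Un_disjoint)
  have "b \<noteq> i" "b \<noteq> j" "b' \<noteq> i" "b' \<noteq> j"
    using i ij by auto
  then have four: "card {b, b', i, j} = 4"
    using b(3) i(3) by simp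
  have cV: "card V1 + card V2 = card X + card Y + 4"
    using card_Un_Int[of V1 V2] V fin four n by (metis finite_subset)
  have "v \<in> X \<union> Y" "v \<notin> V1" "u \<in> X \<union> Y" "u \<notin> V2"
    using U by (auto simp: V1_def V2_def)
  then have "V1 \<subset> X \<union> Y" "V2 \<subset> X \<union> Y"
    using V(1,2) by blast+
  then have lt: "card V1 < card X + card Y" "card V2 < card X + card Y"
    using psubset_card_mono[OF fin] n by metis+
  have ge: "4 \<le> card V1" "4 \<le> card V2"
  proof -
    have "{b, b', i, j} \<subseteq> V1" "{b, b', i, j} \<subseteq> V2" "finite V1" "finite V2"
      using V(4) finite_subset[OF V(1) fin] finite_subset[OF V(2) fin] by blast+
    then show "4 \<le> card V1" "4 \<le> card V2"
      using card_mono four by metis+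
  qed
  have "(x, y) \<in> R1 \<union> R2" if "(x, y) \<in> R" for x y
  proof -
    have xy: "x \<in> X" "y \<in> Y" "relation_adj R x y" "relation_adj R y x"
      using that M(5) by (auto simp: relation_adj_def)
    consider "x \<in> U" | "y \<in> U" | "x \<notin> U" "y \<notin> U" by blast
    then show ?thesis
    proof cases
      case 1
      then have "y \<in> V1"
        using no xy by (auto simp: V1_def)
      then show ?thesis using 1 xy that by (auto simp: R1_def V1_def)
    next
      case 2
      then have "x \<in> V1"
        using no xy by (auto simp: V1_def)
      then show ?thesis using 2 xy that by (auto simp: R1_def V1_def)
    next
      case 3
      then show ?thesis using xy that by (auto simp: R2_def V2_def)
    qed
  qed
  then have RR: "R = R1 \<union> R2"
    by (auto simp: R1_def R2_def)
  have "R1 \<inter> R2 = R \<inter> (X \<inter> (V1 \<inter> V2)) \<times> (Y \<inter> (V1 \<inter> V2))"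
    by (auto simp: R1_def R2_def)
  also have "\<dots> = {i, j} \<times> {b, b'}"
    unfolding V(4) using i b ij M(5) by auto
  finally have "card (R1 \<inter> R2) = 4"
    using i(3) b(3) by (simp add: card_cartesian_product)
  then have cR: "card R1 + card R2 = card R + 4"
    using card_Un_Int[of R1 R2] RR M(6) by (metis finite_Un)
  have le: "card R1 \<le> card R" "card R2 \<le> card R"
    using M(6) by (auto simp: R1_def R2_def intro: card_mono)
  have bip: "bipartite_K33_free (X \<inter> V1) (Y \<inter> V1) R1" "bipartite_K33_free (X \<inter> V2) (Y \<inter> V2) R2"
    by (rule bipartite_K33_free_sub[OF M(1)]; use split V ge in \<open>auto simp: R1_def R2_def\<close>)+
  have "card R1 + 4 \<le> 2 * card V1"
    using M(8)[OF bip(1)] split[OF V(1)] lt le by simp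
  moreover have "card R2 + 4 \<le> 2 * card V2"
    using M(8)[OF bip(2)] split[OF V(2)] lt le by simp
  ultimately show False
    using cV cR M(7) by simp
qed

text \<open>Suppose \<open>i\<close>, \<open>j\<close>, \<open>k\<close> are common neighbors of \<open>b\<close> and \<open>b'\<close>, and let \<open>U\<close> be a component of the rest that contains a
further neighbor of \<open>i\<close>. Since no 4-cycle separates, \<open>U\<close> also touches \<open>j\<close> and \<open>k\<close>. Then \<open>b\<close>, \<open>b'\<close>, \<open>U\<close> against
\<open>i\<close>, \<open>j\<close>, \<open>k\<close> is a \<open>K\<^sub>3\<^sub>,\<^sub>3\<close> minor.\<close>

lemma min_counterexample_codegree:
  assumes m: "min_counterexample X Y R" and b: "b \<in> Y" "b' \<in> Y" "b \<noteq> b'"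
  shows "card {x \<in> X. (x, b) \<in> R \<and> (x, b') \<in> R} < 3"
proof (rule ccontr)
  note M = min_counterexampleD[OF m]
  assume "\<not> ?thesis"
  then have "3 \<le> card {x \<in> X. (x, b) \<in> R \<and> (x, b') \<in> R}" by simp
  then obtain S where "S \<subseteq> {x \<in> X. (x, b) \<in> R \<and> (x, b') \<in> R}" "card S = 3"
    by (meson obtain_subset_with_card_n)
  then obtain i j k where ijk: "i \<noteq> j" "i \<noteq> k" "j \<noteq> k" "i \<in> X" "j \<in> X" "k \<in> X"
    "{i, j, k} \<times> {b, b'} \<subseteq> R"
    by (auto simp: card_3_iff)
  have "\<not> R `` {i} \<subseteq> {b, b'}"
    using min_counterexample_degree[OF m ijk(4)] b(3) card_mono[of "{b, b'}" "R `` {i}"] by auto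
  then obtain u where u: "(i, u) \<in> R" "u \<noteq> b" "u \<noteq> b'" by blast
  have bX: "b \<notin> X" "b' \<notin> X" "i \<notin> Y" "j \<notin> Y" "k \<notin> Y" "u \<in> Y" "u \<notin> X"
    using b ijk u M(4,5) by auto
  define K where "K = X \<union> Y - {b, b', i, j, k}"
  define r where "r = (\<lambda>v w. v \<in> K \<and> w \<in> K \<and> relation_adj R v w)"
  define U where "U = {v. r\<^sup>*\<^sup>* u v}"
  have uK: "u \<in> K"
    using u bX ijk by (auto simp: K_def)
  have UK: "U \<subseteq> K"
  proof
    fix v assume "v \<in> U"
    then have "r\<^sup>*\<^sup>* u v" by (simp add: U_def)
    then show "v \<in> K" by induction (auto simp: uK r_def)
  qed
  have uU: "u \<in> U" by (simp add: U_def)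
  have closed: "t \<in> U" if "s \<in> U" "t \<in> K" "relation_adj R s t" for s t
    using that UK unfolding U_def r_def by (auto intro: rtranclp.rtrancl_into_rtrancl)
  have linU: "linked (relation_adj R) U"
  proof (rule linked_from_root[where r = u])
    fix x assume "x \<in> U"
    then have "r\<^sup>*\<^sup>* u x" by (simp add: U_def)
    then show "(\<lambda>u v. u \<in> U \<and> v \<in> U \<and> relation_adj R u v)\<^sup>*\<^sup>* u x"
    proof induction
      case (step y z)
      have "y \<in> U" using step(1) by (simp add: U_def)
      moreover have "z \<in> U" using step(1,2) by (simp add: U_def)
      ultimately show ?case
        using step by (auto simp: r_def intro: rtranclp.rtrancl_into_rtrancl)
    qed simp
  qed (auto simp: uU relation_adj_def)
  have reach: "touch (relation_adj R) U {l}"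
    if "{i, j', l} = {i, j, k}" "l \<noteq> i" "l \<noteq> j'" "i \<noteq> j'" for j' l
  proof -
    have in3: "j' \<in> {i, j, k}" "l \<in> {i, j, k}"
      using that(1) by blast+
    then have l: "l \<in> X" "j' \<in> X" "l \<notin> U" "l \<noteq> b" "l \<noteq> b'"
      using ijk UK bX by (auto simp: K_def)
    have "\<exists>s\<in>U. \<exists>t\<in>X \<union> Y - {b, b', i, j'} - U. relation_adj R s t"
    proof (rule min_counterexample_4cycle_cut[OF m b ijk(4) l(2) that(4)])
      show "{i, j'} \<times> {b, b'} \<subseteq> R"
        using ijk(7) in3 by blast
      show "U \<subseteq> X \<union> Y - {b, b', i, j'}"
        using UK in3 by (auto simp: K_def)
      show "l \<in> X \<union> Y - {b, b', i, j'} - U"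
        using l that by simp
    qed (rule uU)
    then obtain s t where st: "s \<in> U" "t \<in> X \<union> Y - {b, b', i, j'} - U" "relation_adj R s t" by blast
    then have "t \<notin> K" using closed by blast
    then have "t = l"
      using st(2) that(1) unfolding K_def by blast
    then show ?thesis
      using st by (auto simp: touch_def)
  qed
  have tj: "touch (relation_adj R) U {j}" "touch (relation_adj R) U {k}"
    by (rule reach[of k j]; use ijk in auto) (rule reach[of j k]; use ijk in auto)
  have ti: "touch (relation_adj R) U {i}"
    using uU u(1) by (auto simp: touch_def relation_adj_def)
  show False
  proof (rule K33_freeD[of "X \<union> Y" "relation_adj R" "{b}" "{b'}" U "{i}" "{j}" "{k}"])
    show "K33_free (X \<union> Y) (relation_adj R)"
      using M(1) by (simp add: bipartite_K33_free_def)
    show "{b} \<union> {b'} \<union> U \<union> {i} \<union> {j} \<union> {k} \<subseteq> X \<union> Y"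
      using b ijk UK by (auto simp: K_def)
  qed (use b ijk bX UK ti tj linU in \<open>auto simp: linked_singleton touch_def relation_adj_def K_def\<close>)
qed

lemma no_min_counterexample: "\<not> min_counterexample X Y R"
proof
  assume m: "min_counterexample X Y R"
  have False if m: "min_counterexample X Y R" and i: "i \<in> X" "card (R `` {i}) = 3" for X Y :: "'a set" and R i
  proof -
    obtain b b' c where "R `` {i} = {b, b', c}" "b \<noteq> b'"
      using i(2) by (auto simp: card_3_iff)
    then have b: "(i, b) \<in> R" "(i, b') \<in> R" "b \<noteq> b'" by auto
    then show False
      using min_counterexample_contract[OF m i b] min_counterexample_codegree[OF m _ _ b(3)] min_counterexampleD(5)[OF m] by fastforce
  qed
  then show False
    using min_counterexample_degree_3[OF m] m min_counterexample_converse[OF m] by blast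
qed

text \<open>In a minimal counterexample a vertex of degree three exists by averaging, and the two preceding
properties of its neighbors \<open>b\<close> and \<open>b'\<close> contradict each other.\<close>

theorem bipartite_K33_free_bound:
  fixes X Y :: "'v set"
  assumes "finite X" "finite Y" "X \<inter> Y = {}" "R \<subseteq> X \<times> Y"
    "K33_free (X \<union> Y) (relation_adj R)" "3 \<le> card X + card Y"
  shows "card R + 4 \<le> 2 * (card X + card Y)"
proof -
  have "card R + 4 \<le> 2 * (card X + card Y)" if "bipartite_K33_free X Y R" for X Y :: "'v set" and R
    using that
  proof (induction "card X + card Y + card R" arbitrary: X Y R rule: less_induct)
    case less
    show ?case
    proof (rule ccontr)
      assume "\<not> ?thesis"
      then have "min_counterexample X Y R"
        using less unfolding min_counterexample_def by (auto simp: not_le)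
      then show False
        using no_min_counterexample by blast
    qed
  qed
  then show ?thesis
    using assms by (simp add: bipartite_K33_free_def)
qed

section \<open>Counting connected sets that touch three hubs\<close>

lemma three_le_card:
  assumes "finite A" "a \<in> A" "b \<in> A" "c \<in> A" "a \<noteq> b" "a \<noteq> c" "b \<noteq> c"
  shows "3 \<le> card A"
proof -
  have "card {a, b, c} = 3"
    using assms by simp
  moreover have "card {a, b, c} \<le> card A"
    by (rule card_mono) (use assms in auto)
  ultimately show ?thesis by simp
qed

lemma linked_pair:
  assumes "\<And>u v. adj u v \<Longrightarrow> adj v u" "adj u v"
  shows "linked adj {u, v}"
  by (rule linked_star[where r = u]) (use assms in auto)

text \<open>The edge bound, applied to the bipartite minor whose vertices are disjoint connected sets.\<close>

lemma touch_families_bound: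
  fixes J W :: "'v set set"
  assumes K: "K33_free V adj" and sym: "\<And>u v. adj u v \<Longrightarrow> adj v u"
    and fin: "finite J" "finite W" and JW: "J \<inter> W = {}" and dis: "pairwise disjnt (J \<union> W)"
    and lin: "\<And>X. X \<in> J \<union> W \<Longrightarrow> linked adj X \<and> X \<subseteq> V"
    and n: "3 \<le> card J + card W"
  shows "(\<Sum>X\<in>J. card {Y \<in> W. touch adj X Y}) + 4 \<le> 2 * (card J + card W)"
proof -
  define R where "R = {(X, Y). X \<in> J \<and> Y \<in> W \<and> touch adj X Y}"
  have R: "R \<subseteq> J \<times> W" by (auto simp: R_def)
  have "K33_free (J \<union> W) (relation_adj R)"
  proof (rule K33_free_minor[OF K, where F = id])
    show "id X \<inter> id Y = {}" if "X \<in> J \<union> W" "Y \<in> J \<union> W" "X \<noteq> Y" for X Y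
      using dis that by (auto simp: pairwise_def disjnt_def)
    show "touch adj (id X) (id Y)" if "relation_adj R X Y" for X Y
      using that sym by (auto simp: relation_adj_def R_def touch_def)
  qed (use lin in auto)
  then have "card R + 4 \<le> 2 * (card J + card W)"
    using bipartite_K33_free_bound[OF fin JW R] n by blast
  moreover have "card R = (\<Sum>X\<in>J. card (R `` {X}))"
    by (rule card_relation_rows[OF fin R])
  moreover have "R `` {X} = {Y \<in> W. touch adj X Y}" if "X \<in> J" for X
    using that by (auto simp: R_def)
  ultimately show ?thesis
    by simp
qed

text \<open>If every set of \<open>J\<close> touches at least three of the hubs in \<open>W\<close>, the edge bound limits the excess over two in
terms of the number of hubs alone.\<close>

lemma pods_bound:
  fixes J W :: "'v set set"
  assumes K: "K33_free V adj" and sym: "\<And>u v. adj u v \<Longrightarrow> adj v u"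
    and fin: "finite J" "finite W" and JW: "J \<inter> W = {}" and dis: "pairwise disjnt (J \<union> W)"
    and lin: "\<And>X. X \<in> J \<union> W \<Longrightarrow> linked adj X \<and> X \<subseteq> V"
    and W: "W \<noteq> {}" and three: "\<And>X. X \<in> J \<Longrightarrow> 3 \<le> card {Y \<in> W. touch adj X Y}"
  shows "(\<Sum>X\<in>J. card {Y \<in> W. touch adj X Y} - 2) + 2 \<le> 2 * card W" 
    and "card J + 2 \<le> 2 * card W"
proof -
  have c: "(\<Sum>X\<in>J. card {Y \<in> W. touch adj X Y}) = (\<Sum>X\<in>J. card {Y \<in> W. touch adj X Y} - 2) + 2 * card J"
  proof -
    have "(\<Sum>X\<in>J. card {Y \<in> W. touch adj X Y}) = (\<Sum>X\<in>J. (card {Y \<in> W. touch adj X Y} - 2) + 2)"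
      by (rule sum.cong) (use three in force)+
    also have "\<dots> = (\<Sum>X\<in>J. card {Y \<in> W. touch adj X Y} - 2) + (\<Sum>X\<in>J. 2)"
      by (rule sum.distrib)
    finally show ?thesis by simp
  qed
  show 1: "(\<Sum>X\<in>J. card {Y \<in> W. touch adj X Y} - 2) + 2 \<le> 2 * card W"
  proof (cases "J = {}")
    case True
    moreover have "0 < card W"
      using W fin(2) by (simp add: card_gt_0_iff)
    ultimately show ?thesis by simp
  next
    case False
    then obtain X where "X \<in> J" by blast
    then have "3 \<le> card {Y \<in> W. touch adj X Y}"
      using three by blast
    also have "\<dots> \<le> card W"
      by (rule card_mono) (use fin in auto)
    finally have "3 \<le> card J + card W" by simp
    from touch_families_bound[OF K sym fin JW dis lin this] c show ?thesis
      by simp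
  qed
  have "card J = (\<Sum>X\<in>J. 1)" by simp
  also have "\<dots> \<le> (\<Sum>X\<in>J. card {Y \<in> W. touch adj X Y} - 2)"
    by (rule sum_mono) (use three in force)
  finally show "card J + 2 \<le> 2 * card W"
    using 1 by simp
qed

lemma maximal_disjoint_subfamily:
  assumes "finite C" "{} \<notin> C"
  obtains F where "F \<subseteq> C" "pairwise disjnt F" "\<And>X. X \<in> C \<Longrightarrow> X \<inter> \<Union>F \<noteq> {}"
proof -
  let ?A = "{F. F \<subseteq> C \<and> pairwise disjnt F}"
  have "finite ?A" 
    by (rule finite_subset[of _ "Pow C"]) (use assms(1) in auto)
  moreover have "{} \<in> ?A" by (simp add: pairwise_def)
  ultimately have "\<exists>F\<in>?A. {} \<subseteq> F \<and> (\<forall>G\<in>?A. F \<subseteq> G \<longrightarrow> F = G)"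
    by (rule finite_has_maximal2)
  then obtain F where F: "F \<in> ?A" and max: "\<forall>G\<in>?A. F \<subseteq> G \<longrightarrow> F = G"
    by (elim bexE conjE)
  have "X \<inter> \<Union>F \<noteq> {}" if X: "X \<in> C" for X
  proof
    assume dis: "X \<inter> \<Union>F = {}"
    then have "insert X F \<in> ?A"
      using F X by (auto simp: pairwise_insert disjnt_def)
    then have "F = insert X F"
      using max by (meson subset_insertI)
    then have "X \<in> F" by blast
    then have "X = {}" using dis by blast
    then show False using X assms(2) by blast
  qed
  then show ?thesis
    by (rule that[of F, rotated 2]) (use F in auto)
qed

text \<open>Adding the vertices one by one, each to the side where it has fewer neighbors, cuts at least half of all edges; the
factor four arises because the left-hand side counts ordered pairs.\<close>

lemma large_cut:
  assumes "finite B" and sym: "\<And>u v. adj u v \<Longrightarrow> adj v u" and irr: "\<And>u. \<not> adj u u"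
  shows "\<exists>X Y. X \<union> Y = B \<and> X \<inter> Y = {} \<and>
    card {(x, y). x \<in> B \<and> y \<in> B \<and> adj x y} \<le> 4 * card {(x, y). x \<in> X \<and> y \<in> Y \<and> adj x y}"
  using assms(1)
proof (induction B rule: finite_induct)
  case empty
  then show ?case by auto
next
  case (insert v B)
  then obtain X Y where XY: "X \<union> Y = B" "X \<inter> Y = {}" and
    le: "card {(x, y). x \<in> B \<and> y \<in> B \<and> adj x y} \<le> 4 * card {(x, y). x \<in> X \<and> y \<in> Y \<and> adj x y}"
    by blast
  let ?e = "\<lambda>X Y. {(x, y). x \<in> X \<and> y \<in> Y \<and> adj x y}"
  have fin: "finite X" "finite Y" "v \<notin> X" "v \<notin> Y"
    using insert XY by auto
  define NX where "NX = {x \<in> X. adj x v}"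
  define NY where "NY = {y \<in> Y. adj y v}"
  have finN: "finite NX" "finite NY"
    using fin by (auto simp: NX_def NY_def)
  have fe: "finite (?e X Y)" if "finite X" "finite Y" for X Y
    by (rule finite_subset[of _ "X \<times> Y"]) (use that in auto)
  have "?e (insert v B) (insert v B) \<subseteq> ?e B B \<union> ({v} \<times> (NX \<union> NY) \<union> (NX \<union> NY) \<times> {v})"
    using XY irr sym by (auto simp: NX_def NY_def)
  then have "card (?e (insert v B) (insert v B)) \<le> card (?e B B \<union> ({v} \<times> (NX \<union> NY) \<union> (NX \<union> NY) \<times> {v}))"
    by (rule card_mono[rotated]) (use fe insert(1) finN in auto)
  also have "\<dots> \<le> card (?e B B) + (card ({v} \<times> (NX \<union> NY)) + card ((NX \<union> NY) \<times> {v}))"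
    by (meson add_left_mono card_Un_le order_trans)
  also have "\<dots> = card (?e B B) + 2 * card (NX \<union> NY)"
    by (simp add: card_cartesian_product)
  also have "\<dots> \<le> card (?e B B) + 2 * (card NX + card NY)"
    using card_Un_le[of NX NY] by simp
  finally have up: "card (?e (insert v B) (insert v B)) \<le> 4 * card (?e X Y) + 2 * (card NX + card NY)"
    using le by simp
  have nat_cut: "e \<le> 4 * c'" if "e \<le> 4 * c + 2 * (m + n)" "n \<le> m" "d \<le> c'" "d = c + m" for e c c' d m n :: nat
    using that by simp
  show ?case
  proof (cases "card NY \<le> card NX")
    case True
    have "?e X Y \<union> NX \<times> {v} \<subseteq> ?e X (insert v Y)"
      by (auto simp: NX_def)
    then have w1: "card (?e X Y \<union> NX \<times> {v}) \<le> card (?e X (insert v Y))"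
      using fin by (intro card_mono fe) auto
    have w2: "card (?e X Y \<union> NX \<times> {v}) = card (?e X Y) + card NX"
      using fin fe finN by (subst card_Un_disjoint) (auto simp: card_cartesian_product)
    have "card (?e (insert v B) (insert v B)) \<le> 4 * card (?e X (insert v Y))"
      by (rule nat_cut[OF up True w1 w2])
    moreover have "X \<union> insert v Y = insert v B" "X \<inter> insert v Y = {}"
      using XY fin by auto
    ultimately show ?thesis by blast
  next
    case False
    have "?e X Y \<union> {v} \<times> NY \<subseteq> ?e (insert v X) Y"
      using sym by (auto simp: NY_def)
    then have w1: "card (?e X Y \<union> {v} \<times> NY) \<le> card (?e (insert v X) Y)"
      using fin by (intro card_mono fe) auto
    have w2: "card (?e X Y \<union> {v} \<times> NY) = card (?e X Y) + card NY"
      using fin fe finN by (subst card_Un_disjoint) (auto simp: card_cartesian_product)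
    have "card NX \<le> card NY"
      using False by simp
    have "card (?e (insert v B) (insert v B)) \<le> 4 * card (?e (insert v X) Y)"
      by (rule nat_cut[OF up[unfolded add.commute[of "card NX"]] \<open>card NX \<le> card NY\<close> w1 w2])
    moreover have "insert v X \<union> Y = insert v B" "insert v X \<inter> Y = {}"
      using XY fin by auto
    ultimately show ?thesis by blast
  qed
qed

lemma adjacent_pairs_bound:
  fixes B :: "'v set"
  assumes K: "K33_free B adj" and sym: "\<And>u v. adj u v \<Longrightarrow> adj v u" and irr: "\<And>u. \<not> adj u u"
    and B: "finite B" "B \<noteq> {}"
  shows "(\<Sum>x\<in>B. card {y \<in> B. adj x y}) + 8 \<le> 8 * card B"
proof -
  have "\<exists>X Y. X \<union> Y = B \<and> X \<inter> Y = {} \<and>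
    card {(x, y). x \<in> B \<and> y \<in> B \<and> adj x y} \<le> 4 * card {(x, y). x \<in> X \<and> y \<in> Y \<and> adj x y}"
    by (rule large_cut[OF B(1)]) (fact sym irr)+
  then obtain X Y where XY: "X \<union> Y = B" "X \<inter> Y = {}" and
    le: "card {(x, y). x \<in> B \<and> y \<in> B \<and> adj x y} \<le> 4 * card {(x, y). x \<in> X \<and> y \<in> Y \<and> adj x y}"
    by (elim exE conjE)
  define R where "R = {(x, y). x \<in> X \<and> y \<in> Y \<and> adj x y}"
  have fin: "finite X" "finite Y" and n: "card X + card Y = card B"
    using XY B(1) by (auto simp: card_Un_disjoint)
  have R: "R \<subseteq> X \<times> Y" by (auto simp: R_def)
  have KR: "K33_free (X \<union> Y) (relation_adj R)"
    by (rule K33_free_subgraph[OF K]) (use XY sym in \<open>auto simp: relation_adj_def R_def\<close>)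
  have "card R + 2 \<le> 2 * card B"
  proof (cases "3 \<le> card B")
    case True
    then show ?thesis
      using bipartite_K33_free_bound[OF fin XY(2) R KR] n by simp
  next
    case False
    have "card B \<noteq> 0" using B by simp
    then have "card X = 0 \<or> card Y = 0 \<or> (card X = 1 \<and> card Y = 1)"
      using False n by auto
    moreover have "card R \<le> card X * card Y"
      using card_mono[OF _ R] fin by (simp add: card_cartesian_product)
    ultimately show ?thesis
      using n \<open>card B \<noteq> 0\<close> by auto
  qed
  moreover have "card {(x, y). x \<in> B \<and> y \<in> B \<and> adj x y} = (\<Sum>x\<in>B. card {y \<in> B. adj x y})"
  proof -
    have "{(x, y). x \<in> B \<and> y \<in> B \<and> adj x y} = (SIGMA x:B. {y \<in> B. adj x y})"
      by auto
    then show ?thesis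
      using B(1) by simp
  qed
  ultimately show ?thesis
    using le by (simp add: R_def)
qed

lemma pairwise_disjnt_Un:
  assumes A: "pairwise disjnt A" and C: "pairwise disjnt C" and AC: "\<Union>A \<inter> \<Union>C = {}"
  shows "pairwise disjnt (A \<union> C)"
proof (rule pairwiseI)
  fix X Y assume XY: "X \<in> A \<union> C" "Y \<in> A \<union> C" "X \<noteq> Y"
  consider "X \<in> A" "Y \<in> A" | "X \<in> C" "Y \<in> C" | "X \<in> A" "Y \<in> C" | "X \<in> C" "Y \<in> A"
    using XY(1,2) by blast
  then show "disjnt X Y"
  proof cases
    case 1
    then show ?thesis using pairwiseD[OF A] XY(3) by blast
  next
    case 2
    then show ?thesis using pairwiseD[OF C] XY(3) by blast
  next
    case 3
    then show ?thesis using AC unfolding disjnt_def by blast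
  next
    case 4
    then show ?thesis using AC unfolding disjnt_def by blast
  qed
qed

lemma pairwise_disjnt_singletons: "pairwise disjnt ((\<lambda>v. {v}) ` A)"
  by (auto simp: pairwise_def disjnt_def)

section \<open>Irreducible graphs have small average big degree\<close>

text \<open>The structure that remains when no small vertex can be used for the induction: \<open>S\<close> and \<open>B\<close> are the small and the big
vertices. The last three conditions say why a small vertex with none, one or two big neighbors is not
usable. The condition for one big neighbor exhibits two disjoint edges \<open>ay\<close> and \<open>a'y'\<close> that may be opposite to the
edge from \<open>v\<close>; the condition for two exhibits a small
neighbor that sees a different set of big vertices.\<close>

locale irreducible_graph =
  fixes S B :: "'v set" and adj :: "'v \<Rightarrow> 'v \<Rightarrow> bool" and hub_nbrs :: "'v \<Rightarrow> 'v set"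
  assumes hub_nbrs_def: "hub_nbrs v = {x \<in> B. adj v x}"
    and finS: "finite S" and finB: "finite B" and SB: "S \<inter> B = {}"
    and sym: "adj u v \<Longrightarrow> adj v u" and irr: "\<not> adj u u"
    and K: "K33_free (S \<union> B) adj"
    and Bne: "B \<noteq> {}"
    and none: "v \<in> S \<Longrightarrow> hub_nbrs v \<noteq> {}"
    and one: "v \<in> S \<Longrightarrow> card (hub_nbrs v) = 1 \<Longrightarrow> 
      \<exists>a\<in>S. \<exists>a'\<in>S. \<exists>y\<in>hub_nbrs a. \<exists>y'\<in>hub_nbrs a'. adj v a \<and> adj v a' \<and> a \<noteq> a' \<and> y \<noteq> y' \<and> y \<notin> hub_nbrs v \<and> y' \<notin> hub_nbrs v"
    and two: "v \<in> S \<Longrightarrow> card (hub_nbrs v) = 2 \<Longrightarrow> \<exists>z\<in>S. adj v z \<and> hub_nbrs z \<noteq> hub_nbrs v"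
begin

text \<open>Small vertices with three or more hub neighbors are pods by themselves.\<close>

definition rich where "rich = {v \<in> S. 3 \<le> card (hub_nbrs v)}"

definition hub_sets :: "'v set set" where "hub_sets = (\<lambda>x. {x}) ` B"

lemma finite_hub_nbrs: "finite (hub_nbrs v)"
  using finB by (simp add: hub_nbrs_def)

lemma hub_sets: "finite hub_sets" "card hub_sets = card B" "hub_sets \<noteq> {}" "\<Union>hub_sets = B" "pairwise disjnt hub_sets"
  using finB Bne by (auto simp: hub_sets_def card_image inj_on_def pairwise_def)

lemma hub_nbrs_cases: "v \<in> S - rich \<Longrightarrow> card (hub_nbrs v) = 1 \<or> card (hub_nbrs v) = 2"
  using none[of v] finite_hub_nbrs[of v] by (auto simp: rich_def card_gt_0_iff not_le less_Suc_eq numeral_3_eq_3)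

lemma touch_hub: "{Y \<in> hub_sets. touch adj X Y} = (\<lambda>x. {x}) ` (\<Union>v\<in>X. hub_nbrs v)"
  by (auto simp: hub_sets_def touch_def hub_nbrs_def)

lemma card_touch_hub: "card {Y \<in> hub_sets. touch adj X Y} = card (\<Union>v\<in>X. hub_nbrs v)"
  unfolding touch_hub by (rule card_image) (simp add: inj_on_def)

lemma linked_hub: "X \<in> hub_sets \<Longrightarrow> linked adj X"
  by (auto simp: hub_sets_def linked_singleton)

text \<open>The bound for families of connected sets, relative to any family of hubs that contains the single big vertices.\<close>

lemma pod_bound:
  assumes W: "hub_sets \<subseteq> W" "finite W" "pairwise disjnt (J \<union> W)" and J: "finite J" "\<Union>J \<inter> \<Union>W = {}"
    and lin: "\<And>X. X \<in> J \<union> W \<Longrightarrow> linked adj X \<and> X \<subseteq> S \<union> B"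
    and three: "\<And>X. X \<in> J \<Longrightarrow> 3 \<le> card {Y \<in> W. touch adj X Y}"
  shows "(\<Sum>X\<in>J. card {Y \<in> W. touch adj X Y} - 2) + 2 \<le> 2 * card W" 
    and "card J + 2 \<le> 2 * card W"
proof -
  have "J \<inter> W = {}"
  proof (rule ccontr)
    assume "J \<inter> W \<noteq> {}"
    then obtain X where "X \<in> J" "X \<in> W" by blast
    moreover have "X \<noteq> {}"
      using lin[of X] \<open>X \<in> J\<close> by (auto simp: linked_def)
    ultimately show False using J(2) by blast
  qed
  then have JW: "J \<inter> W = {}" .
  have Wne: "W \<noteq> {}" using W(1) hub_sets(3) by blast
  note b = pods_bound[where V = "S \<union> B" and J = J and W = W, OF K sym J(1) W(2) JW W(3) lin Wne three]
  show "(\<Sum>X\<in>J. card {Y \<in> W. touch adj X Y} - 2) + 2 \<le> 2 * card W"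
    by (rule b(1))
  show "card J + 2 \<le> 2 * card W"
    by (rule b(2))
qed

text \<open>Maximal families of disjoint connected sets of at most three vertices that see at least three big
vertices. Three vertices suffice to unite a vertex \<open>v\<close> with the two neighbors \<open>a\<close> and \<open>a'\<close> of the irreducibility
condition.\<close>

definition pod_family :: "'v set set \<Rightarrow> bool" where
  "pod_family F \<longleftrightarrow> F \<subseteq> {X. X \<subseteq> S - rich \<and> linked adj X \<and> card X \<le> 3 \<and> 3 \<le> card (\<Union>v\<in>X. hub_nbrs v)} \<and>
     pairwise disjnt F \<and>
     (\<forall>X. X \<subseteq> S - rich \<and> linked adj X \<and> card X \<le> 3 \<and> 3 \<le> card (\<Union>v\<in>X. hub_nbrs v) \<longrightarrow> X \<inter> \<Union>F \<noteq> {})"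

lemma pod_family_exists: "\<exists>F. pod_family F"
proof -
  let ?C = "{X. X \<subseteq> S - rich \<and> linked adj X \<and> card X \<le> 3 \<and> 3 \<le> card (\<Union>v\<in>X. hub_nbrs v)}"
  have "finite ?C"
    by (rule finite_subset[of _ "Pow S"]) (use finS in auto)
  moreover have "{} \<notin> ?C" by (simp add: linked_def)
  ultimately obtain F where "F \<subseteq> ?C" "pairwise disjnt F" "\<And>X. X \<in> ?C \<Longrightarrow> X \<inter> \<Union>F \<noteq> {}"
    by (rule maximal_disjoint_subfamily) blast
  then have "pod_family F"
    unfolding pod_family_def by (intro conjI allI impI) simp_all
  then show ?thesis by (rule exI)
qed

definition small_pods where "small_pods = (SOME F. pod_family F)"
definition first_pods where "first_pods = (\<lambda>v. {v}) ` rich \<union> small_pods"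
definition podded where "podded = \<Union>first_pods"
definition rest where "rest = S - podded"

lemma small_pods_family: "pod_family small_pods"
  unfolding small_pods_def by (rule someI_ex[OF pod_family_exists])

lemma small_pods: 
  assumes "X \<in> small_pods"
  shows "X \<subseteq> S - rich" "linked adj X" "card X \<le> 3" "3 \<le> card (\<Union>v\<in>X. hub_nbrs v)"
proof -
  have "small_pods \<subseteq> {X. X \<subseteq> S - rich \<and> linked adj X \<and> card X \<le> 3 \<and> 3 \<le> card (\<Union>v\<in>X. hub_nbrs v)}"
    using small_pods_family unfolding pod_family_def by (elim conjE)
  from subsetD[OF this assms] 
  show "X \<subseteq> S - rich" "linked adj X" "card X \<le> 3" "3 \<le> card (\<Union>v\<in>X. hub_nbrs v)"
    by simp_all
qed

lemma small_pods_disjoint: "pairwise disjnt small_pods"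
  using small_pods_family unfolding pod_family_def by (elim conjE)

text \<open>By maximality no connected set of at most three remaining vertices sees three big vertices.\<close>

lemma small_pods_maximal:
  assumes "X \<subseteq> rest" "linked adj X" "card X \<le> 3"
  shows "card (\<Union>v\<in>X. hub_nbrs v) < 3"
proof (rule ccontr)
  assume "\<not> ?thesis"
  moreover have "X \<subseteq> S - rich"
    using assms(1) by (auto simp: rest_def podded_def first_pods_def)
  moreover have "X \<subseteq> S - rich \<and> linked adj X \<and> card X \<le> 3 \<and> 3 \<le> card (\<Union>v\<in>X. hub_nbrs v) \<longrightarrow> X \<inter> \<Union>small_pods \<noteq> {}"
    using small_pods_family unfolding pod_family_def by simp
  ultimately have "X \<inter> \<Union>small_pods \<noteq> {}"
    using assms(2,3) by (simp add: not_less)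
  then show False
    using assms(1) by (auto simp: rest_def podded_def first_pods_def)
qed

lemma first_pods:
  assumes "X \<in> first_pods"
  shows "X \<subseteq> S" "linked adj X" "card X \<le> 3" "3 \<le> card (\<Union>v\<in>X. hub_nbrs v)"
    "(\<Sum>v\<in>X. card (hub_nbrs v)) \<le> 6 * (card (\<Union>v\<in>X. hub_nbrs v) - 2)"
proof -
  consider v where "v \<in> rich" "X = {v}" | "X \<in> small_pods"
    using assms by (auto simp: first_pods_def)
  then have "X \<subseteq> S \<and> linked adj X \<and> card X \<le> 3 \<and> 3 \<le> card (\<Union>v\<in>X. hub_nbrs v) \<and>
    (\<Sum>v\<in>X. card (hub_nbrs v)) \<le> 6 * (card (\<Union>v\<in>X. hub_nbrs v) - 2)"
  proof cases
    case 1
    then show ?thesis by (auto simp: rich_def linked_singleton)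
  next
    case 2
    note F = small_pods[OF 2]
    have "(\<Sum>v\<in>X. card (hub_nbrs v)) \<le> (\<Sum>v\<in>X. 2)"
      by (rule sum_mono) (use hub_nbrs_cases F(1) in force)
    also have "\<dots> \<le> 6" using F(3) by simp
    also have "\<dots> \<le> 6 * (card (\<Union>v\<in>X. hub_nbrs v) - 2)" using F(4) by simp
    finally show ?thesis using F by auto
  qed
  then show "X \<subseteq> S" "linked adj X" "card X \<le> 3" "3 \<le> card (\<Union>v\<in>X. hub_nbrs v)"
    "(\<Sum>v\<in>X. card (hub_nbrs v)) \<le> 6 * (card (\<Union>v\<in>X. hub_nbrs v) - 2)" by auto
qed

lemma finite_first_pods: "finite first_pods" "X \<in> first_pods \<Longrightarrow> finite X" "podded \<subseteq> S" "finite podded"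
proof -
  have "first_pods \<subseteq> Pow S" using first_pods(1) by blast
  then show "finite first_pods" "podded \<subseteq> S" "X \<in> first_pods \<Longrightarrow> finite X"
    using finS by (auto simp: podded_def intro: finite_subset)
  then show "finite podded"
    using finS finite_subset by blast
qed

lemma first_pods_disjoint: "pairwise disjnt first_pods"
  unfolding first_pods_def
  by (rule pairwise_disjnt_Un[OF pairwise_disjnt_singletons small_pods_disjoint]) (use small_pods(1) in blast)

lemma first_pods_hubs_disjoint: "pairwise disjnt (first_pods \<union> hub_sets)"
  by (rule pairwise_disjnt_Un[OF first_pods_disjoint hub_sets(5)]) (use first_pods(1) hub_sets(4) SB in blast)

lemma first_pods_hubs_linked: 
  assumes "X \<in> first_pods \<union> hub_sets"
  shows "linked adj X \<and> X \<subseteq> S \<union> B"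
  using assms
proof
  assume "X \<in> first_pods"
  then show ?thesis using first_pods(1,2)[of X] by auto
next
  assume "X \<in> hub_sets"
  then show ?thesis using linked_hub[of X] by (auto simp: hub_sets_def)
qed

lemma first_pods_bound: "(\<Sum>X\<in>first_pods. card (\<Union>v\<in>X. hub_nbrs v) - 2) + 2 \<le> 2 * card B" "card first_pods + 2 \<le> 2 * card B"
proof -
  have dis: "\<Union>first_pods \<inter> \<Union>hub_sets = {}"
    using first_pods(1) SB unfolding hub_sets(4) by blast
  have three: "3 \<le> card {Y \<in> hub_sets. touch adj X Y}" if "X \<in> first_pods" for X
    unfolding card_touch_hub by (rule first_pods(4)[OF that])
  note b = pod_bound[OF order_refl hub_sets(1) first_pods_hubs_disjoint finite_first_pods(1) dis first_pods_hubs_linked three]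
  show "(\<Sum>X\<in>first_pods. card (\<Union>v\<in>X. hub_nbrs v) - 2) + 2 \<le> 2 * card B" "card first_pods + 2 \<le> 2 * card B"
    using b by (simp_all only: card_touch_hub hub_sets(2))
qed

text \<open>A rich vertex with \<open>d\<close> big neighbors is charged \<open>d \<le> 3(d - 2)\<close>, and a pod of at most three vertices with at most two big
neighbors each is charged at most six; hence the factor \<open>6\<close>.\<close>

lemma podded_degrees: "(\<Sum>v\<in>podded. card (hub_nbrs v)) + 12 \<le> 12 * card B"
proof -
  have "(\<Sum>v\<in>podded. card (hub_nbrs v)) = (\<Sum>X\<in>first_pods. \<Sum>v\<in>X. card (hub_nbrs v))"
    unfolding podded_def using first_pods_disjoint finite_first_pods(2)
    by (subst sum.Union_disjoint) (auto simp: pairwise_def disjnt_def)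
  also have "\<dots> \<le> (\<Sum>X\<in>first_pods. 6 * (card (\<Union>v\<in>X. hub_nbrs v) - 2))"
    by (rule sum_mono) (rule first_pods(5))
  also have "\<dots> = 6 * (\<Sum>X\<in>first_pods. card (\<Union>v\<in>X. hub_nbrs v) - 2)"
    by (simp add: sum_distrib_left)
  finally show ?thesis
    using first_pods_bound(1) by simp
qed

lemma podded_card: "card podded + 6 \<le> 6 * card B"
proof -
  have "card podded \<le> (\<Sum>X\<in>first_pods. card X)"
    unfolding podded_def by (rule card_Union_le_sum_card_weak) (use finite_first_pods in auto)
  also have "\<dots> \<le> (\<Sum>X\<in>first_pods. 3)"
    by (rule sum_mono) (rule first_pods(3))
  finally show ?thesis
    using first_pods_bound(2) by simp
qed

text \<open>In the second round the contracted pods serve as hubs as well.\<close>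

definition first_hubs where "first_hubs = hub_sets \<union> first_pods"

lemma first_hubs: "finite first_hubs" "card first_hubs + 2 \<le> 3 * card B" "\<Union>first_hubs = B \<union> podded"
proof -
  show "finite first_hubs" "\<Union>first_hubs = B \<union> podded"
    using hub_sets finite_first_pods by (auto simp: first_hubs_def podded_def)
  have "card first_hubs \<le> card hub_sets + card first_pods"
    unfolding first_hubs_def by (rule card_Un_le)
  then show "card first_hubs + 2 \<le> 3 * card B"
    using first_pods_bound(2) hub_sets(2) by simp
qed

text \<open>A second-round pod sees three hubs of the first round. Bounding its contribution by three
admits single vertices and pairs in which one vertex has only one big neighbor.\<close>

definition second_pod where
  "second_pod X \<longleftrightarrow> X \<subseteq> rest \<and> linked adj X \<and> (\<Sum>v\<in>X. card (hub_nbrs v)) \<le> 3 \<and> 3 \<le> card {Y \<in> first_hubs. touch adj X Y}"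

definition second_family where
  "second_family F \<longleftrightarrow> (\<forall>X\<in>F. second_pod X) \<and> pairwise disjnt F \<and> (\<forall>X. second_pod X \<longrightarrow> X \<inter> \<Union>F \<noteq> {})"

lemma second_family_exists: "\<exists>F. second_family F"
proof -
  have "finite (Collect second_pod)"
    by (rule finite_subset[of _ "Pow S"]) (use finS in \<open>auto simp: second_pod_def rest_def\<close>)
  moreover have "{} \<notin> Collect second_pod" by (simp add: linked_def second_pod_def)
  ultimately obtain F where "F \<subseteq> Collect second_pod" "pairwise disjnt F" "\<And>X. X \<in> Collect second_pod \<Longrightarrow> X \<inter> \<Union>F \<noteq> {}"
    by (rule maximal_disjoint_subfamily) blast
  then have "second_family F"
    unfolding second_family_def by auto
  then show ?thesis by (rule exI)
qed

definition second_pods where "second_pods = (SOME F. second_family F)"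

lemma second_pods: "X \<in> second_pods \<Longrightarrow> second_pod X" "pairwise disjnt second_pods" "second_pod X \<Longrightarrow> X \<inter> \<Union>second_pods \<noteq> {}"
proof -
  have "second_family second_pods"
    unfolding second_pods_def by (rule someI_ex[OF second_family_exists])
  then show "X \<in> second_pods \<Longrightarrow> second_pod X" "pairwise disjnt second_pods" "second_pod X \<Longrightarrow> X \<inter> \<Union>second_pods \<noteq> {}"
    unfolding second_family_def by simp_all
qed

lemma finite_second_pods: "finite second_pods" "X \<in> second_pods \<Longrightarrow> finite X" "\<Union>second_pods \<subseteq> rest"
proof -
  have "second_pods \<subseteq> Pow rest" using second_pods(1) by (auto simp: second_pod_def)
  moreover have "finite rest" using finS by (simp add: rest_def)
  ultimately show "finite second_pods" "\<Union>second_pods \<subseteq> rest" "X \<in> second_pods \<Longrightarrow> finite X"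
    by (auto intro: finite_subset)
qed

lemma disjoint_parts: "rest \<inter> podded = {}" "rest \<inter> B = {}" "podded \<inter> B = {}" "rest \<subseteq> S - rich"
  using SB finite_first_pods(3) by (auto simp: rest_def podded_def first_pods_def)

lemma rest_cases: "v \<in> rest \<Longrightarrow> card (hub_nbrs v) = 1 \<or> card (hub_nbrs v) = 2"
  using hub_nbrs_cases disjoint_parts(4) by blast

definition second_hubs where "second_hubs = second_pods \<union> first_hubs"

lemma second_hubs_disjoint: "pairwise disjnt second_hubs"
proof -
  have "pairwise disjnt first_hubs"
    using first_pods_hubs_disjoint by (simp add: first_hubs_def Un_commute)
  moreover have "\<Union>second_pods \<inter> \<Union>first_hubs = {}"
    using finite_second_pods(3) first_hubs(3) disjoint_parts by blast
  ultimately show ?thesis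
    unfolding second_hubs_def by (rule pairwise_disjnt_Un[OF second_pods(2)])
qed

lemma second_hubs_linked:
  assumes "X \<in> second_hubs" 
  shows "linked adj X \<and> X \<subseteq> S \<union> B"
  using assms unfolding second_hubs_def first_hubs_def
proof
  assume "X \<in> second_pods"
  then show ?thesis using second_pods(1)[of X] by (auto simp: second_pod_def rest_def)
next
  assume "X \<in> hub_sets \<union> first_pods"
  then show ?thesis using first_pods_hubs_linked[of X] by auto
qed

lemma second_pods_bound: "card second_pods + 6 \<le> 6 * card B"
proof -
  have "\<Union>second_pods \<inter> \<Union>first_hubs = {}"
    using finite_second_pods(3) first_hubs(3) disjoint_parts by blast
  moreover have "hub_sets \<subseteq> first_hubs" by (simp add: first_hubs_def)
  moreover have "3 \<le> card {Y \<in> first_hubs. touch adj X Y}" if "X \<in> second_pods" for X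
    using second_pods(1)[OF that] by (simp add: second_pod_def)
  ultimately have "card second_pods + 2 \<le> 2 * card first_hubs"
    using pod_bound(2)[OF _ first_hubs(1) second_hubs_disjoint[unfolded second_hubs_def] finite_second_pods(1) _ second_hubs_linked[unfolded second_hubs_def]] by simp
  then show ?thesis
    using first_hubs(2) by simp
qed

lemma second_pods_degrees: "(\<Sum>v\<in>\<Union>second_pods. card (hub_nbrs v)) + 18 \<le> 18 * card B"
proof -
  have "(\<Sum>v\<in>\<Union>second_pods. card (hub_nbrs v)) = (\<Sum>X\<in>second_pods. \<Sum>v\<in>X. card (hub_nbrs v))"
    using second_pods(2) finite_second_pods(2)
    by (subst sum.Union_disjoint) (auto simp: pairwise_def disjnt_def)
  also have "\<dots> \<le> (\<Sum>X\<in>second_pods. 3)"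
    by (rule sum_mono) (use second_pods(1) in \<open>auto simp: second_pod_def\<close>)
  finally show ?thesis
    using second_pods_bound by simp
qed

lemma singles_bound:
  assumes W: "hub_sets \<subseteq> W" "finite W" "pairwise disjnt W" "\<And>X. X \<in> W \<Longrightarrow> linked adj X \<and> X \<subseteq> S \<union> B"
    and A: "A \<subseteq> S" "A \<inter> \<Union>W = {}" "\<And>v. v \<in> A \<Longrightarrow> 3 \<le> card {Y \<in> W. touch adj {v} Y}"
  shows "card A + 2 \<le> 2 * card W"
proof -
  let ?J = "(\<lambda>v. {v}) ` A"
  have "pairwise disjnt (?J \<union> W)"
    by (rule pairwise_disjnt_Un[OF pairwise_disjnt_singletons W(3)]) (use A(2) in simp)
  moreover have "finite ?J"
    using finite_subset[OF A(1) finS] by simp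
  moreover have "\<Union>?J \<inter> \<Union>W = {}"
    using A(2) by simp
  moreover have "linked adj X \<and> X \<subseteq> S \<union> B" if "X \<in> ?J \<union> W" for X
    using that
  proof
    assume "X \<in> ?J"
    then show ?thesis using A(1) by (auto simp: linked_singleton)
  qed (rule W(4))
  moreover have "3 \<le> card {Y \<in> W. touch adj X Y}" if "X \<in> ?J" for X
    using that A(3) by auto
  ultimately have "card ?J + 2 \<le> 2 * card W"
    using pod_bound(2)[OF W(1,2)] by blast
  then show ?thesis
    by (simp add: card_image)
qed

text \<open>Vertices with one big neighbor whose two witnesses \<open>a\<close> and \<open>a'\<close> are both contained in pods. The witnesses may lie in the
same pod, so these vertices are counted against uncontracted pods.\<close>

definition doubly_attached where "doubly_attached = {v \<in> rest. card (hub_nbrs v) = 1 \<and> 3 \<le> card {u \<in> B \<union> podded. adj v u}}"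

lemma doubly_attached_bound: "card doubly_attached + 14 \<le> 14 * card B"
proof -
  let ?W = "(\<lambda>u. {u}) ` (B \<union> podded)"
  have fin: "finite (B \<union> podded)" using finB finite_first_pods by simp
  have "card doubly_attached + 2 \<le> 2 * card ?W"
  proof (rule singles_bound)
    show "hub_sets \<subseteq> ?W" by (auto simp: hub_sets_def)
    show "finite ?W" using fin by simp
    show "pairwise disjnt ?W" by (rule pairwise_disjnt_singletons)
    show "linked adj X \<and> X \<subseteq> S \<union> B" if "X \<in> ?W" for X
      using that finite_first_pods(3) by (auto simp: linked_singleton)
    show "doubly_attached \<subseteq> S" by (auto simp: doubly_attached_def rest_def)
    show "doubly_attached \<inter> \<Union>?W = {}"
      using disjoint_parts by (auto simp: doubly_attached_def)
    show "3 \<le> card {Y \<in> ?W. touch adj {v} Y}" if "v \<in> doubly_attached" for v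
    proof -
      have "{Y \<in> ?W. touch adj {v} Y} = (\<lambda>u. {u}) ` {u \<in> B \<union> podded. adj v u}"
        by (auto simp: touch_def)
      then have "card {Y \<in> ?W. touch adj {v} Y} = card {u \<in> B \<union> podded. adj v u}"
        by (simp add: card_image)
      then show ?thesis
        using that by (simp add: doubly_attached_def)
    qed
  qed
  moreover have "card ?W = card B + card podded"
    using disjoint_parts(3) finB finite_first_pods(4) by (simp add: card_image card_Un_disjoint Int_commute)
  ultimately show ?thesis
    using podded_card by simp
qed

text \<open>The witnesses \<open>a\<close>, \<open>a'\<close> of a remaining vertex \<open>v\<close> cannot both remain, since \<open>v\<close>, \<open>a\<close>, \<open>a'\<close> together would be a pod.\<close>

lemma near_pod:
  assumes v: "v \<in> rest" "card (hub_nbrs v) = 1"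
  obtains a a' y' where "a \<in> podded" "a' \<in> S" "a \<noteq> a'" "adj v a" "adj v a'" "y' \<in> hub_nbrs a'" "y' \<notin> hub_nbrs v"
proof -
  have vS: "v \<in> S" using v by (simp add: rest_def)
  obtain a a' y y' where a: "a \<in> S" "a' \<in> S" "y \<in> hub_nbrs a" "y' \<in> hub_nbrs a'" "adj v a" "adj v a'" "a \<noteq> a'"
    "y \<noteq> y'" "y \<notin> hub_nbrs v" "y' \<notin> hub_nbrs v"
    using one[OF vS v(2)] by blast
  show ?thesis
  proof (cases "a \<in> podded \<or> a' \<in> podded")
    case True
    then show ?thesis
      using a that by metis
  next
    case False
    then have sub: "{v, a, a'} \<subseteq> rest"
      using a v by (auto simp: rest_def)
    obtain x where x: "hub_nbrs v = {x}"
      using v(2) by (auto simp: card_1_singleton_iff)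
    have "linked adj {v, a, a'}"
      by (rule linked_star[where r = v]) (use sym a in auto)
    moreover have "card {v, a, a'} \<le> 3"
      by (simp add: card_insert_if)
    ultimately have "card (\<Union>u\<in>{v, a, a'}. hub_nbrs u) < 3"
      using small_pods_maximal[OF sub] by blast
    moreover have "3 \<le> card (\<Union>u\<in>{v, a, a'}. hub_nbrs u)"
      by (rule three_le_card[of _ x y y']) (use a x finite_hub_nbrs in auto)
    ultimately show ?thesis by simp
  qed
qed

definition remainder where "remainder = rest - \<Union>second_pods - doubly_attached"

text \<open>A vertex \<open>v\<close> of the remainder is adjacent to a second-round pod, because otherwise \<open>v\<close>, alone or
together with a suitable neighbor, could be added to that maximal family. If \<open>v\<close> has two big neighbors, these are two
further hubs. If it has one, the other two hubs are this neighbor and the pod of its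
witness.\<close>

lemma remainder_touches:
  assumes v: "v \<in> remainder"
  shows "3 \<le> card {Y \<in> second_hubs. touch adj {v} Y}"
proof -
  have vR: "v \<in> rest" "v \<notin> \<Union>second_pods" "v \<notin> doubly_attached" using v by (auto simp: remainder_def)
  have finite_second_hubs: "finite second_hubs" using finite_second_pods first_hubs by (simp add: second_hubs_def)
  have hubI: "{x} \<in> first_hubs" "touch adj X {x}" if "x \<in> hub_nbrs u" "u \<in> X" for x u X
    using that by (auto simp: first_hubs_def hub_sets_def hub_nbrs_def touch_def)
  have distinctness: "{x} \<noteq> Y" "Y \<noteq> {x}" if "x \<in> B" "Y \<in> first_pods \<union> second_pods" for x Y
    using that first_pods(1) second_pods(1) SB unfolding second_pod_def rest_def by blast+
  have pods_differ: "X \<noteq> Y" if "X \<in> first_pods" "Y \<in> second_pods" for X Y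
  proof -
    have "X \<subseteq> podded" "Y \<subseteq> rest" "X \<noteq> {}"
      using that finite_second_pods(3) first_pods(2)[of X] by (auto simp: podded_def linked_def)
    then show ?thesis using disjoint_parts by blast
  qed
  have podI: "\<exists>X\<in>first_pods. a \<in> X" if "a \<in> podded" for a
    using that by (auto simp: podded_def)
  have in3: "3 \<le> card {Y \<in> second_hubs. touch adj X Y}"
    if "Y1 \<in> second_hubs" "Y2 \<in> second_hubs" "Y3 \<in> second_hubs" "touch adj X Y1" "touch adj X Y2" "touch adj X Y3"
      "Y1 \<noteq> Y2" "Y1 \<noteq> Y3" "Y2 \<noteq> Y3" for X Y1 Y2 Y3
    by (rule three_le_card[of _ Y1 Y2 Y3]) (use that finite_second_hubs in auto)
  have in2: "3 \<le> card {Y \<in> first_hubs. touch adj X Y}"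
    if "Y1 \<in> first_hubs" "Y2 \<in> first_hubs" "Y3 \<in> first_hubs" "touch adj X Y1" "touch adj X Y2" "touch adj X Y3"
      "Y1 \<noteq> Y2" "Y1 \<noteq> Y3" "Y2 \<noteq> Y3" for X Y1 Y2 Y3
    by (rule three_le_card[of _ Y1 Y2 Y3]) (use that first_hubs(1) in auto)
  consider "card (hub_nbrs v) = 1" | "card (hub_nbrs v) = 2"
    using rest_cases[OF vR(1)] by blast
  then show ?thesis
  proof cases
    case 1
    then obtain x where x: "hub_nbrs v = {x}"
      by (auto simp: card_1_singleton_iff)
    then have xB: "x \<in> B" "adj v x" by (auto simp: hub_nbrs_def)
    obtain a a' y' where a: "a \<in> podded" "a' \<in> S" "a \<noteq> a'" "adj v a" "adj v a'" "y' \<in> hub_nbrs a'" "y' \<notin> hub_nbrs v"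
      using near_pod[OF vR(1) 1] by blast
    obtain X where X: "X \<in> first_pods" "a \<in> X" using podI a by blast
    have "a' \<notin> podded"
    proof
      assume "a' \<in> podded"
      then have "3 \<le> card {u \<in> B \<union> podded. adj v u}"
        by (intro three_le_card[of _ x a a']) (use a xB finB finite_first_pods disjoint_parts in auto)
      then show False using vR 1 by (simp add: doubly_attached_def)
    qed
    then have a'R: "a' \<in> rest" using a by (simp add: rest_def)
    have "second_pod {v, a'}"
      unfolding second_pod_def
    proof (intro conjI)
      show "{v, a'} \<subseteq> rest" using vR a'R by simp
      show "linked adj {v, a'}" by (rule linked_pair) (use sym a in auto)
      have "card (hub_nbrs a') \<le> 2"
        using rest_cases[OF a'R] by auto
      then show "(\<Sum>v\<in>{v, a'}. card (hub_nbrs v)) \<le> 3"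
        using 1 by (auto simp: sum.insert_if)
      show "3 \<le> card {Y \<in> first_hubs. touch adj {v, a'} Y}"
      proof (rule in2[of "{x}" "{y'}" X])
        show "{x} \<in> first_hubs" "touch adj {v, a'} {x}" "{y'} \<in> first_hubs" "touch adj {v, a'} {y'}"
          using hubI[of x v "{v, a'}"] hubI[of y' a' "{v, a'}"] x a by simp_all
        show "X \<in> first_hubs" using X by (simp add: first_hubs_def)
        show "touch adj {v, a'} X" using X a by (auto simp: touch_def)
        show "{x} \<noteq> {y'}" using x a by auto
        show "{x} \<noteq> X" "{y'} \<noteq> X"
          using distinctness(1)[of x X] distinctness(1)[of y' X] X xB a by (simp_all add: hub_nbrs_def)
      qed
    qed
    then obtain Y where Y: "Y \<in> second_pods" "a' \<in> Y"
      using second_pods(3) vR(2) by blast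
    show ?thesis
    proof (rule in3[of "{x}" X Y])
      show "{x} \<in> second_hubs" "touch adj {v} {x}"
        using hubI[of x v "{v}"] x by (simp_all add: second_hubs_def)
      show "X \<in> second_hubs" "Y \<in> second_hubs" using X Y by (auto simp: second_hubs_def first_hubs_def)
      show "touch adj {v} X" "touch adj {v} Y" using X Y a by (auto simp: touch_def)
      show "{x} \<noteq> X" "{x} \<noteq> Y" "X \<noteq> Y"
        using distinctness(1)[of x X] distinctness(1)[of x Y] pods_differ[of X Y] X Y xB by simp_all
    qed
  next
    case 2
    then obtain x y where xy: "hub_nbrs v = {x, y}" "x \<noteq> y"
      by (auto simp: card_2_iff)
    then have B: "x \<in> B" "y \<in> B" by (auto simp: hub_nbrs_def)
    have vS: "v \<in> S" using vR by (simp add: rest_def)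
    obtain z where z: "z \<in> S" "adj v z" "hub_nbrs z \<noteq> hub_nbrs v"
      using two[OF vS 2] by blast
    have "z \<notin> podded"
    proof
      assume "z \<in> podded"
      then obtain X where X: "X \<in> first_pods" "z \<in> X" using podI by blast
      have "second_pod {v}"
        unfolding second_pod_def
      proof (intro conjI)
        show "3 \<le> card {Y \<in> first_hubs. touch adj {v} Y}"
        proof (rule in2[of "{x}" "{y}" X])
          show "{x} \<in> first_hubs" "touch adj {v} {x}" "{y} \<in> first_hubs" "touch adj {v} {y}"
            using hubI[of x v "{v}"] hubI[of y v "{v}"] xy by simp_all
          show "X \<in> first_hubs" using X by (simp add: first_hubs_def)
          show "touch adj {v} X" using X z by (auto simp: touch_def)
          show "{x} \<noteq> {y}" using xy by auto
          show "{x} \<noteq> X" "{y} \<noteq> X"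
            using distinctness(1)[of x X] distinctness(1)[of y X] X B by simp_all
        qed
      qed (use vR 2 in \<open>auto simp: linked_singleton\<close>)
      then show False using second_pods(3) vR(2) by blast
    qed
    then have zR: "z \<in> rest" using z by (simp add: rest_def)
    have lin: "linked adj {v, z}" by (rule linked_pair) (use sym z in auto)
    have "card (\<Union>u\<in>{v, z}. hub_nbrs u) < 3"
      by (rule small_pods_maximal[OF _ lin]) (use zR vR in \<open>auto simp: card_insert_if\<close>)
    then have "card (hub_nbrs v \<union> hub_nbrs z) \<le> 2" by simp
    then have "hub_nbrs v = hub_nbrs v \<union> hub_nbrs z"
      using 2 finite_hub_nbrs by (intro card_seteq) auto
    then have "hub_nbrs z \<subset> hub_nbrs v" using z(3) by blast
    then have "card (hub_nbrs z) < 2"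
      using 2 finite_hub_nbrs psubset_card_mono by metis
    then have z1: "card (hub_nbrs z) = 1"
      using rest_cases[OF zR] by auto
    obtain a where a: "a \<in> podded" "adj z a" 
      using near_pod[OF zR z1] by blast
    obtain X where X: "X \<in> first_pods" "a \<in> X" using podI a by blast
    have "second_pod {v, z}"
      unfolding second_pod_def
    proof (intro conjI)
      show "{v, z} \<subseteq> rest" using vR zR by simp
      show "(\<Sum>v\<in>{v, z}. card (hub_nbrs v)) \<le> 3"
        using z1 2 by (auto simp: sum.insert_if)
      show "3 \<le> card {Y \<in> first_hubs. touch adj {v, z} Y}"
      proof (rule in2[of "{x}" "{y}" X])
        show "{x} \<in> first_hubs" "touch adj {v, z} {x}" "{y} \<in> first_hubs" "touch adj {v, z} {y}"
          using hubI[of x v "{v, z}"] hubI[of y v "{v, z}"] xy by simp_all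
        show "X \<in> first_hubs" using X by (simp add: first_hubs_def)
        show "touch adj {v, z} X" using X a by (auto simp: touch_def)
        show "{x} \<noteq> {y}" using xy by auto
        show "{x} \<noteq> X" "{y} \<noteq> X"
            using distinctness(1)[of x X] distinctness(1)[of y X] X B by simp_all
      qed
    qed (rule lin)
    then obtain Y where Y: "Y \<in> second_pods" "z \<in> Y"
      using second_pods(3) vR(2) by blast
    show ?thesis
    proof (rule in3[of "{x}" "{y}" Y])
      show "{x} \<in> second_hubs" "touch adj {v} {x}" "{y} \<in> second_hubs" "touch adj {v} {y}"
        using hubI[of x v "{v}"] hubI[of y v "{v}"] xy by (simp_all add: second_hubs_def)
      show "Y \<in> second_hubs" using Y by (auto simp: second_hubs_def)
      show "touch adj {v} Y" using Y z by (auto simp: touch_def)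
      show "{x} \<noteq> {y}" using xy by auto
      show "{x} \<noteq> Y" "{y} \<noteq> Y"
        using distinctness(1)[of x Y] distinctness(1)[of y Y] Y B by simp_all
    qed
  qed
qed

lemma remainder_bound: "card remainder + 18 \<le> 18 * card B"
proof -
  have "card remainder + 2 \<le> 2 * card second_hubs"
  proof (rule singles_bound)
    show "hub_sets \<subseteq> second_hubs" by (auto simp: second_hubs_def first_hubs_def)
    show "finite second_hubs" using finite_second_pods first_hubs by (simp add: second_hubs_def)
    show "remainder \<subseteq> S" by (auto simp: remainder_def rest_def)
    have "\<Union>second_hubs = \<Union>second_pods \<union> (B \<union> podded)" using first_hubs(3) by (simp add: second_hubs_def)
    then show "remainder \<inter> \<Union>second_hubs = {}"
      using disjoint_parts by (auto simp: remainder_def)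
  qed (use second_hubs_disjoint second_hubs_linked remainder_touches in auto)
  moreover have "card second_hubs \<le> card second_pods + card first_hubs"
    unfolding second_hubs_def by (rule card_Un_le)
  ultimately show ?thesis
    using second_pods_bound first_hubs(2) by simp
qed

text \<open>The contributions of the four kinds of small vertices add up: \<open>12\<close> for the vertices in pods, \<open>18\<close> for second-round pods, \<open>14\<close> for
doubly attached vertices and \<open>2 \<sqdot> 18\<close> for the remainder.\<close>

lemma S_degrees: "(\<Sum>v\<in>S. card (hub_nbrs v)) + 80 \<le> 80 * card B"
proof -
  have fin: "finite podded" "finite rest" "finite remainder" "finite doubly_attached" "finite (\<Union>second_pods)"
    using finite_first_pods finS finite_subset[OF finite_second_pods(3)] by (auto simp: rest_def remainder_def doubly_attached_def)
  have low: "card (hub_nbrs v) \<le> 2" if "v \<in> rest" for v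
    using rest_cases[OF that] by auto
  have tot: "(\<Sum>v\<in>S. card (hub_nbrs v)) = (\<Sum>v\<in>podded. card (hub_nbrs v)) + (\<Sum>v\<in>rest. card (hub_nbrs v))"
    unfolding rest_def using sum.subset_diff[OF finite_first_pods(3) finS, of "\<lambda>v. card (hub_nbrs v)"] by simp
  have "(\<Sum>v\<in>rest. card (hub_nbrs v)) \<le> (\<Sum>v\<in>\<Union>second_pods \<union> (doubly_attached \<union> remainder). card (hub_nbrs v))"
    by (rule sum_mono2) (use fin in \<open>auto simp: remainder_def\<close>)
  also have "\<dots> \<le> (\<Sum>v\<in>\<Union>second_pods. card (hub_nbrs v)) + (\<Sum>v\<in>doubly_attached \<union> remainder. card (hub_nbrs v))"
    using sum_Un_nat[of "\<Union>second_pods" "doubly_attached \<union> remainder" "\<lambda>v. card (hub_nbrs v)"] fin by simp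
  finally have 1: "(\<Sum>v\<in>rest. card (hub_nbrs v)) \<le> (\<Sum>v\<in>\<Union>second_pods. card (hub_nbrs v)) + (\<Sum>v\<in>doubly_attached \<union> remainder. card (hub_nbrs v))" .
  have 2: "(\<Sum>v\<in>doubly_attached \<union> remainder. card (hub_nbrs v)) \<le> (\<Sum>v\<in>doubly_attached. card (hub_nbrs v)) + (\<Sum>v\<in>remainder. card (hub_nbrs v))"
    using sum_Un_nat[of doubly_attached remainder "\<lambda>v. card (hub_nbrs v)"] fin by simp
  have 3: "(\<Sum>v\<in>doubly_attached. card (hub_nbrs v)) = card doubly_attached"
    by (simp add: doubly_attached_def)
  have "(\<Sum>v\<in>remainder. card (hub_nbrs v)) \<le> (\<Sum>v\<in>remainder. 2)"
    by (rule sum_mono) (use low in \<open>auto simp: remainder_def\<close>)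
  then have 4: "(\<Sum>v\<in>remainder. card (hub_nbrs v)) \<le> 2 * card remainder" by simp
  show ?thesis
    using tot 1 2 3 4 podded_degrees second_pods_degrees doubly_attached_bound remainder_bound by linarith
qed

text \<open>The edges inside \<open>B\<close> contribute at most \<open>8\<close> per big vertex, those to small vertices at most \<open>80\<close>.\<close>

theorem big_degrees: "(\<Sum>x\<in>B. card {v \<in> S \<union> B. adj x v}) < 88 * card B"
proof -
  have KB: "K33_free B adj"
    by (rule K33_free_subgraph[OF K]) auto
  have "card {v \<in> S \<union> B. adj x v} = card {v \<in> S. adj x v} + card {v \<in> B. adj x v}" for x
  proof -
    have "{v \<in> S \<union> B. adj x v} = {v \<in> S. adj x v} \<union> {v \<in> B. adj x v}" by auto
    then show ?thesis
      using finS finB SB by (simp add: card_Un_disjoint disjoint_iff)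
  qed
  then have "(\<Sum>x\<in>B. card {v \<in> S \<union> B. adj x v}) =
      (\<Sum>x\<in>B. card {v \<in> S. adj x v}) + (\<Sum>x\<in>B. card {v \<in> B. adj x v})"
    by (simp add: sum.distrib)
  moreover have "(\<Sum>x\<in>B. card {v \<in> S. adj x v}) = (\<Sum>v\<in>S. card (hub_nbrs v))"
  proof (rule sum_multicount_gen[OF finB finS], rule ballI)
    fix v
    have "{x \<in> B. adj x v} = hub_nbrs v" using sym by (auto simp: hub_nbrs_def)
    then show "card {x \<in> B. adj x v} = card (hub_nbrs v)" by simp
  qed
  moreover have "0 < card B" using finB Bne by (simp add: card_gt_0_iff)
  ultimately show ?thesis
    using S_degrees adjacent_pairs_bound[OF KB sym irr finB Bne] by simp
qed

end

section \<open>Conflicts between edges and greedy coloring\<close>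

text \<open>The centers \<open>p\<close> and \<open>q\<close> are joined to \<open>A\<close> and \<open>C\<close> and to each other. Together with them the edges between \<open>A\<close> and \<open>C\<close>
form a bipartite graph, so half of the bound \<open>2n - 4\<close> is used up by the stars.\<close>

lemma double_star_bound:
  fixes A C :: "'v set"
  assumes K: "K33_free V adj" and sym: "\<And>u v. adj u v \<Longrightarrow> adj v u"
    and fin: "finite A" "finite C" and sub: "A \<subseteq> V" "C \<subseteq> V" "p \<in> V" "q \<in> V"
    and dis: "A \<inter> C = {}" "p \<notin> A \<union> C" "q \<notin> A \<union> C" "p \<noteq> q"
    and star: "adj p q" "\<And>x. x \<in> A \<Longrightarrow> adj p x" "\<And>y. y \<in> C \<Longrightarrow> adj q y"
    and ne: "A \<union> C \<noteq> {}"
  shows "card {(x, y). x \<in> A \<and> y \<in> C \<and> adj x y} + 1 \<le> card A + card C"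
proof -
  define E where "E = {(x, y). x \<in> A \<and> y \<in> C \<and> adj x y}"
  \<comment> \<open>Each center lies on the side opposite to its leaves.\<close>
  define R where "R = E \<union> (A \<times> {p} \<union> ({q} \<times> C \<union> {(q, p)}))"
  have finE: "finite E"
    by (rule finite_subset[of _ "A \<times> C"]) (use fin in \<open>auto simp: E_def\<close>)
  have "K33_free (insert q A \<union> insert p C) (relation_adj R)"
    by (rule K33_free_subgraph[OF K])
       (use sub star sym in \<open>auto simp: relation_adj_def R_def E_def\<close>)
  moreover have "insert q A \<inter> insert p C = {}" "R \<subseteq> insert q A \<times> insert p C"
    using dis by (auto simp: R_def E_def)
  moreover have "card (insert q A) = card A + 1" "card (insert p C) = card C + 1"
    using fin dis by simp_all
  moreover have "3 \<le> card A + 1 + (card C + 1)"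
    using ne fin by (cases "A = {}") (simp_all add: card_gt_0_iff Suc_le_eq)
  ultimately have "card R + 4 \<le> 2 * (card A + 1 + (card C + 1))"
    using bipartite_K33_free_bound[of "insert q A" "insert p C" R] fin by (simp only: finite_insert)
  moreover have "card R = card E + (card A + (card C + 1))"
  proof -
    have "card ({q} \<times> C \<union> {(q, p)}) = card C + 1"
      using fin dis by (simp add: card_cartesian_product)
    moreover have "card (A \<times> {p} \<union> ({q} \<times> C \<union> {(q, p)})) = card (A \<times> {p}) + card ({q} \<times> C \<union> {(q, p)})"
      by (rule card_Un_disjoint) (use fin dis in auto)
    moreover have "card R = card E + card (A \<times> {p} \<union> ({q} \<times> C \<union> {(q, p)}))"
      unfolding R_def by (rule card_Un_disjoint) (use fin finE dis in \<open>auto simp: E_def\<close>)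
    ultimately show ?thesis
      by (simp add: card_cartesian_product)
  qed
  ultimately show ?thesis
    by (simp add: E_def)
qed

text \<open>A vertex of \<open>T\<close> with three neighbors in \<open>T\<close> would form a \<open>K\<^sub>3\<^sub>,\<^sub>3\<close> with \<open>a\<close> and \<open>b\<close>, so the graph induced by \<open>T\<close> has
maximum degree at most two.\<close>

lemma common_neighbourhood_edges:
  fixes T :: "'v set"
  assumes K: "K33_free V adj" and sym: "\<And>u v. adj u v \<Longrightarrow> adj v u" and irr: "\<And>u. \<not> adj u u"
    and T: "finite T" "T \<subseteq> V" and ab: "a \<in> V" "b \<in> V" "a \<notin> T" "b \<notin> T" "a \<noteq> b"
    and star: "\<And>x. x \<in> T \<Longrightarrow> adj a x" "\<And>x. x \<in> T \<Longrightarrow> adj b x"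
  shows "card {{x, y} |x y. x \<in> T \<and> y \<in> T \<and> adj x y} \<le> card T"
proof -
  let ?E = "{{x, y} |x y. x \<in> T \<and> y \<in> T \<and> adj x y}"
  have finE: "finite ?E"
    by (rule finite_subset[of _ "Pow T"]) (use T in auto)
  have deg: "card {y \<in> T. adj x y} \<le> 2" if x: "x \<in> T" for x
  proof (rule ccontr)
    assume "\<not> ?thesis"
    then have "3 \<le> card {y \<in> T. adj x y}" by simp
    then obtain N where "N \<subseteq> {y \<in> T. adj x y}" "card N = 3"
      by (meson obtain_subset_with_card_n)
    then obtain u v w where uvw: "u \<in> T" "v \<in> T" "w \<in> T" "adj x u" "adj x v" "adj x w" "u \<noteq> v" "u \<noteq> w" "v \<noteq> w"
      by (auto simp: card_3_iff)
    have "x \<noteq> u" "x \<noteq> v" "x \<noteq> w" "x \<noteq> a" "x \<noteq> b"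
      using uvw irr x ab by auto
    then show False
      using K33_freeD[OF K, of "{a}" "{b}" "{x}" "{u}" "{v}" "{w}"] uvw x T ab star
      by (auto simp: linked_singleton touch_def)
  qed
  have "2 * card ?E = (\<Sum>e\<in>?E. 2)" by simp
  also have "\<dots> = (\<Sum>x\<in>T. card {e \<in> ?E. x \<in> e})"
  proof (rule sum_multicount_gen[symmetric, OF T(1) finE], rule ballI)
    fix e assume "e \<in> ?E"
    then obtain x y where "e = {x, y}" "x \<in> T" "y \<in> T" "adj x y" by blast
    moreover from this have "x \<noteq> y" using irr by auto
    moreover have "{i \<in> T. i \<in> {x, y}} = {x, y}" if "x \<in> T" "y \<in> T"
      using that by auto
    ultimately show "card {i \<in> T. i \<in> e} = 2" by simp
  qed
  also have "\<dots> \<le> (\<Sum>x\<in>T. 2)"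
  proof (rule sum_mono)
    fix x assume x: "x \<in> T"
    have "{e \<in> ?E. x \<in> e} \<subseteq> (\<lambda>y. {x, y}) ` {y \<in> T. adj x y}"
      using sym by (auto simp: insert_commute)
    then have "card {e \<in> ?E. x \<in> e} \<le> card ((\<lambda>y. {x, y}) ` {y \<in> T. adj x y})"
      by (rule card_mono[rotated]) (use T in simp)
    also have "\<dots> \<le> card {y \<in> T. adj x y}"
      by (rule card_image_le) (use T in simp)
    finally show "card {e \<in> ?E. x \<in> e} \<le> 2"
      using deg[OF x] by simp
  qed
  finally show ?thesis by simp
qed

text \<open>With \<open>T = X \<inter> Y\<close> the edges split into those between \<open>X - T\<close> and \<open>Y\<close>, those between \<open>Y - T\<close> and \<open>T\<close>, and
those inside \<open>T\<close>. The first two kinds lie between double stars with centers \<open>a\<close> and \<open>b\<close>.\<close>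

lemma opposite_edges_bound:
  fixes X Y :: "'v set"
  assumes K: "K33_free V adj" and sym: "\<And>u v. adj u v \<Longrightarrow> adj v u" and irr: "\<And>u. \<not> adj u u"
    and fin: "finite X" "finite Y" and sub: "X \<subseteq> V" "Y \<subseteq> V" "a \<in> V" "b \<in> V"
    and dis: "a \<notin> X \<union> Y" "b \<notin> X \<union> Y" "a \<noteq> b"
    and star: "adj a b" "\<And>x. x \<in> X \<Longrightarrow> adj a x" "\<And>y. y \<in> Y \<Longrightarrow> adj b y"
  shows "card {{x, y} |x y. x \<in> X \<and> y \<in> Y \<and> adj x y} \<le> card X + 2 * card Y - 2"
proof (cases "Y = {}")
  case True
  then show ?thesis by simp
next
  case False
  define T where "T = X \<inter> Y"
  define f where "f = (\<lambda>(x, y). {x :: 'v, y})"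
  let ?e = "\<lambda>A C. {(x, y). x \<in> A \<and> y \<in> C \<and> adj x y}"
  let ?O = "{{x, y} |x y. x \<in> X \<and> y \<in> Y \<and> adj x y}"
  let ?ET = "{{x, y} |x y. x \<in> T \<and> y \<in> T \<and> adj x y}"
  have fe: "finite (?e A C)" if "finite A" "finite C" for A C
    by (rule finite_subset[of _ "A \<times> C"]) (use that in auto)
  have ba: "adj b a" using sym star(1) by blast
  have 1: "card (?e (X - T) Y) + 1 \<le> card (X - T) + card Y"
    by (rule double_star_bound[OF K, where p = a and q = b])
       (use fin sub dis star False sym in \<open>auto simp: T_def\<close>)
  have 2: "card (?e (Y - T) T) + 1 \<le> card (Y - T) + card T"
    by (rule double_star_bound[OF K, where p = b and q = a])
       (use fin sub dis star ba False sym in \<open>auto simp: T_def\<close>)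
  have 3: "card ?ET \<le> card T"
    by (rule common_neighbourhood_edges[OF K, where a = a and b = b])
       (use fin sub dis star irr sym in \<open>auto simp: T_def\<close>)
  have c: "card (X - T) + card T = card X" "card (Y - T) + card T = card Y"
    using fin card_Diff_subset[of T X] card_Diff_subset[of T Y] card_mono[of X T] card_mono[of Y T]
    by (simp_all add: T_def)
  have finET: "finite ?ET"
    by (rule finite_subset[of _ "Pow T"]) (use fin in \<open>auto simp: T_def\<close>)
  have "?O \<subseteq> f ` ?e (X - T) Y \<union> (f ` ?e (Y - T) T \<union> ?ET)"
  proof
    fix e assume "e \<in> ?O"
    then obtain x y where e: "e = {x, y}" "x \<in> X" "y \<in> Y" "adj x y" by blast
    consider "x \<notin> T" | "x \<in> T" "y \<notin> T" | "x \<in> T" "y \<in> T" by blast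
    then show "e \<in> f ` ?e (X - T) Y \<union> (f ` ?e (Y - T) T \<union> ?ET)"
    proof cases
      case 1
      then have "(x, y) \<in> ?e (X - T) Y" "e = f (x, y)" using e by (auto simp: f_def)
      then show ?thesis by blast
    next
      case 2
      then have "(y, x) \<in> ?e (Y - T) T" "e = f (y, x)" using e sym by (auto simp: f_def)
      then show ?thesis by blast
    next
      case 3
      then show ?thesis using e by blast
    qed
  qed
  then have "card ?O \<le> card (f ` ?e (X - T) Y \<union> (f ` ?e (Y - T) T \<union> ?ET))"
    by (rule card_mono[rotated]) (intro finite_UnI finite_imageI fe finET; use fin in \<open>simp add: T_def\<close>)
  also have "\<dots> \<le> card (f ` ?e (X - T) Y) + card (f ` ?e (Y - T) T \<union> ?ET)"
    by (rule card_Un_le)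
  finally have 4: "card ?O \<le> card (f ` ?e (X - T) Y) + card (f ` ?e (Y - T) T \<union> ?ET)" .
  have 5: "card (f ` ?e (Y - T) T \<union> ?ET) \<le> card (f ` ?e (Y - T) T) + card ?ET"
    by (rule card_Un_le)
  have 6: "card (f ` ?e (X - T) Y) \<le> card (?e (X - T) Y)"
    by (rule card_image_le) (rule fe; use fin in simp)
  have 7: "card (f ` ?e (Y - T) T) \<le> card (?e (Y - T) T)"
    by (rule card_image_le) (rule fe; use fin in \<open>simp add: T_def\<close>)
  show ?thesis
    using 1 2 3 4 5 6 7 c by linarith
qed

text \<open>For disjoint edges the second disjunct says that they are opposite in a 4-cycle.\<close>

definition conflict :: "'a set set \<Rightarrow> 'a set \<Rightarrow> 'a set \<Rightarrow> bool" where
  "conflict E e f \<longleftrightarrow> e \<noteq> f \<and> (e \<inter> f \<noteq> {} \<or>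
     (\<exists>a b c d. e = {a, b} \<and> f = {c, d} \<and> {b, c} \<in> E \<and> {d, a} \<in> E))"

lemma conflict_sym: "conflict E e f \<Longrightarrow> conflict E f e"
  unfolding conflict_def by (metis Int_commute)

lemma conflict_cases:
  assumes "conflict E {a, b} f"
  obtains "f \<noteq> {a, b}" "a \<in> f" | "f \<noteq> {a, b}" "b \<in> f"
  | c d where "f = {c, d}" "{b, c} \<in> E" "{a, d} \<in> E" "f \<inter> {a, b} = {}"
proof -
  have ne: "f \<noteq> {a, b}" and "{a, b} \<inter> f \<noteq> {} \<or> (\<exists>p q c d. {a, b} = {p, q} \<and> f = {c, d} \<and> {q, c} \<in> E \<and> {d, p} \<in> E)"
    using assms unfolding conflict_def by blast+
  then consider "a \<in> f" | "b \<in> f" | p q c d where "{a, b} = {p, q}" "f = {c, d}" "{q, c} \<in> E" "{d, p} \<in> E" "f \<inter> {a, b} = {}"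
    by blast
  then show ?thesis
  proof cases
    case 3
    from 3(1) consider "p = a" "q = b" | "p = b" "q = a" by (auto simp: doubleton_eq_iff)
    then show ?thesis
    proof cases
      case 1
      then have "{b, c} \<in> E" "{a, d} \<in> E"
        using 3(3,4) by (simp_all add: insert_commute[of d])
      then show ?thesis by (rule that(3)[OF 3(2) _ _ 3(5)])
    next
      case 2
      then have "{b, d} \<in> E" "{a, c} \<in> E" "f = {d, c}"
        using 3(2,3,4) by (auto simp: insert_commute)
      then show ?thesis using that(3)[of d c] 3(5) by blast
    qed
  next
    case 1
    then show ?thesis using that(1) ne by blast
  next
    case 2
    then show ?thesis using that(2) ne by blast
  qed
qed

definition conflict_free :: "'a set set \<Rightarrow> 'a set set \<Rightarrow> ('a set \<Rightarrow> nat) \<Rightarrow> bool" where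
  "conflict_free E F c \<longleftrightarrow> (\<forall>e\<in>F. \<forall>f\<in>F. conflict E e f \<longrightarrow> c e \<noteq> c f)"

text \<open>Edges with fewer than \<open>q\<close> conflicts inside \<open>D\<close> can be colored in any order.\<close>

lemma greedy_extension:
  assumes c: "conflict_free E F c" "c ` F \<subseteq> {..<q}" and fin: "finite D" "F \<union> G \<subseteq> D"
    and few: "\<And>e. e \<in> G \<Longrightarrow> card {f \<in> D. conflict E e f} < q"
  shows "\<exists>c'. conflict_free E (F \<union> G) c' \<and> c' ` (F \<union> G) \<subseteq> {..<q}"
proof -
  have "finite G" using fin finite_subset by blast
  then show ?thesis
    using fin(2) few
  proof (induction G rule: finite_induct)
    case empty
    then show ?case using c by auto
  next
    case (insert e G)
    then obtain c' where c': "conflict_free E (F \<union> G) c'" "c' ` (F \<union> G) \<subseteq> {..<q}"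
      by auto
    show ?case
    proof (cases "e \<in> F \<union> G")
      case True
      then have "F \<union> insert e G = F \<union> G" by auto
      then show ?thesis using c' by metis
    next
      case False
      let ?bad = "c' ` {f \<in> D. conflict E e f}"
      have "card ?bad \<le> card {f \<in> D. conflict E e f}"
        by (rule card_image_le) (use fin in simp)
      also have "\<dots> < q" using insert.prems by auto
      finally have lt: "card ?bad < q" .
      have finbad: "finite ?bad" using fin(1) by simp
      have "\<not> {..<q} \<subseteq> ?bad"
      proof
        assume "{..<q} \<subseteq> ?bad"
        from card_mono[OF finbad this] lt show False by simp
      qed
      then obtain k where k: "k < q" "k \<notin> ?bad" by auto
      have off: "c' f \<noteq> k" if "f \<in> F \<union> G" "conflict E e f" for f
      proof -
        have "f \<in> D" using that(1) insert.prems(1) by blast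
        then have "c' f \<in> ?bad" using that(2) by blast
        then show ?thesis using k(2) by metis
      qed
      have "conflict_free E (F \<union> insert e G) (c'(e := k))"
        unfolding conflict_free_def
      proof (intro ballI impI)
        fix f g assume fg: "f \<in> F \<union> insert e G" "g \<in> F \<union> insert e G" "conflict E f g"
        then have "f \<noteq> g" by (simp add: conflict_def)
        consider "f = e" "g \<in> F \<union> G" "g \<noteq> e" | "g = e" "f \<in> F \<union> G" "f \<noteq> e" | "f \<in> F \<union> G" "f \<noteq> e" "g \<in> F \<union> G" "g \<noteq> e"
          using fg \<open>f \<noteq> g\<close> by blast
        then show "(c'(e := k)) f \<noteq> (c'(e := k)) g"
        proof cases
          case 1
          then show ?thesis using off[of g] fg(3) by auto
        next
          case 2
          then show ?thesis using off[of f] conflict_sym[OF fg(3)] by auto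
        next
          case 3
          then show ?thesis using c'(1) fg(3) by (simp add: conflict_free_def)
        qed
      qed
      moreover have "(c'(e := k)) ` (F \<union> insert e G) \<subseteq> {..<q}"
        using c'(2) k(1) False by (auto simp: image_subset_iff)
      ultimately show ?thesis by blast
    qed
  qed
qed

lemma conflict_free_B_coloring:
  assumes "conflict_free E E c"
  shows "B_coloring E c"
  unfolding B_coloring_def
proof (intro conjI allI impI)
  have c: "c e \<noteq> c f" if "e \<in> E" "f \<in> E" "conflict E e f" for e f
    using assms that by (simp add: conflict_free_def)
  show "proper_edge_coloring E c"
    unfolding proper_edge_coloring_def using c by (simp add: conflict_def)
  fix w x y z assume "four_cycle E w x y z"
  then have d: "distinct [w, x, y, z]" and E: "{w, x} \<in> E" "{x, y} \<in> E" "{y, z} \<in> E" "{z, w} \<in> E"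
    by (auto simp: four_cycle_def)
  have "conflict E {w, x} {x, y}" "conflict E {x, y} {y, z}" "conflict E {y, z} {z, w}" "conflict E {w, x} {z, w}"
    using d by (auto simp: conflict_def doubleton_eq_iff)
  moreover have "conflict E {w, x} {y, z}" "conflict E {x, y} {z, w}"
    unfolding conflict_def using d E by (auto simp: doubleton_eq_iff)
  ultimately have "c {w, x} \<noteq> c {x, y}" "c {x, y} \<noteq> c {y, z}" "c {y, z} \<noteq> c {z, w}" "c {w, x} \<noteq> c {z, w}"
    "c {w, x} \<noteq> c {y, z}" "c {x, y} \<noteq> c {z, w}"
    using c E by blast+
  then show "distinct [c {w, x}, c {x, y}, c {y, z}, c {z, w}]"
    by simp
qed

lemma simple_graphD:
  assumes "simple_graph V E"
  shows "finite V" "finite E" "\<And>u v. {u, v} \<in> E \<Longrightarrow> u \<in> V \<and> v \<in> V \<and> u \<noteq> v" "neighborhood E u \<subseteq> V" "finite (neighborhood E u)"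
    "\<And>e. e \<in> E \<Longrightarrow> \<exists>u v. e = {u, v} \<and> u \<noteq> v"
proof -
  have VE: "finite V" "\<And>e. e \<in> E \<Longrightarrow> e \<subseteq> V \<and> card e = 2"
    using assms by (auto simp: simple_graph_def)
  show "finite V" by (rule VE)
  show "finite E"
    by (rule finite_subset[of _ "Pow V"]) (use VE in auto)
  show "\<And>u v. {u, v} \<in> E \<Longrightarrow> u \<in> V \<and> v \<in> V \<and> u \<noteq> v"
    using VE(2) by fastforce
  then show N: "neighborhood E u \<subseteq> V" by (auto simp: neighborhood_def)
  then show "finite (neighborhood E u)" using VE(1) finite_subset by blast
  show "\<And>e. e \<in> E \<Longrightarrow> \<exists>u v. e = {u, v} \<and> u \<noteq> v"
    using VE(2) by (metis card_2_iff)
qed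

lemma edges_at: 
  assumes G: "simple_graph V E" and ab: "{a, b} \<in> E"
  shows "card {f \<in> E. f \<noteq> {a, b} \<and> a \<in> f} \<le> degree E a - 1"
proof -
  note S = simple_graphD[OF G]
  have "{f \<in> E. f \<noteq> {a, b} \<and> a \<in> f} \<subseteq> (\<lambda>v. {a, v}) ` (neighborhood E a - {b})"
  proof
    fix f assume f: "f \<in> {f \<in> E. f \<noteq> {a, b} \<and> a \<in> f}"
    then obtain u v where uv: "f = {u, v}" using S(6) by blast
    with f have "\<exists>w. f = {a, w}" by (auto simp: insert_commute)
    then obtain w where "f = {a, w}" by blast
    then show "f \<in> (\<lambda>v. {a, v}) ` (neighborhood E a - {b})"
      using f by (auto simp: neighborhood_def)
  qed
  then have "card {f \<in> E. f \<noteq> {a, b} \<and> a \<in> f} \<le> card ((\<lambda>v. {a, v}) ` (neighborhood E a - {b}))"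
    by (rule card_mono[rotated]) (use S(5) in simp)
  also have "\<dots> \<le> card (neighborhood E a - {b})"
    by (rule card_image_le) (use S(5) in simp)
  also have "\<dots> = degree E a - 1"
    using ab S(5) by (simp add: degree_def neighborhood_def)
  finally show ?thesis .
qed

text \<open>There are at most \<open>86\<close> further edges at either end, and at most \<open>86 + 2 \<sqdot> 86 - 2\<close> opposite edges.\<close>

lemma light_edge_conflicts:
  fixes V :: "'a set"
  assumes G: "simple_graph V E" and K: "K33_free V (\<lambda>u v. {u, v} \<in> E)"
    and ab: "{a, b} \<in> E" and deg: "degree E a \<le> 87" "degree E b \<le> 87"
  shows "card {f \<in> E. conflict E {a, b} f} \<le> 428"
proof -
  note S = simple_graphD[OF G]
  define X where "X = neighborhood E a - {b}"
  define Y where "Y = neighborhood E b - {a}"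
  let ?O = "{{x, y} |x y. x \<in> X \<and> y \<in> Y \<and> {x, y} \<in> E}"
  have abV: "a \<in> V" "b \<in> V" "a \<noteq> b" using S(3)[OF ab] by auto
  have fin: "finite X" "finite Y" using S(5) by (simp_all add: X_def Y_def)
  have cX: "card X \<le> 86" "card Y \<le> 86"
    using deg ab S(5) by (simp_all add: X_def Y_def degree_def neighborhood_def insert_commute)
  have loop: "{v} \<notin> E" for v using S(3)[of v v] by auto
  have "card ?O \<le> card X + 2 * card Y - 2"
  proof (rule opposite_edges_bound[OF K, where a = a and b = b])
    show "X \<subseteq> V" "Y \<subseteq> V" using S(4) by (auto simp: X_def Y_def)
    show "a \<notin> X \<union> Y" "b \<notin> X \<union> Y" using loop by (auto simp: X_def Y_def neighborhood_def)
    show "{a, x} \<in> E" if "x \<in> X" for x using that by (simp add: X_def neighborhood_def)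
    show "{b, y} \<in> E" if "y \<in> Y" for y using that by (simp add: Y_def neighborhood_def)
  qed (use abV fin ab loop in \<open>auto simp: insert_commute\<close>)
  then have O: "card ?O \<le> 256" using cX by simp
  let ?A = "{f \<in> E. f \<noteq> {a, b} \<and> a \<in> f}" and ?B = "{f \<in> E. f \<noteq> {b, a} \<and> b \<in> f}"
  have "{f \<in> E. conflict E {a, b} f} \<subseteq> ?A \<union> (?B \<union> ?O)"
  proof
    fix f assume "f \<in> {f \<in> E. conflict E {a, b} f}"
    then have f: "f \<in> E" "conflict E {a, b} f" by auto
    from f(2) show "f \<in> ?A \<union> (?B \<union> ?O)"
    proof (cases rule: conflict_cases)
      case (3 c d)
      then have "d \<in> X" "c \<in> Y" by (auto simp: X_def Y_def neighborhood_def)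
      moreover have fdc: "f = {d, c}" using 3(1) by (simp add: insert_commute)
      moreover have "{d, c} \<in> E" using f(1) fdc by simp
      ultimately have "{d, c} \<in> ?O" by blast
      then show ?thesis unfolding fdc by (rule UnI2[OF UnI2])
    qed (use f in \<open>auto simp: insert_commute\<close>)
  qed
  moreover have "finite ?O"
    by (rule finite_subset[OF _ S(2)]) auto
  ultimately have "card {f \<in> E. conflict E {a, b} f} \<le> card (?A \<union> (?B \<union> ?O))"
    using S(2) by (intro card_mono) auto
  also have "\<dots> \<le> card ?A + (card ?B + card ?O)"
    by (meson add_left_mono card_Un_le order_trans)
  finally have main: "card {f \<in> E. conflict E {a, b} f} \<le> card ?A + (card ?B + card ?O)" .
  have "card ?A \<le> 86"
    using edges_at[OF G ab] deg(1) by simp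
  moreover have "card ?B \<le> 86"
    using edges_at[OF G, of b a] ab deg(2) by (simp add: insert_commute)
  ultimately show ?thesis
    using main O by linarith
qed

text \<open>A bipartite graph without two disjoint edges is a star.\<close>

lemma no_matching_star:
  assumes "\<And>z w z' w'. (z, w) \<in> Q \<Longrightarrow> (z', w') \<in> Q \<Longrightarrow> z = z' \<or> w = w'"
  shows "(\<exists>z. Q \<subseteq> {z} \<times> UNIV) \<or> (\<exists>w. Q \<subseteq> UNIV \<times> {w})"
proof (rule ccontr)
  assume no: "\<not> ?thesis"
  then have "Q \<noteq> {}" by auto
  then obtain z w where zw: "(z, w) \<in> Q" by (metis equals0I surj_pair)
  have "\<not> Q \<subseteq> {z} \<times> UNIV" "\<not> Q \<subseteq> UNIV \<times> {w}" using no by blast+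
  then obtain z1 w1 z2 w2 where 1: "(z1, w1) \<in> Q" "z1 \<noteq> z" and 2: "(z2, w2) \<in> Q" "w2 \<noteq> w"
    by auto
  have "w1 = w" using assms[OF zw 1(1)] 1(2) by auto
  moreover have "z2 = z" using assms[OF zw 2(1)] 2(2) by auto
  ultimately show False using assms[OF 1(1) 2(1)] 1(2) 2(2) by auto
qed


lemma common_neighbours_le:
  assumes G: "simple_graph V E" and t: "K2t_free t V E" and "u \<noteq> v"
  shows "card {w. {u, w} \<in> E \<and> {v, w} \<in> E} \<le> t - 1"
proof (cases "u \<in> V \<and> v \<in> V")
  case True
  then have "card (neighborhood E u \<inter> neighborhood E v) \<le> t - 1"
    using t assms(3) by (simp add: K2t_free_def)
  moreover have "neighborhood E u \<inter> neighborhood E v = {w. {u, w} \<in> E \<and> {v, w} \<in> E}"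
    by (auto simp: neighborhood_def)
  ultimately show ?thesis by simp
next
  case False
  then have none: "{w. {u, w} \<in> E \<and> {v, w} \<in> E} = {}"
    using simple_graphD(3)[OF G] by blast
  show ?thesis unfolding none by simp
qed

lemma finite_common: 
  assumes "simple_graph V E"
  shows "finite {w. {u, w} \<in> E \<and> {v, w} \<in> E}"
  by (rule finite_subset[OF _ simple_graphD(5)[OF assms, of u]]) (auto simp: neighborhood_def)

lemma card_edges_at_or:
  assumes G: "simple_graph V E" and vx: "{v, x} \<in> E" and D: "degree E x \<le> D"
    and A: "A \<subseteq> {f \<in> E. f \<noteq> {x, v} \<and> x \<in> f} \<union> C" "finite C" "card C \<le> m"
  shows "card A \<le> D - 1 + m"
proof -
  have "card A \<le> card ({f \<in> E. f \<noteq> {x, v} \<and> x \<in> f} \<union> C)"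
    using A simple_graphD(2)[OF G] by (intro card_mono) auto
  also have "\<dots> \<le> card {f \<in> E. f \<noteq> {x, v} \<and> x \<in> f} + card C"
    by (rule card_Un_le)
  also have "\<dots> \<le> (D - 1) + m"
    using edges_at[OF G, of x v] vx D A(3) by (simp add: insert_commute)
  finally show ?thesis .
qed

text \<open>Besides the edges at \<open>x\<close>, only edges \<open>zw\<close> with \<open>z\<close> a small neighbor of \<open>v\<close> and \<open>w\<close> a big neighbor of \<open>x\<close> conflict with \<open>vx\<close>.
If no two of them are disjoint, they form a star. Its leaves are common neighbors of \<open>x\<close> and the
center \<open>z\<close>, or of \<open>v\<close> and the center \<open>w\<close>, so there are at most \<open>t - 1\<close>.\<close>

lemma one_hub_conflicts:
  assumes G: "simple_graph V E" and t: "K2t_free t V E" and deg: "\<And>u. u \<in> V \<Longrightarrow> degree E u \<le> D"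
    and V: "V = S \<union> B" "S \<inter> B = {}" and v: "v \<in> S" "{u \<in> B. {v, u} \<in> E} = {x}"
    and no: "\<And>a a' y y'. a \<in> S \<Longrightarrow> a' \<in> S \<Longrightarrow> y \<in> B \<Longrightarrow> y' \<in> B \<Longrightarrow> {v, a} \<in> E \<Longrightarrow> {v, a'} \<in> E \<Longrightarrow>
      {a, y} \<in> E \<Longrightarrow> {a', y'} \<in> E \<Longrightarrow> y \<noteq> x \<Longrightarrow> y' \<noteq> x \<Longrightarrow> a = a' \<or> y = y'"
  shows "card {f \<in> E. f \<inter> B \<noteq> {} \<and> conflict E {v, x} f} \<le> D - 1 + (t - 1)"
proof -
  note S = simple_graphD[OF G]
  have x: "x \<in> B" "{v, x} \<in> E" "x \<in> V" using v(2) V by auto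
  have vB: "v \<notin> B" "v \<noteq> x" using v(1) V(2) x by auto
  define Q where "Q = {(z, w). z \<in> S \<and> {v, z} \<in> E \<and> w \<in> B \<and> {z, w} \<in> E \<and> w \<noteq> x \<and> {x, w} \<in> E}"
  have "(\<exists>z. Q \<subseteq> {z} \<times> UNIV) \<or> (\<exists>w. Q \<subseteq> UNIV \<times> {w})"
    by (rule no_matching_star) (use no in \<open>auto simp: Q_def\<close>)
  then have Q: "finite Q \<and> card Q \<le> t - 1"
  proof (cases "Q = {}")
    case ne: False
    show ?thesis
      using \<open>(\<exists>z. Q \<subseteq> {z} \<times> UNIV) \<or> (\<exists>w. Q \<subseteq> UNIV \<times> {w})\<close>
    proof (elim disjE exE)
      fix z assume z: "Q \<subseteq> {z} \<times> UNIV"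
      then have "z \<in> S" using ne by (auto simp: Q_def)
      then have "z \<noteq> x" using x V(2) by auto
      have sub: "Q \<subseteq> {z} \<times> {w. {z, w} \<in> E \<and> {x, w} \<in> E}"
        using z by (auto simp: Q_def)
      then have "card Q \<le> card ({z} \<times> {w. {z, w} \<in> E \<and> {x, w} \<in> E})"
        by (rule card_mono[rotated]) (use finite_common[OF G] in simp)
      then show ?thesis
        using common_neighbours_le[OF G t \<open>z \<noteq> x\<close>] finite_subset[OF sub] finite_common[OF G]
        by (simp add: card_cartesian_product)
    next
      fix w assume w: "Q \<subseteq> UNIV \<times> {w}"
      then have "w \<in> B" using ne by (auto simp: Q_def)
      then have "v \<noteq> w" using vB by auto
      have sub: "Q \<subseteq> {z. {v, z} \<in> E \<and> {w, z} \<in> E} \<times> {w}"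
        using w by (auto simp: Q_def insert_commute)
      then have "card Q \<le> card ({z. {v, z} \<in> E \<and> {w, z} \<in> E} \<times> {w})"
        by (rule card_mono[rotated]) (use finite_common[OF G] in simp)
      then show ?thesis
        using common_neighbours_le[OF G t \<open>v \<noteq> w\<close>] finite_subset[OF sub] finite_common[OF G]
        by (simp add: card_cartesian_product)
    qed
  qed simp
  define C where "C = (\<lambda>(z, w). {z, w}) ` Q"
  have C: "finite C" "card C \<le> t - 1"
    using Q card_image_le[of Q "\<lambda>(z, w). {z, w}"] by (auto simp: C_def)
  have cover: "{f \<in> E. f \<inter> B \<noteq> {} \<and> conflict E {v, x} f} \<subseteq> {f \<in> E. f \<noteq> {x, v} \<and> x \<in> f} \<union> C"
  proof
    fix f assume "f \<in> {f \<in> E. f \<inter> B \<noteq> {} \<and> conflict E {v, x} f}"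
    then have f: "f \<in> E" "f \<inter> B \<noteq> {}" "conflict E {v, x} f" by auto
    from f(3) show "f \<in> {f \<in> E. f \<noteq> {x, v} \<and> x \<in> f} \<union> C"
    proof (cases rule: conflict_cases)
      case 1
      obtain p q where "f = {p, q}" using S(6) f(1) by blast
      with 1 obtain w where w: "f = {v, w}" by (auto simp: insert_commute)
      then have "w \<in> {u \<in> B. {v, u} \<in> E}" using f vB by auto
      then have "w = x" using v(2) by simp
      then show ?thesis using 1 w by simp
    next
      case 2
      then show ?thesis using f(1) by (simp add: insert_commute)
    next
      case (3 c d)
      have dx: "d \<noteq> x" "c \<noteq> x" using 3 by auto
      have "d \<notin> B"
      proof
        assume "d \<in> B"
        then have "d \<in> {u \<in> B. {v, u} \<in> E}" using 3 by simp
        then show False using v(2) dx by simp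
      qed
      then have "d \<in> S" "c \<in> B" using S(3)[OF 3(3)] V f(2) 3(1) by auto
      then have "(d, c) \<in> Q" using 3 dx f(1) by (auto simp: Q_def insert_commute)
      moreover have "f = {d, c}" using 3 by auto
      ultimately show ?thesis by (auto simp: C_def)
    qed
  qed
  show ?thesis
    by (rule card_edges_at_or[OF G x(2) deg[OF x(3)] cover C])
qed

text \<open>If all small neighbors of \<open>v\<close> see exactly \<open>x\<close> and \<open>y\<close>, every non-light edge that conflicts with \<open>vx\<close> and avoids \<open>x\<close> joins \<open>y\<close>
to a common neighbor of \<open>x\<close> and \<open>y\<close>.\<close>

lemma two_hubs_conflicts:
  assumes G: "simple_graph V E" and t: "K2t_free t V E" and deg: "\<And>u. u \<in> V \<Longrightarrow> degree E u \<le> D"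
    and V: "V = S \<union> B" "S \<inter> B = {}" and v: "v \<in> S" "{u \<in> B. {v, u} \<in> E} = {x, y}" and xy: "x \<noteq> y"
    and same: "\<And>z. z \<in> S \<Longrightarrow> {v, z} \<in> E \<Longrightarrow> {u \<in> B. {z, u} \<in> E} = {x, y}"
  shows "card {f \<in> E. f \<inter> B \<noteq> {} \<and> conflict E {v, x} f} \<le> D - 1 + (t - 1)"
proof -
  note S = simple_graphD[OF G]
  have x: "x \<in> B" "{v, x} \<in> E" "x \<in> V" "{v, y} \<in> E" using v(2) V by auto
  have vB: "v \<notin> B" using v(1) V(2) by auto
  define C where "C = (\<lambda>w. {y, w}) ` {w. {x, w} \<in> E \<and> {y, w} \<in> E}"
  have C: "finite C" "card C \<le> t - 1"
    using finite_common[OF G, of x y] common_neighbours_le[OF G t xy] 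
      card_image_le[of "{w. {x, w} \<in> E \<and> {y, w} \<in> E}" "\<lambda>w. {y, w}"] by (auto simp: C_def)
  have inC: "{y, w} \<in> C" if "{x, w} \<in> E" "{y, w} \<in> E" for w
    using that by (simp add: C_def)
  have cover: "{f \<in> E. f \<inter> B \<noteq> {} \<and> conflict E {v, x} f} \<subseteq> {f \<in> E. f \<noteq> {x, v} \<and> x \<in> f} \<union> C"
  proof
    fix f assume "f \<in> {f \<in> E. f \<inter> B \<noteq> {} \<and> conflict E {v, x} f}"
    then have f: "f \<in> E" "f \<inter> B \<noteq> {}" "conflict E {v, x} f" by auto
    from f(3) show "f \<in> {f \<in> E. f \<noteq> {x, v} \<and> x \<in> f} \<union> C"
    proof (cases rule: conflict_cases)
      case 1
      obtain p q where "f = {p, q}" using S(6) f(1) by blast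
      with 1 obtain w where w: "f = {v, w}" by (auto simp: insert_commute)
      then have "w \<in> {u \<in> B. {v, u} \<in> E}" using f vB by auto
      then have "w = y" using v(2) 1 w by auto
      then have "f = {y, v}" using w by auto
      then show ?thesis using inC[of v] x by (simp add: insert_commute)
    next
      case 2
      then show ?thesis using f(1) by (simp add: insert_commute)
    next
      case (3 c d)
      have dx: "d \<noteq> x" "c \<noteq> x" using 3 by auto
      show ?thesis
      proof (cases "d \<in> B")
        case True
        then have "d \<in> {u \<in> B. {v, u} \<in> E}" using 3 by simp
        then have "d = y" using v(2) dx by auto
        then have "f = {y, c}" "{y, c} \<in> E" using 3 f(1) by (auto simp: insert_commute)
        then show ?thesis using inC[of c] 3 by simp
      next
        case False
        then have d: "d \<in> S" "c \<in> B" using S(3)[OF 3(3)] V f(2) 3(1) by auto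
        have nb: "{u \<in> B. {d, u} \<in> E} = {x, y}"
          by (rule same) (use d 3 in auto)
        have "c \<in> {u \<in> B. {d, u} \<in> E}" using d 3 f(1) by (auto simp: insert_commute)
        then have "c = y" using nb dx by auto
        moreover have "{d, x} \<in> E" "{d, y} \<in> E" using nb by auto
        ultimately show ?thesis using inC[of d] 3 by (simp add: insert_commute)
      qed
    qed
  qed
  show ?thesis
    by (rule card_edges_at_or[OF G x(2) deg[OF x(3)] cover C])
qed

text \<open>Otherwise the graph satisfies the conditions of an irreducible graph, and the degrees of its big vertices, each
at least 88, contradict the bound on their sum.\<close>

lemma reducible_vertex:
  fixes V :: "'a set"
  assumes G: "simple_graph V E" and K: "K33_free V (\<lambda>u v. {u, v} \<in> E)" and t: "K2t_free t V E"
    and deg: "\<And>u. u \<in> V \<Longrightarrow> degree E u \<le> D" and ne: "V \<noteq> {}"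
  defines "B \<equiv> {v \<in> V. 87 < degree E v}"
  shows "\<exists>v\<in>V - B. \<forall>x\<in>B. {v, x} \<in> E \<longrightarrow>
    card {f \<in> E. f \<inter> B \<noteq> {} \<and> conflict E {v, x} f} \<le> D - 1 + (t - 1)"
proof (rule ccontr)
  note Sg = simple_graphD[OF G]
  define S where "S = V - B"
  let ?N = "\<lambda>v. {x \<in> B. {v, x} \<in> E}"
  assume irreducible: "\<not> ?thesis"
  then have irr: "\<exists>x\<in>B. {v, x} \<in> E \<and> \<not> card {f \<in> E. f \<inter> B \<noteq> {} \<and> conflict E {v, x} f} \<le> D - 1 + (t - 1)"
    if "v \<in> S" for v
    using that unfolding S_def by blast
  have V: "V = S \<union> B" "S \<inter> B = {}"
    by (auto simp: S_def B_def)
  have fin: "finite S" "finite B"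
    using Sg(1) by (auto simp: S_def B_def)
  have none: "?N v \<noteq> {}" if "v \<in> S" for v
    using irr[OF that] by blast
  have "B \<noteq> {}"
    using none ne V by blast
  have loop: "{u, u} \<notin> E" for u
    using Sg(3)[of u u] by blast
  have "(\<Sum>x\<in>B. card {v \<in> S \<union> B. {x, v} \<in> E}) < 88 * card B"
  proof (rule irreducible_graph.big_degrees[where hub_nbrs = ?N], unfold_locales)
    fix v assume v: "v \<in> S" "card (?N v) = 1"
    then obtain x where x: "?N v = {x}" by (auto simp: card_1_singleton_iff)
    show "\<exists>a\<in>S. \<exists>a'\<in>S. \<exists>y\<in>?N a. \<exists>y'\<in>?N a'. {v, a} \<in> E \<and> {v, a'} \<in> E \<and> a \<noteq> a' \<and> y \<noteq> y' \<and>
        y \<notin> ?N v \<and> y' \<notin> ?N v"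
    proof (rule ccontr)
      assume no: "\<not> ?thesis"
      have "card {f \<in> E. f \<inter> B \<noteq> {} \<and> conflict E {v, x} f} \<le> D - 1 + (t - 1)"
      proof (rule one_hub_conflicts[OF G t deg V v(1) x])
        fix a a' y y'
        assume a: "a \<in> S" "a' \<in> S" "y \<in> B" "y' \<in> B" "{v, a} \<in> E" "{v, a'} \<in> E"
          "{a, y} \<in> E" "{a', y'} \<in> E" "y \<noteq> x" "y' \<noteq> x"
        then have "y \<in> ?N a" "y' \<in> ?N a'" "y \<notin> ?N v" "y' \<notin> ?N v"
          unfolding x by auto
        then show "a = a' \<or> y = y'"
          using no a by blast
      qed
      moreover have "x' = x" if "x' \<in> B" "{v, x'} \<in> E" for x'
        using x that by blast
      ultimately show False using irr[OF v(1)] by blast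
    qed
  next
    fix v assume v: "v \<in> S" "card (?N v) = 2"
    then obtain x y where xy: "?N v = {x, y}" "x \<noteq> y" by (auto simp: card_2_iff)
    show "\<exists>z\<in>S. {v, z} \<in> E \<and> ?N z \<noteq> ?N v"
    proof (rule ccontr)
      assume no: "\<not> ?thesis"
      have 1: "card {f \<in> E. f \<inter> B \<noteq> {} \<and> conflict E {v, x} f} \<le> D - 1 + (t - 1)"
        by (rule two_hubs_conflicts[OF G t deg V v(1) xy]) (use no xy in blast)+
      have yx: "?N v = {y, x}" "y \<noteq> x" using xy by auto
      have 2: "card {f \<in> E. f \<inter> B \<noteq> {} \<and> conflict E {v, y} f} \<le> D - 1 + (t - 1)"
        by (rule two_hubs_conflicts[OF G t deg V v(1) yx]) (use no yx in blast)+
      have "x' = x \<or> x' = y" if "x' \<in> B" "{v, x'} \<in> E" for x'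
        using xy(1) that by blast
      then show False using irr[OF v(1)] 1 2 by blast
    qed
  qed (use fin V K \<open>B \<noteq> {}\<close> none loop in \<open>simp_all add: insert_commute\<close>)
  moreover have "{v \<in> S \<union> B. {x, v} \<in> E} = neighborhood E x" for x
    using V Sg(3) by (auto simp: neighborhood_def)
  then have "(\<Sum>x\<in>B. card {v \<in> S \<union> B. {x, v} \<in> E}) = (\<Sum>x\<in>B. degree E x)"
    by (simp add: degree_def)
  moreover have "(\<Sum>x\<in>B. 88) \<le> (\<Sum>x\<in>B. degree E x)"
    by (rule sum_mono) (simp add: B_def)
  ultimately show False by simp
qed

text \<open>The induction keeps the number \<open>D\<close> fixed, so that deleting a vertex does not decrease the number of colors.\<close>

theorem conflict_free_colouring:
  fixes V :: "'a set"
  assumes "simple_graph V E" "K33_free V (\<lambda>u v. {u, v} \<in> E)" "K2t_free t V E"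
    "\<And>u. u \<in> V \<Longrightarrow> degree E u \<le> D" "428 < D" "2 \<le> t"
  shows "\<exists>c. conflict_free E E c \<and> c ` E \<subseteq> {..<D + t - 1}"
  using assms(1-4)
proof (induction "card V" arbitrary: V E rule: less_induct)
  case less
  note G = less.prems(1) and K = less.prems(2) and t = less.prems(3) and deg = less.prems(4)
  note Sg = simple_graphD[OF G]
  let ?q = "D + t - 1"
  show ?case
  proof (cases "V = {}")
    case True
    then have "E = {}" using Sg(6) Sg(3) by blast
    then show ?thesis by (simp add: conflict_free_def)
  next
    case False
    define B where "B = {v \<in> V. 87 < degree E v}"
    obtain v where v: "v \<in> V" "v \<notin> B" and few: "\<And>x. x \<in> B \<Longrightarrow> {v, x} \<in> E \<Longrightarrow>
        card {f \<in> E. f \<inter> B \<noteq> {} \<and> conflict E {v, x} f} \<le> D - 1 + (t - 1)"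
      using reducible_vertex[OF G K t deg False] unfolding B_def by blast
    define E' where "E' = {e \<in> E. v \<notin> e}"
    have sub: "neighborhood E' u \<subseteq> neighborhood E u" for u
      by (auto simp: neighborhood_def E'_def)
    have "\<exists>c. conflict_free E' E' c \<and> c ` E' \<subseteq> {..<?q}"
    proof (rule less.hyps)
      show "card (V - {v}) < card V" using v Sg(1) by (meson card_Diff1_less)
      show "simple_graph (V - {v}) E'" using G by (auto simp: simple_graph_def E'_def)
      show "K33_free (V - {v}) (\<lambda>u v. {u, v} \<in> E')"
        by (rule K33_free_subgraph[OF K]) (auto simp: E'_def)
      show "K2t_free t (V - {v}) E'"
        unfolding K2t_free_def
      proof (intro ballI impI)
        fix x y assume xy: "x \<in> V - {v}" "y \<in> V - {v}" "x \<noteq> y"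
        have "card (neighborhood E' x \<inter> neighborhood E' y) \<le> card (neighborhood E x \<inter> neighborhood E y)"
          by (rule card_mono) (use sub Sg(5) in auto)
        then show "card (neighborhood E' x \<inter> neighborhood E' y) \<le> t - 1"
          using t xy unfolding K2t_free_def by fastforce
      qed
      show "degree E' u \<le> D" if "u \<in> V - {v}" for u
      proof -
        have "degree E' u \<le> degree E u"
          unfolding degree_def by (rule card_mono[OF Sg(5) sub])
        then show ?thesis using deg[of u] that by simp
      qed
    qed
    then obtain c where c: "conflict_free E' E' c" "c ` E' \<subseteq> {..<?q}" by blast
    \<comment> \<open>All vertices of a 4-cycle lie on any two of its opposite edges, so no conflict is lost.\<close>
    have conflict': "conflict E' e f" if ef: "e \<in> E'" "f \<in> E'" "conflict E e f" for e f
    proof (cases "e \<inter> f = {}")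
      case True
      then obtain p q r s where "e = {p, q}" "f = {r, s}" "{q, r} \<in> E" "{s, p} \<in> E"
        using ef(3) unfolding conflict_def by blast
      moreover from this have "{q, r} \<in> E'" "{s, p} \<in> E'"
        using ef(1,2) by (auto simp: E'_def)
      ultimately show ?thesis
        using ef(3) unfolding conflict_def by blast
    next
      case False
      then show ?thesis using ef(3) unfolding conflict_def by blast
    qed
    define H where "H = {e \<in> E. e \<inter> B \<noteq> {}}"
    define F where "F = (\<lambda>x. {v, x}) ` {x \<in> B. {v, x} \<in> E}"
    have H: "(H \<inter> E') \<union> F = H"
    proof
      show "H \<inter> E' \<union> F \<subseteq> H" by (auto simp: H_def F_def)
      show "H \<subseteq> H \<inter> E' \<union> F"
      proof
        fix e assume e: "e \<in> H"
        then have eE: "e \<in> E" "e \<inter> B \<noteq> {}" by (auto simp: H_def)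
        obtain p q where pq: "e = {p, q}" using Sg(6) eE(1) by blast
        show "e \<in> H \<inter> E' \<union> F"
        proof (cases "v \<in> e")
          case True
          then obtain w where w: "e = {v, w}" using pq by (auto simp: insert_commute)
          then have "w \<in> B" using eE v(2) by auto
          then show ?thesis using w eE by (auto simp: F_def)
        next
          case False
          then show ?thesis using e eE by (simp add: E'_def)
        qed
      qed
    qed
    have "\<exists>c. conflict_free E ((H \<inter> E') \<union> F) c \<and> c ` ((H \<inter> E') \<union> F) \<subseteq> {..<?q}"
    proof (rule greedy_extension[where D = H])
      show "conflict_free E (H \<inter> E') c"
        unfolding conflict_free_def
      proof (intro ballI impI)
        fix e f assume ef: "e \<in> H \<inter> E'" "f \<in> H \<inter> E'" "conflict E e f"
        then have "conflict E' e f" using conflict' by simp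
        then show "c e \<noteq> c f" using c(1) ef by (simp add: conflict_free_def)
      qed
      show "c ` (H \<inter> E') \<subseteq> {..<?q}" using c(2) by auto
      show "finite H" using Sg(2) by (simp add: H_def)
      show "H \<inter> E' \<union> F \<subseteq> H" using H by simp
      fix e assume "e \<in> F"
      then obtain x where x: "e = {v, x}" "x \<in> B" "{v, x} \<in> E" by (auto simp: F_def)
      have "{f \<in> H. conflict E e f} = {f \<in> E. f \<inter> B \<noteq> {} \<and> conflict E {v, x} f}"
        by (auto simp: H_def x(1))
      then show "card {f \<in> H. conflict E e f} < ?q"
        using few[OF x(2,3)] assms(5,6) by simp
    qed
    then obtain c1 where c1: "conflict_free E H c1" "c1 ` H \<subseteq> {..<?q}"
      unfolding H by blast
    have "\<exists>c. conflict_free E (H \<union> (E - H)) c \<and> c ` (H \<union> (E - H)) \<subseteq> {..<?q}"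
    proof (rule greedy_extension[OF c1 Sg(2)])
      show "H \<union> (E - H) \<subseteq> E" by (auto simp: H_def)
      fix e assume e: "e \<in> E - H"
      then obtain a b where ab: "e = {a, b}" using Sg(6) by blast
      have "{a, b} \<in> E" using e ab by simp
      then have "a \<in> V" "b \<in> V" using Sg(3) by blast+
      moreover have "a \<notin> B" "b \<notin> B" using e ab by (auto simp: H_def)
      ultimately have "degree E a \<le> 87" "degree E b \<le> 87" by (auto simp: B_def)
      from light_edge_conflicts[OF G K \<open>{a, b} \<in> E\<close> this]
      show "card {f \<in> E. conflict E e f} < ?q"
        using assms(5,6) unfolding ab by simp
    qed
    moreover have "H \<union> (E - H) = E" by (auto simp: H_def)
    ultimately show ?thesis by simp
  qed
qed

section \<open>The B-coloring number\<close>

theorem theoremB: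
  fixes t :: nat and V :: "'a set" and E :: "'a set set"
  assumes "t \<ge> 2"
    and "simple_graph V E"
    and "planar V E"
    and "K2t_free t V E"
    and "max_degree V E > 428"
  shows "B_coloring_number E \<le> max_degree V E + t - 1"
proof -
  have "degree E u \<le> max_degree V E" if "u \<in> V" for u
    unfolding max_degree_def
    by (rule Max_ge) (use simple_graphD(1)[OF assms(2)] that in auto)
  then obtain c where "conflict_free E E c" "c ` E \<subseteq> {..<max_degree V E + t - 1}"
    using conflict_free_colouring[OF assms(2) planar_imp_K33_free[OF assms(2,3)] assms(4) _ assms(5,1)]
    by blast
  then have "\<exists>c. B_coloring E c \<and> c ` E \<subseteq> {..<max_degree V E + t - 1}"
    using conflict_free_B_coloring by blast
  then show ?thesis
    unfolding B_coloring_number_def by (rule Least_le)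
qed

end
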